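(* Let $(\Omega^{(\bullet,\bullet)},\bar\partial,\partial,\kappa)$ be a positive definite ($A$-covariant) Kähler structure over $M$, of total dimension $2n$, and let $\mathbf f$ be a state on $M$ such that the integral $\int=\mathbf f\circ\mathrm{vol}_\kappa$ is closed. Let $(\mathcal F,\bar\partial_{\mathcal F})$ be a left holomorphic vector bundle with a positive definite Hermitian structure $h$ such that the Kähler structure on $\Omega^\bullet\otimes_M\mathcal F$ is diagonalisable. Then there is a (well-defined) non-degenerate bilinear pairing given by $$H^{(a,b)}_{\bar\partial_{\mathcal F}}\otimes H^{(n-a,n-b)}_{\bar\partial_{{}^\vee\mathcal F}}\to\mathbb C,\qquad ([\alpha],[\beta])\mapsto\int\alpha\wedge_{\mathrm{ev}}\beta .$$
   Context: **Calculi.** Everything is over $\mathbb C$. $A$ is a fixed Hopf $*$-algebra ($A=\mathbb C$, i.e. no covariance, is allowed); left coactions are written $v\mapsto v_{(-1)}\otimes v_{(0)}$. An $A$-comodule $*$-algebra is a unital $*$-algebra $M$ with a left $A$-coaction that is an algebra map and commutes with $*$. An $A$-covariant differential $*$-calculus over $M$ is a graded algebra $\Omega^\bullet=\bigoplus_{k\ge 0}\Omega^k$ (product $\wedge$) with $\Omega^0=M$, a degree one map $d$ with $d^2=0$ satisfying the graded Leibniz rule, generated by $M$ as a dg algebra, with a conjugate-linear involution $*$ extending that of $M$, $(d\omega)^*=d(\omega^* )$, $(\omega\wedge\nu)^*=(-1)^{|\omega||\nu|}\nu^*\wedge\omega^*$, and a graded left $A$-coaction compatible with product, $d$ and $*$.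 A complex structure is an algebra $\mathbb N_0^2$-grading $\Omega^{(a,b)}$ with $\Omega^k=\bigoplus_{a+b=k}\Omega^{(a,b)}$ (as $A$-comodules and $M$-bimodules), $(\Omega^{(a,b)})^*=\Omega^{(b,a)}$ and $d=\partial+\bar\partial$, where $\partial,\bar\partial$ are the components of $d$ of bidegree $(1,0),(0,1)$. **Kähler structures.** Let $\Omega^\bullet$ have total dimension $2n$ ($\Omega^{2n}\neq0$, $\Omega^k=0$ for $k>2n$). A Kähler structure is a complex structure together with a closed, central, real ($\kappa^*=\kappa$), $A$-coinvariant form $\kappa\in\Omega^{(1,1)}$ such that, for $L(\omega)=\kappa\wedge\omega$, the maps $L^{n-k}:\Omega^k\to\Omega^{2n-k}$ are isomorphisms for $0\le k<n$. Put $P^k=\{\alpha\in\Omega^k: L^{n-k+1}\alpha=0\}$ for $k\le n$, $P^k=0$ for $k>n$, and $P^{(a,b)}=P^{a+b}\cap\Omega^{(a,b)}$. The Hodge map $\ast_H:\Omega^\bullet\to\Omega^\bullet$ is the linear map determined by $$\ast_H(L^j\alpha)=(-1)^{\frac{k(k+1)}2}i^{a-b}\frac{j!}{(n-j-k)!}L^{n-j-k}(\alpha),\qquad \alpha\in P^{(a,b)},\ k=a+b,\ 0\le j\le n-k.$$ $\mathrm{vol}_\kappa=\ast_H|_{\Omega^{2n}}:\Omega^{2n}\to M$ (extended by $0$ to lower degrees). **Bundles.** A vector bundle $\mathcal F$ is a left $M$-module, finitely generated projective, with a compatible left $A$-coaction; ${}^\vee\mathcal F$ is the right $M$-module of left $M$-linear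 maps $\mathcal F\to M$ (with coaction $\phi_{(-1)}\otimes\phi_{(0)}(f)=S(f_{(-1)})\phi(f_{(0)})_{(-1)}\otimes\phi(f_{(0)})_{(0)}$). A left holomorphic structure is an $A$-comodule map $\bar\partial_{\mathcal F}:\mathcal F\to\Omega^{(0,1)}\otimes_M\mathcal F$ with $\bar\partial_{\mathcal F}(mf)=\bar\partial m\otimes f+m\bar\partial_{\mathcal F}f$ whose extension $\bar\partial_{\mathcal F}(\omega\otimes f)=\bar\partial\omega\otimes f+(-1)^{|\omega|}\omega\wedge\bar\partial_{\mathcal F}f$ to $\Omega^\bullet\otimes_M\mathcal F$ squares to zero. The evaluation pairing is $(\omega\otimes f)\wedge_{\mathrm{ev}}(\phi\otimes\nu)=\omega\,\phi(f)\wedge\nu$. The dual holomorphic structure $\bar\partial_{{}^\vee\mathcal F}:{}^\vee\mathcal F\to{}^\vee\mathcal F\otimes_M\Omega^{(0,1)}$ is determined by $f\wedge_{\mathrm{ev}}\bar\partial_{{}^\vee\mathcal F}(\phi)=\bar\partial(\phi(f))-\bar\partial_{\mathcal F}(f)\wedge_{\mathrm{ev}}\phi$ and extended to ${}^\vee\mathcal F\otimes_M\Omega^\bullet$ by $\bar\partial_{{}^\vee\mathcal F}(\phi\otimes\omega)=\bar\partial_{{}^\vee\mathcal F}(\phi)\wedge\omega+\phi\otimes\bar\partial\omega$. $H^{(a,b)}_{\bar\partial_{\mathcal F}}$ and $H^{(a,b)}_{\bar\partial_{{}^\vee\mathcal F}}$ are the cohomologies of $\bar\partial_{\mathcal F}$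 at $\Omega^{(a,b)}\otimes_M\mathcal F$ and of $\bar\partial_{{}^\vee\mathcal F}$ at ${}^\vee\mathcal F\otimes_M\Omega^{(a,b)}$. A Hermitian structure is an isomorphism of right $M$-modules and $A$-comodules $h:\overline{\mathcal F}\to{}^\vee\mathcal F$ with $h(\overline f)(g)=h(\overline g)(f)^*$; here $\overline{\mathcal F}$ is the conjugate vector space with $\overline f\,m=\overline{m^*f}$ and coaction $\overline f\mapsto (f_{(-1)})^*\otimes\overline{f_{(0)}}$. **Metric and diagonalisability.** Put $\bar\ast_{\mathcal F}(\omega\otimes f)=h(\overline f)\otimes\ast_H(\omega^* )$ and $g_{\mathcal F}(\alpha,\beta)=\mathrm{vol}_\kappa(\alpha\wedge_{\mathrm{ev}}\bar\ast_{\mathcal F}\beta)\in M$. $M_{>0}$ is the set of non-zero finite sums $\sum\lambda_i m_im_i^*$ with $\lambda_i\ge0$. The Kähler structure is positive definite if $\mathrm{vol}_\kappa(\omega\wedge\ast_H(\omega^* ))\in M_{>0}$ for all non-zero $\omega\in\Omega^\bullet$; $h$ is positive definite if $h(\overline f)(f)\in M_{>0}$ for all non-zero $f$. A state is a unital linear functional $\mathbf f:M\to\mathbb C$ with $\mathbf f(M_{>0})\subseteq\mathbb R_{>0}$. The integral $\int=\mathbf f\circ\mathrm{vol}_\kappa$ is closed if $\int d\omega=0$ for all $\omega\in\Omega^{2n-1}$. $\langle\alpha,\beta\rangle_{\mathcal F}=\mathbf f(g_{\mathcal F}(\alpha,\beta))$ is an inner product for which $\bar\partial_{\mathcal F}$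 has an adjoint $\bar\partial_{\mathcal F}^\dagger$; the Kähler structure on $\Omega^\bullet\otimes_M\mathcal F$ is diagonalisable if $\bar\partial_{\mathcal F}+\bar\partial_{\mathcal F}^\dagger$ is diagonalisable as a $\mathbb C$-linear operator. *)

theory Defs
  imports Complex_Main "HOL-Library.Function_Algebras"
begin

section \<open>Complex vector spaces and complex *-algebras\<close>

class complex_vector = ab_group_add +
  fixes scaleC :: "complex \<Rightarrow> 'a \<Rightarrow> 'a" (infixr "*\<^sub>C" 75)
  assumes scaleC_add_right: "c *\<^sub>C (x + y) = c *\<^sub>C x + c *\<^sub>C y"
    and scaleC_add_left: "(c + c') *\<^sub>C x = c *\<^sub>C x + c' *\<^sub>C x"
    and scaleC_scaleC: "c *\<^sub>C c' *\<^sub>C x = (c * c') *\<^sub>C x"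
    and scaleC_one: "1 *\<^sub>C x = x"

class complex_algebra_1 = complex_vector + ring_1 +
  assumes mult_scaleC_left: "(c *\<^sub>C x) * y = c *\<^sub>C (x * y)"
    and mult_scaleC_right: "x * (c *\<^sub>C y) = c *\<^sub>C (x * y)"

class complex_star_algebra = complex_algebra_1 +
  fixes star :: "'a \<Rightarrow> 'a"
  assumes star_add: "star (x + y) = star x + star y"
    and star_scaleC: "star (c *\<^sub>C x) = cnj c *\<^sub>C star x"
    and star_mult: "star (x * y) = star y * star x"
    and star_star: "star (star x) = x"

instantiation complex :: complex_star_algebra
begin
definition scaleC_complex :: "complex \<Rightarrow> complex \<Rightarrow> complex" where "scaleC_complex c x = c * x"
definition star_complex :: "complex \<Rightarrow> complex" where "star_complex = cnj"
instance by standard (simp_all add: scaleC_complex_def star_complex_def algebra_simps)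
end

instantiation "fun" :: (type, complex_vector) complex_vector
begin
definition scaleC_fun :: "complex \<Rightarrow> ('a \<Rightarrow> 'b) \<Rightarrow> 'a \<Rightarrow> 'b"
  where "scaleC_fun c f = (\<lambda>x. c *\<^sub>C f x)"
instance by standard
    (simp_all add: scaleC_fun_def fun_eq_iff scaleC_add_right scaleC_add_left scaleC_scaleC scaleC_one)
end

interpretation cvec: vector_space "scaleC :: complex \<Rightarrow> 'a \<Rightarrow> 'a::complex_vector"
  by standard (simp_all add: scaleC_add_right scaleC_add_left scaleC_scaleC scaleC_one)

abbreviation clinear :: "('v::complex_vector \<Rightarrow> 'w::complex_vector) \<Rightarrow> bool"
  where "clinear \<equiv> Vector_Spaces.linear scaleC scaleC"

definition internal_direct_sum :: "'v::complex_vector set \<Rightarrow> 'i set \<Rightarrow> ('i \<Rightarrow> 'v set) \<Rightarrow> bool"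
  where "internal_direct_sum V I U \<longleftrightarrow>
    (\<forall>i\<in>I. cvec.subspace (U i) \<and> U i \<subseteq> V) \<and>
    (\<forall>v\<in>V. \<exists>!c. (\<forall>i\<in>I. c i \<in> U i) \<and> (\<forall>i. i \<notin> I \<longrightarrow> c i = 0) \<and>
       finite {i. c i \<noteq> 0} \<and> v = (\<Sum>i | c i \<noteq> 0. c i))"

text \<open>The \<open>i\<close>-th component of a vector with respect to a direct sum decomposition of the whole space.\<close>

definition component :: "('i \<Rightarrow> 'v::complex_vector set) \<Rightarrow> 'i \<Rightarrow> 'v \<Rightarrow> 'v"
  where "component U i v =
    (THE c. (\<forall>j. c j \<in> U j) \<and> finite {j. c j \<noteq> 0} \<and> v = (\<Sum>j | c j \<noteq> 0. c j)) i"


section \<open>Tensor products\<close>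

text \<open>
  Let \<open>V\<close> (a subspace of a type) be a right and \<open>W\<close> (a whole type) a left module over a complex
  algebra.  The dual space of \<open>V \<otimes> W\<close> (tensor product over that algebra) is the space of balanced
  bilinear forms on \<open>V \<times> W\<close>, and these forms separate the points of \<open>V \<otimes> W\<close>.  The tensor product
  is therefore realised inside the dual of the space of balanced bilinear forms, as the span of the
  evaluations \<open>b \<mapsto> b v w\<close>.  Its universal property is \<open>tens_lift_sum\<close> below.
\<close>

type_synonym ('v, 'w) tensor = "('v \<Rightarrow> 'w \<Rightarrow> complex) \<Rightarrow> complex"

definition balanced_form ::
  "'v::complex_vector set \<Rightarrow> ('v \<Rightarrow> 'r \<Rightarrow> 'v) \<Rightarrow> ('r \<Rightarrow> 'w::complex_vector \<Rightarrow> 'w) \<Rightarrow>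
   ('v \<Rightarrow> 'w \<Rightarrow> complex) \<Rightarrow> bool"
  where "balanced_form V ract lact b \<longleftrightarrow>
    (\<forall>v\<in>V. \<forall>v'\<in>V. \<forall>w. b (v + v') w = b v w + b v' w) \<and>
    (\<forall>v\<in>V. \<forall>w w'. b v (w + w') = b v w + b v w') \<and>
    (\<forall>c. \<forall>v\<in>V. \<forall>w. b (c *\<^sub>C v) w = c * b v w \<and> b v (c *\<^sub>C w) = c * b v w) \<and>
    (\<forall>v\<in>V. \<forall>r w. b (ract v r) w = b v (lact r w))"

definition tens ::
  "'v::complex_vector set \<Rightarrow> ('v \<Rightarrow> 'r \<Rightarrow> 'v) \<Rightarrow> ('r \<Rightarrow> 'w::complex_vector \<Rightarrow> 'w) \<Rightarrow>
   'v \<Rightarrow> 'w \<Rightarrow> ('v, 'w) tensor"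
  where "tens V ract lact v w = (\<lambda>b. if balanced_form V ract lact b then b v w else 0)"

text \<open>
  The additive map sending each \<open>v \<otimes> w\<close> to \<open>\<beta> v w\<close>.  It is defined whenever \<open>\<beta>\<close> is biadditive and
  balanced, both over the algebra and over the complex numbers; \<open>\<beta>\<close> may thus also be conjugate-linear
  in both arguments.
\<close>

definition tens_lift ::
  "'v::complex_vector set \<Rightarrow> ('v \<Rightarrow> 'r \<Rightarrow> 'v) \<Rightarrow> ('r \<Rightarrow> 'w::complex_vector \<Rightarrow> 'w) \<Rightarrow>
   ('v \<Rightarrow> 'w \<Rightarrow> 'x::complex_vector) \<Rightarrow> ('v, 'w) tensor \<Rightarrow> 'x"
  where "tens_lift V ract lact \<beta> x =
    (THE y. \<exists>(N::nat) v w. (\<forall>i<N. v i \<in> V) \<and>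
       x = (\<Sum>i<N. tens V ract lact (v i) (w i)) \<and> y = (\<Sum>i<N. \<beta> (v i) (w i)))"

lemma tens_balanced:
  assumes "v \<in> V"
  shows "tens V ract lact (ract v r) w = tens V ract lact v (lact r w)"
  using assms by (auto simp: tens_def balanced_form_def fun_eq_iff)

lemma sum_fun_apply: "(\<Sum>i\<in>I. f i) x = (\<Sum>i\<in>I. f i x)" for f :: "'i \<Rightarrow> 'b \<Rightarrow> 'c::comm_monoid_add"
  by (induction I rule: infinite_finite_induct) auto

lemma separating_functional:
  fixes y :: "'x::complex_vector"
  assumes "y \<noteq> 0"
  shows "\<exists>l :: 'x \<Rightarrow> complex. clinear l \<and> l y \<noteq> 0"
proof -
  interpret p: vector_space_pair "scaleC :: complex \<Rightarrow> 'x \<Rightarrow> 'x"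
    "scaleC :: complex \<Rightarrow> complex \<Rightarrow> complex" ..
  have "cvec.independent {y}" using assms by simp
  from p.linear_independent_extend[OF this, of "\<lambda>_. 1"] show ?thesis by auto
qed

lemma tens_lift_sum:
  fixes \<beta> :: "'v::complex_vector \<Rightarrow> 'w::complex_vector \<Rightarrow> 'x::complex_vector"
  assumes add: "\<And>v v' w. v \<in> V \<Longrightarrow> v' \<in> V \<Longrightarrow> \<beta> (v + v') w = \<beta> v w + \<beta> v' w"
      "\<And>v w w'. v \<in> V \<Longrightarrow> \<beta> v (w + w') = \<beta> v w + \<beta> v w'"
    and s: "s = id \<or> s = cnj"
    and scale: "\<And>c v w. v \<in> V \<Longrightarrow> \<beta> (c *\<^sub>C v) w = s c *\<^sub>C \<beta> v w"
      "\<And>c v w. v \<in> V \<Longrightarrow> \<beta> v (c *\<^sub>C w) = s c *\<^sub>C \<beta> v w"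
    and bal: "\<And>v r w. v \<in> V \<Longrightarrow> \<beta> (ract v r) w = \<beta> v (lact r w)"
    and V: "\<forall>i<N. v i \<in> V"
  shows "tens_lift V ract lact \<beta> (\<Sum>i<N. tens V ract lact (v i) (w i)) = (\<Sum>i<(N::nat). \<beta> (v i) (w i))"
  unfolding tens_lift_def
proof (rule the_equality)
  show "\<exists>(N'::nat) v' w'. (\<forall>i<N'. v' i \<in> V) \<and>
      (\<Sum>i<N. tens V ract lact (v i) (w i)) = (\<Sum>i<N'. tens V ract lact (v' i) (w' i)) \<and>
      (\<Sum>i<N. \<beta> (v i) (w i)) = (\<Sum>i<N'. \<beta> (v' i) (w' i))"
    using V by blast
next
  fix y
  assume "\<exists>(N'::nat) v' w'. (\<forall>i<N'. v' i \<in> V) \<and>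
      (\<Sum>i<N. tens V ract lact (v i) (w i)) = (\<Sum>i<N'. tens V ract lact (v' i) (w' i)) \<and>
      y = (\<Sum>i<N'. \<beta> (v' i) (w' i))"
  then obtain N' :: nat and v' w' where V': "\<forall>i<N'. v' i \<in> V"
    and eq: "(\<Sum>i<N. tens V ract lact (v i) (w i)) = (\<Sum>i<N'. tens V ract lact (v' i) (w' i))"
    and y: "y = (\<Sum>i<N'. \<beta> (v' i) (w' i))" by blast
  have same: "l y = l (\<Sum>i<N. \<beta> (v i) (w i))" if l: "clinear l" for l :: "'x \<Rightarrow> complex"
  proof -
    interpret l: Vector_Spaces.linear scaleC scaleC l by (rule l)
    have ss: "s (s c) = c" "s (c + c') = s c + s c'" "s (c * c') = s c * s c'" for c c'
      using s by auto
    have s_inj: "s c = s c' \<Longrightarrow> c = c'" for c c' using ss(1) by metis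
    have s_sum: "s (\<Sum>i\<in>I. g i) = (\<Sum>i\<in>I. s (g i))" for g :: "nat \<Rightarrow> complex" and I
      using s by auto
    let ?b = "\<lambda>v w. s (l (\<beta> v w))"
    have b: "balanced_form V ract lact ?b"
      unfolding balanced_form_def
      by (auto simp: add scale bal l.add l.scale ss scaleC_complex_def)
    have "(\<Sum>i<N. ?b (v i) (w i)) = (\<Sum>i<N'. ?b (v' i) (w' i))"
      using fun_cong[OF eq, of ?b] b by (simp add: sum_fun_apply tens_def)
    then have "(\<Sum>i<N. l (\<beta> (v i) (w i))) = (\<Sum>i<N'. l (\<beta> (v' i) (w' i)))"
      by (auto simp: s_sum[symmetric] dest: s_inj)
    then show ?thesis by (simp add: y l.sum)
  qed
  show "y = (\<Sum>i<N. \<beta> (v i) (w i))"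
  proof (rule ccontr)
    assume "y \<noteq> (\<Sum>i<N. \<beta> (v i) (w i))"
    then obtain l :: "'x \<Rightarrow> complex" where l: "clinear l" "l (y - (\<Sum>i<N. \<beta> (v i) (w i))) \<noteq> 0"
      using separating_functional[of "y - (\<Sum>i<N. \<beta> (v i) (w i))"] by auto
    interpret l: Vector_Spaces.linear scaleC scaleC l by (rule l(1))
    show False using same[OF l(1)] l(2) by (simp add: l.diff)
  qed
qed

text \<open>Tensor products over the complex numbers.\<close>

definition tensC :: "'v::complex_vector \<Rightarrow> 'w::complex_vector \<Rightarrow> ('v, 'w) tensor" (infixr "\<otimes>" 72)
  where "v \<otimes> w = tens UNIV (\<lambda>v c. c *\<^sub>C v) scaleC v w"

definition liftC ::
  "('v::complex_vector \<Rightarrow> 'w::complex_vector \<Rightarrow> 'x::complex_vector) \<Rightarrow> ('v, 'w) tensor \<Rightarrow> 'x"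
  where "liftC = tens_lift UNIV (\<lambda>v c. c *\<^sub>C v) scaleC"

definition tensC_space :: "'v::complex_vector set \<Rightarrow> 'w::complex_vector set \<Rightarrow> ('v, 'w) tensor set"
  where "tensC_space V W = cvec.span {v \<otimes> w | v w. v \<in> V \<and> w \<in> W}"

definition tensC_mult ::
  "('v::complex_algebra_1, 'w::complex_algebra_1) tensor \<Rightarrow> ('v, 'w) tensor \<Rightarrow> ('v, 'w) tensor"
  where "tensC_mult x y = liftC (\<lambda>a v. liftC (\<lambda>b w. (a * b) \<otimes> (v * w)) y) x"


section \<open>Hopf *-algebras and comodules\<close>

record 'a hopf =
  comult :: "'a \<Rightarrow> ('a, 'a) tensor"
  counit :: "'a \<Rightarrow> complex"
  antipode :: "'a \<Rightarrow> 'a"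

definition hopf_star_algebra :: "'a::complex_star_algebra hopf \<Rightarrow> bool"
  where "hopf_star_algebra H \<longleftrightarrow>
    clinear (comult H) \<and> (\<forall>x. comult H x \<in> tensC_space UNIV UNIV) \<and>
    comult H 1 = 1 \<otimes> 1 \<and> (\<forall>x y. comult H (x * y) = tensC_mult (comult H x) (comult H y)) \<and>
    clinear (counit H) \<and> counit H 1 = 1 \<and> (\<forall>x y. counit H (x * y) = counit H x * counit H y) \<and>
    (\<forall>x. liftC (\<lambda>a b. liftC (\<lambda>a1 a2. a1 \<otimes> a2 \<otimes> b) (comult H a)) (comult H x)
       = liftC (\<lambda>a b. a \<otimes> comult H b) (comult H x)) \<and>
    (\<forall>x. liftC (\<lambda>a b. counit H a *\<^sub>C b) (comult H x) = x) \<and>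
    (\<forall>x. liftC (\<lambda>a b. counit H b *\<^sub>C a) (comult H x) = x) \<and>
    clinear (antipode H) \<and>
    (\<forall>x. liftC (\<lambda>a b. antipode H a * b) (comult H x) = counit H x *\<^sub>C 1) \<and>
    (\<forall>x. liftC (\<lambda>a b. a * antipode H b) (comult H x) = counit H x *\<^sub>C 1) \<and>
    (\<forall>x. comult H (star x) = liftC (\<lambda>a b. star a \<otimes> star b) (comult H x))"

definition comodule ::
  "'a::complex_star_algebra hopf \<Rightarrow> ('v::complex_vector \<Rightarrow> ('a, 'v) tensor) \<Rightarrow> bool"
  where "comodule H \<delta> \<longleftrightarrow>
    clinear \<delta> \<and> (\<forall>v. \<delta> v \<in> tensC_space UNIV UNIV) \<and>
    (\<forall>v. liftC (\<lambda>a u. liftC (\<lambda>a1 a2. a1 \<otimes> a2 \<otimes> u) (comult H a)) (\<delta> v)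
       = liftC (\<lambda>a u. a \<otimes> \<delta> u) (\<delta> v)) \<and>
    (\<forall>v. liftC (\<lambda>a u. counit H a *\<^sub>C u) (\<delta> v) = v)"

definition comodule_star_algebra ::
  "'a::complex_star_algebra hopf \<Rightarrow> ('m::complex_star_algebra \<Rightarrow> ('a, 'm) tensor) \<Rightarrow> bool"
  where "comodule_star_algebra H \<delta> \<longleftrightarrow>
    comodule H \<delta> \<and> \<delta> 1 = 1 \<otimes> 1 \<and> (\<forall>m m'. \<delta> (m * m') = tensC_mult (\<delta> m) (\<delta> m')) \<and>
    (\<forall>m. \<delta> (star m) = liftC (\<lambda>a m'. star a \<otimes> star m') (\<delta> m))"


section \<open>Differential *-calculi, complex and Kaehler structures\<close>

text \<open>
  The algebra \<open>M\<close> is the type \<open>'m\<close> and the total space of forms is the type \<open>'w\<close>, whose product is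
  the wedge product.  The identification of \<open>M\<close> with the forms of degree 0 is the embedding \<open>incl\<close>.
\<close>

record ('a, 'm, 'w) kaehler =
  coM :: "'m \<Rightarrow> ('a, 'm) tensor"
  incl :: "'m \<Rightarrow> 'w"
  forms :: "nat \<Rightarrow> 'w set"
  diffl :: "'w \<Rightarrow> 'w"
  conj :: "'w \<Rightarrow> 'w"
  coOmega :: "'w \<Rightarrow> ('a, 'w) tensor"
  biforms :: "nat \<times> nat \<Rightarrow> 'w set"
  del :: "'w \<Rightarrow> 'w"
  delbar :: "'w \<Rightarrow> 'w"
  half_dim :: nat
  kform :: 'w

definition differential_star_calculus ::
  "'a::complex_star_algebra hopf \<Rightarrow> ('a, 'm::complex_star_algebra, 'w::complex_algebra_1) kaehler \<Rightarrow> bool"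
  where "differential_star_calculus H K \<longleftrightarrow>
    comodule_star_algebra H (coM K) \<and>
    \<comment> \<open>graded algebra with degree 0 part \<open>M\<close>\<close>
    internal_direct_sum UNIV UNIV (forms K) \<and>
    (\<forall>k l. \<forall>\<omega>\<in>forms K k. \<forall>\<nu>\<in>forms K l. \<omega> * \<nu> \<in> forms K (k + l)) \<and>
    clinear (incl K) \<and> inj (incl K) \<and> range (incl K) = forms K 0 \<and>
    incl K 1 = 1 \<and> (\<forall>m m'. incl K (m * m') = incl K m * incl K m') \<and>
    \<comment> \<open>differential\<close>
    clinear (diffl K) \<and> (\<forall>k. \<forall>\<omega>\<in>forms K k. diffl K \<omega> \<in> forms K (Suc k)) \<and>
    (\<forall>\<omega>. diffl K (diffl K \<omega>) = 0) \<and>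
    (\<forall>k. \<forall>\<omega>\<in>forms K k. \<forall>\<nu>. diffl K (\<omega> * \<nu>) = diffl K \<omega> * \<nu> + (-1) ^ k *\<^sub>C (\<omega> * diffl K \<nu>)) \<and>
    \<comment> \<open>generated by \<open>M\<close> as a dg algebra\<close>
    (\<forall>X. cvec.subspace X \<and> range (incl K) \<subseteq> X \<and> (\<forall>\<omega>\<in>X. \<forall>\<nu>\<in>X. \<omega> * \<nu> \<in> X) \<and>
       (\<forall>\<omega>\<in>X. diffl K \<omega> \<in> X) \<longrightarrow> X = UNIV) \<and>
    \<comment> \<open>involution\<close>
    (\<forall>\<omega> \<nu>. conj K (\<omega> + \<nu>) = conj K \<omega> + conj K \<nu>) \<and>
    (\<forall>c \<omega>. conj K (c *\<^sub>C \<omega>) = cnj c *\<^sub>C conj K \<omega>) \<and>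
    (\<forall>\<omega>. conj K (conj K \<omega>) = \<omega>) \<and>
    (\<forall>m. conj K (incl K m) = incl K (star m)) \<and>
    (\<forall>\<omega>. conj K (diffl K \<omega>) = diffl K (conj K \<omega>)) \<and>
    (\<forall>k l. \<forall>\<omega>\<in>forms K k. \<forall>\<nu>\<in>forms K l.
       conj K (\<omega> * \<nu>) = (-1) ^ (k * l) *\<^sub>C (conj K \<nu> * conj K \<omega>)) \<and>
    \<comment> \<open>coaction\<close>
    comodule H (coOmega K) \<and>
    (\<forall>k. \<forall>\<omega>\<in>forms K k. coOmega K \<omega> \<in> tensC_space UNIV (forms K k)) \<and>
    (\<forall>m. coOmega K (incl K m) = liftC (\<lambda>a m'. a \<otimes> incl K m') (coM K m)) \<and>
    (\<forall>\<omega> \<nu>. coOmega K (\<omega> * \<nu>) = tensC_mult (coOmega K \<omega>) (coOmega K \<nu>)) \<and>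
    (\<forall>\<omega>. coOmega K (diffl K \<omega>) = liftC (\<lambda>a \<nu>. a \<otimes> diffl K \<nu>) (coOmega K \<omega>)) \<and>
    (\<forall>\<omega>. coOmega K (conj K \<omega>) = liftC (\<lambda>a \<nu>. star a \<otimes> conj K \<nu>) (coOmega K \<omega>))"

definition complex_structure ::
  "('a::complex_star_algebra, 'm::complex_star_algebra, 'w::complex_algebra_1) kaehler \<Rightarrow> bool"
  where "complex_structure K \<longleftrightarrow>
    (\<forall>k. internal_direct_sum (forms K k) {(a, b). a + b = k} (biforms K)) \<and>
    (\<forall>a b a' b'. \<forall>\<omega>\<in>biforms K (a, b). \<forall>\<nu>\<in>biforms K (a', b'). \<omega> * \<nu> \<in> biforms K (a + a', b + b')) \<and>
    (\<forall>p. \<forall>\<omega>\<in>biforms K p. \<forall>m. incl K m * \<omega> \<in> biforms K p \<and> \<omega> * incl K m \<in> biforms K p) \<and>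
    (\<forall>p. \<forall>\<omega>\<in>biforms K p. coOmega K \<omega> \<in> tensC_space UNIV (biforms K p)) \<and>
    (\<forall>a b. conj K ` biforms K (a, b) = biforms K (b, a)) \<and>
    clinear (del K) \<and> clinear (delbar K) \<and>
    (\<forall>a b. \<forall>\<omega>\<in>biforms K (a, b). del K \<omega> \<in> biforms K (a + 1, b) \<and> delbar K \<omega> \<in> biforms K (a, b + 1)) \<and>
    (\<forall>\<omega>. diffl K \<omega> = del K \<omega> + delbar K \<omega>)"

definition Lef :: "('a, 'm, 'w::complex_algebra_1) kaehler \<Rightarrow> 'w \<Rightarrow> 'w"
  where "Lef K \<omega> = kform K * \<omega>"

definition kaehler_structure ::
  "'a::complex_star_algebra hopf \<Rightarrow> ('a, 'm::complex_star_algebra, 'w::complex_algebra_1) kaehler \<Rightarrow> bool"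
  where "kaehler_structure H K \<longleftrightarrow>
    differential_star_calculus H K \<and> complex_structure K \<and>
    forms K (2 * half_dim K) \<noteq> {0} \<and> (\<forall>k > 2 * half_dim K. forms K k = {0}) \<and>
    kform K \<in> biforms K (1, 1) \<and> diffl K (kform K) = 0 \<and>
    (\<forall>\<omega>. kform K * \<omega> = \<omega> * kform K) \<and> conj K (kform K) = kform K \<and>
    coOmega K (kform K) = 1 \<otimes> kform K \<and>
    (\<forall>k < half_dim K.
       bij_betw (Lef K ^^ (half_dim K - k)) (forms K k) (forms K (2 * half_dim K - k)))"

definition primitive :: "('a, 'm, 'w::complex_algebra_1) kaehler \<Rightarrow> nat \<Rightarrow> 'w set"
  where "primitive K k =
    (if k \<le> half_dim K then {\<alpha> \<in> forms K k. (Lef K ^^ (half_dim K - k + 1)) \<alpha> = 0} else {0})"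

definition Hodge :: "('a, 'm, 'w::complex_algebra_1) kaehler \<Rightarrow> 'w \<Rightarrow> 'w"
  where "Hodge K = (THE s. clinear s \<and>
    (\<forall>a b j \<alpha>. \<alpha> \<in> primitive K (a + b) \<inter> biforms K (a, b) \<and> a + b + j \<le> half_dim K \<longrightarrow>
       s ((Lef K ^^ j) \<alpha>) =
         ((-1) ^ ((a + b) * (a + b + 1) div 2) * \<i> powi (int a - int b) *
           (fact j / fact (half_dim K - j - (a + b)))) *\<^sub>C (Lef K ^^ (half_dim K - j - (a + b))) \<alpha>))"

definition vol :: "('a, 'm, 'w::complex_algebra_1) kaehler \<Rightarrow> 'w \<Rightarrow> 'm"
  where "vol K \<omega> = inv (incl K) (Hodge K (component (forms K) (2 * half_dim K) \<omega>))"


section \<open>Positivity, states and integrals\<close>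

definition positive_cone :: "'m::complex_star_algebra set"
  where "positive_cone = {m. m \<noteq> 0 \<and> (\<exists>(N::nat) (r :: nat \<Rightarrow> real) x. (\<forall>i<N. 0 \<le> r i) \<and>
    m = (\<Sum>i<N. complex_of_real (r i) *\<^sub>C (x i * star (x i))))}"

definition positive_definite_kaehler ::
  "('a, 'm::complex_star_algebra, 'w::complex_algebra_1) kaehler \<Rightarrow> bool"
  where "positive_definite_kaehler K \<longleftrightarrow>
    (\<forall>\<omega>. \<omega> \<noteq> 0 \<longrightarrow> vol K (\<omega> * Hodge K (conj K \<omega>)) \<in> positive_cone)"

definition state :: "('m::complex_star_algebra \<Rightarrow> complex) \<Rightarrow> bool"
  where "state f \<longleftrightarrow> clinear f \<and> f 1 = 1 \<and>
    (\<forall>m\<in>positive_cone. \<exists>r>0. f m = complex_of_real r)"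

definition form_integral ::
  "('a, 'm::complex_star_algebra, 'w::complex_algebra_1) kaehler \<Rightarrow> ('m \<Rightarrow> complex) \<Rightarrow> 'w \<Rightarrow> complex"
  where "form_integral K f \<omega> = f (vol K \<omega>)"

definition closed_integral ::
  "('a, 'm::complex_star_algebra, 'w::complex_algebra_1) kaehler \<Rightarrow> ('m \<Rightarrow> complex) \<Rightarrow> bool"
  where "closed_integral K f \<longleftrightarrow>
    (\<forall>k. k + 1 = 2 * half_dim K \<longrightarrow> (\<forall>\<omega>\<in>forms K k. form_integral K f (diffl K \<omega>) = 0))"


section \<open>Vector bundles and holomorphic structures\<close>

text \<open>
  The bundle is the type \<open>'f\<close>; \<open>dbarF\<close> is its holomorphic structure.
\<close>

record ('a, 'm, 'w, 'f) bundle_data =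
  act :: "'m \<Rightarrow> 'f \<Rightarrow> 'f"
  coF :: "'f \<Rightarrow> ('a, 'f) tensor"
  dbarF :: "'f \<Rightarrow> ('w, 'f) tensor"

definition finitely_generated_projective ::
  "('m::complex_algebra_1 \<Rightarrow> 'f::complex_vector \<Rightarrow> 'f) \<Rightarrow> bool"
  \<comment> \<open>direct summand of a free module of finite rank \<open>N\<close>\<close>
  where "finitely_generated_projective \<mu> \<longleftrightarrow>
    (\<exists>N (s :: 'f \<Rightarrow> nat \<Rightarrow> 'm) (p :: (nat \<Rightarrow> 'm) \<Rightarrow> 'f). let free = {v. \<forall>k\<ge>N. v k = 0} in
       (\<forall>x. s x \<in> free) \<and> (\<forall>x y. s (x + y) = s x + s y) \<and>
       (\<forall>m x. s (\<mu> m x) = (\<lambda>k. m * s x k)) \<and>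
       (\<forall>u\<in>free. \<forall>v\<in>free. p (u + v) = p u + p v) \<and>
       (\<forall>m. \<forall>v\<in>free. p (\<lambda>k. m * v k) = \<mu> m (p v)) \<and>
       (\<forall>x. p (s x) = x))"

definition vector_bundle ::
  "'a::complex_star_algebra hopf \<Rightarrow> ('a, 'm::complex_star_algebra, 'w::complex_algebra_1) kaehler \<Rightarrow>
   ('a, 'm, 'w, 'f::complex_vector) bundle_data \<Rightarrow> bool"
  where "vector_bundle H K E \<longleftrightarrow>
    (\<forall>m x y. act E m (x + y) = act E m x + act E m y) \<and>
    (\<forall>m m' x. act E (m + m') x = act E m x + act E m' x) \<and>
    (\<forall>m m' x. act E (m * m') x = act E m (act E m' x)) \<and>
    (\<forall>x. act E 1 x = x) \<and>
    (\<forall>c m x. act E (c *\<^sub>C m) x = c *\<^sub>C act E m x \<and> act E m (c *\<^sub>C x) = c *\<^sub>C act E m x) \<and>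
    finitely_generated_projective (act E) \<and>
    comodule H (coF E) \<and>
    (\<forall>m x. coF E (act E m x) =
       liftC (\<lambda>a m'. liftC (\<lambda>b y. (a * b) \<otimes> act E m' y) (coF E x)) (coM K m))"

definition dual :: "('a, 'm::complex_star_algebra, 'w, 'f::complex_vector) bundle_data \<Rightarrow> ('f \<Rightarrow> 'm) set"
  where "dual E = {\<phi>. (\<forall>x y. \<phi> (x + y) = \<phi> x + \<phi> y) \<and> (\<forall>m x. \<phi> (act E m x) = m * \<phi> x)}"

definition dual_act :: "('f \<Rightarrow> 'm::complex_star_algebra) \<Rightarrow> 'm \<Rightarrow> 'f \<Rightarrow> 'm"
  where "dual_act \<phi> m = (\<lambda>x. \<phi> x * m)"

definition dual_coaction ::
  "'a::complex_star_algebra hopf \<Rightarrow> ('a, 'm::complex_star_algebra, 'w::complex_algebra_1) kaehler \<Rightarrow>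
   ('a, 'm, 'w, 'f::complex_vector) bundle_data \<Rightarrow> ('f \<Rightarrow> 'm) \<Rightarrow> ('a, 'f \<Rightarrow> 'm) tensor"
  where "dual_coaction H K E \<phi> = (THE t. t \<in> tensC_space UNIV (dual E) \<and>
    (\<forall>x. liftC (\<lambda>a \<psi>. a \<otimes> \<psi> x) t =
       liftC (\<lambda>a y. liftC (\<lambda>b m. (antipode H a * b) \<otimes> m) (coM K (\<phi> y))) (coF E x)))"

text \<open>
  Forms with values in the bundle (tensor product over \<open>M\<close>).  For a sub-bimodule \<open>X\<close> that is a
  direct summand of the forms, as \<open>biforms K p\<close> is, \<open>formsF K E X\<close> is a copy of its tensor product
  with the bundle.  The same applies to \<open>formsD\<close>, which takes values in the dual bundle.
\<close>

definition tensF ::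
  "('a, 'm::complex_star_algebra, 'w::complex_algebra_1) kaehler \<Rightarrow>
   ('a, 'm, 'w, 'f::complex_vector) bundle_data \<Rightarrow> 'w \<Rightarrow> 'f \<Rightarrow> ('w, 'f) tensor"
  where "tensF K E = tens UNIV (\<lambda>\<omega> m. \<omega> * incl K m) (act E)"

definition liftF ::
  "('a, 'm::complex_star_algebra, 'w::complex_algebra_1) kaehler \<Rightarrow>
   ('a, 'm, 'w, 'f::complex_vector) bundle_data \<Rightarrow>
   ('w \<Rightarrow> 'f \<Rightarrow> 'x::complex_vector) \<Rightarrow> ('w, 'f) tensor \<Rightarrow> 'x"
  where "liftF K E = tens_lift UNIV (\<lambda>\<omega> m. \<omega> * incl K m) (act E)"

definition formsF ::
  "('a, 'm::complex_star_algebra, 'w::complex_algebra_1) kaehler \<Rightarrow>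
   ('a, 'm, 'w, 'f::complex_vector) bundle_data \<Rightarrow> 'w set \<Rightarrow> ('w, 'f) tensor set"
  where "formsF K E X = cvec.span {tensF K E \<omega> x | \<omega> x. \<omega> \<in> X}"

definition tensD ::
  "('a, 'm::complex_star_algebra, 'w::complex_algebra_1) kaehler \<Rightarrow>
   ('a, 'm, 'w, 'f::complex_vector) bundle_data \<Rightarrow> ('f \<Rightarrow> 'm) \<Rightarrow> 'w \<Rightarrow> ('f \<Rightarrow> 'm, 'w) tensor"
  where "tensD K E = tens (dual E) dual_act (\<lambda>m \<omega>. incl K m * \<omega>)"

definition liftD ::
  "('a, 'm::complex_star_algebra, 'w::complex_algebra_1) kaehler \<Rightarrow>
   ('a, 'm, 'w, 'f::complex_vector) bundle_data \<Rightarrow>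
   (('f \<Rightarrow> 'm) \<Rightarrow> 'w \<Rightarrow> 'x::complex_vector) \<Rightarrow> ('f \<Rightarrow> 'm, 'w) tensor \<Rightarrow> 'x"
  where "liftD K E = tens_lift (dual E) dual_act (\<lambda>m \<omega>. incl K m * \<omega>)"

definition formsD ::
  "('a, 'm::complex_star_algebra, 'w::complex_algebra_1) kaehler \<Rightarrow>
   ('a, 'm, 'w, 'f::complex_vector) bundle_data \<Rightarrow> 'w set \<Rightarrow> ('f \<Rightarrow> 'm, 'w) tensor set"
  where "formsD K E X = cvec.span {tensD K E \<phi> \<nu> | \<phi> \<nu>. \<phi> \<in> dual E \<and> \<nu> \<in> X}"

text \<open>\<open>\<omega> \<mapsto> (-1)\<^sup>|\<^sup>\<omega>\<^sup>| \<omega>\<close>, extended linearly to inhomogeneous forms.\<close>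

definition grading_involution :: "('a, 'm, 'w::complex_algebra_1) kaehler \<Rightarrow> 'w \<Rightarrow> 'w"
  where "grading_involution K \<omega> =
    (\<Sum>k | component (forms K) k \<omega> \<noteq> 0. (-1) ^ k *\<^sub>C component (forms K) k \<omega>)"

definition wedgeF ::
  "('a, 'm::complex_star_algebra, 'w::complex_algebra_1) kaehler \<Rightarrow>
   ('a, 'm, 'w, 'f::complex_vector) bundle_data \<Rightarrow> 'w \<Rightarrow> ('w, 'f) tensor \<Rightarrow> ('w, 'f) tensor"
  where "wedgeF K E \<omega> = liftF K E (\<lambda>\<eta> x. tensF K E (\<omega> * \<eta>) x)"

definition wedgeD ::
  "('a, 'm::complex_star_algebra, 'w::complex_algebra_1) kaehler \<Rightarrow>
   ('a, 'm, 'w, 'f::complex_vector) bundle_data \<Rightarrow> ('f \<Rightarrow> 'm, 'w) tensor \<Rightarrow> 'w \<Rightarrow> ('f \<Rightarrow> 'm, 'w) tensor"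
  where "wedgeD K E y \<omega> = liftD K E (\<lambda>\<phi> \<nu>. tensD K E \<phi> (\<nu> * \<omega>)) y"

definition dbar_ext ::
  "('a, 'm::complex_star_algebra, 'w::complex_algebra_1) kaehler \<Rightarrow>
   ('a, 'm, 'w, 'f::complex_vector) bundle_data \<Rightarrow> ('w, 'f) tensor \<Rightarrow> ('w, 'f) tensor"
  where "dbar_ext K E = liftF K E (\<lambda>\<omega> x.
    tensF K E (delbar K \<omega>) x + wedgeF K E (grading_involution K \<omega>) (dbarF E x))"

definition coaction_formsF ::
  "('a::complex_star_algebra, 'm::complex_star_algebra, 'w::complex_algebra_1) kaehler \<Rightarrow>
   ('a, 'm, 'w, 'f::complex_vector) bundle_data \<Rightarrow> ('w, 'f) tensor \<Rightarrow> ('a, ('w, 'f) tensor) tensor"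
  where "coaction_formsF K E = liftF K E (\<lambda>\<omega> x.
    liftC (\<lambda>a \<eta>. liftC (\<lambda>b y. (a * b) \<otimes> tensF K E \<eta> y) (coF E x)) (coOmega K \<omega>))"

definition holomorphic_vector_bundle ::
  "'a::complex_star_algebra hopf \<Rightarrow> ('a, 'm::complex_star_algebra, 'w::complex_algebra_1) kaehler \<Rightarrow>
   ('a, 'm, 'w, 'f::complex_vector) bundle_data \<Rightarrow> bool"
  where "holomorphic_vector_bundle H K E \<longleftrightarrow>
    vector_bundle H K E \<and>
    clinear (dbarF E) \<and> (\<forall>x. dbarF E x \<in> formsF K E (biforms K (0, 1))) \<and>
    (\<forall>x. coaction_formsF K E (dbarF E x) = liftC (\<lambda>a y. a \<otimes> dbarF E y) (coF E x)) \<and>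
    (\<forall>m x. dbarF E (act E m x) =
       tensF K E (delbar K (incl K m)) x + wedgeF K E (incl K m) (dbarF E x)) \<and>
    (\<forall>\<alpha>\<in>formsF K E UNIV. dbar_ext K E (dbar_ext K E \<alpha>) = 0)"

definition ev ::
  "('a, 'm::complex_star_algebra, 'w::complex_algebra_1) kaehler \<Rightarrow>
   ('a, 'm, 'w, 'f::complex_vector) bundle_data \<Rightarrow> ('w, 'f) tensor \<Rightarrow> ('f \<Rightarrow> 'm, 'w) tensor \<Rightarrow> 'w"
  where "ev K E \<alpha> \<beta> = liftF K E (\<lambda>\<omega> x. liftD K E (\<lambda>\<phi> \<nu>. \<omega> * incl K (\<phi> x) * \<nu>) \<beta>) \<alpha>"

definition dbar_dual ::
  "('a, 'm::complex_star_algebra, 'w::complex_algebra_1) kaehler \<Rightarrow>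
   ('a, 'm, 'w, 'f::complex_vector) bundle_data \<Rightarrow> ('f \<Rightarrow> 'm) \<Rightarrow> ('f \<Rightarrow> 'm, 'w) tensor"
  where "dbar_dual K E \<phi> = (THE \<beta>. \<beta> \<in> formsD K E (biforms K (0, 1)) \<and>
    (\<forall>x. ev K E (tensF K E 1 x) \<beta> =
       delbar K (incl K (\<phi> x)) - ev K E (dbarF E x) (tensD K E \<phi> 1)))"

definition dbar_dual_ext ::
  "('a, 'm::complex_star_algebra, 'w::complex_algebra_1) kaehler \<Rightarrow>
   ('a, 'm, 'w, 'f::complex_vector) bundle_data \<Rightarrow> ('f \<Rightarrow> 'm, 'w) tensor \<Rightarrow> ('f \<Rightarrow> 'm, 'w) tensor"
  where "dbar_dual_ext K E = liftD K E (\<lambda>\<phi> \<omega>.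
    wedgeD K E (dbar_dual K E \<phi>) \<omega> + tensD K E \<phi> (delbar K \<omega>))"


section \<open>Hermitian structures and diagonalisability\<close>

text \<open>
  The conjugate bundle has the same underlying set as the bundle, so a map from it to the dual is
  given as a function \<open>h\<close> on \<open>'f\<close>, \<open>h x\<close> being the value at the conjugate of \<open>x\<close>; the conditions
  below are right \<open>M\<close>-linearity, complex linearity, bijectivity and colinearity with respect to the
  structure of the conjugate bundle.
\<close>

definition hermitian_structure ::
  "'a::complex_star_algebra hopf \<Rightarrow> ('a, 'm::complex_star_algebra, 'w::complex_algebra_1) kaehler \<Rightarrow>
   ('a, 'm, 'w, 'f::complex_vector) bundle_data \<Rightarrow> ('f \<Rightarrow> 'f \<Rightarrow> 'm) \<Rightarrow> bool"
  where "hermitian_structure H K E h \<longleftrightarrow>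
    (\<forall>x y. h (x + y) = h x + h y) \<and> (\<forall>c x. h (c *\<^sub>C x) = cnj c *\<^sub>C h x) \<and>
    (\<forall>m x. h (act E (star m) x) = dual_act (h x) m) \<and>
    bij_betw h UNIV (dual E) \<and>
    (\<forall>x. dual_coaction H K E (h x) = liftC (\<lambda>a y. star a \<otimes> h y) (coF E x)) \<and>
    (\<forall>x y. h x y = star (h y x))"

definition positive_definite_hermitian :: "('f::complex_vector \<Rightarrow> 'f \<Rightarrow> 'm::complex_star_algebra) \<Rightarrow> bool"
  where "positive_definite_hermitian h \<longleftrightarrow> (\<forall>x. x \<noteq> 0 \<longrightarrow> h x x \<in> positive_cone)"

definition Hodge_bar ::
  "('a, 'm::complex_star_algebra, 'w::complex_algebra_1) kaehler \<Rightarrow>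
   ('a, 'm, 'w, 'f::complex_vector) bundle_data \<Rightarrow> ('f \<Rightarrow> 'f \<Rightarrow> 'm) \<Rightarrow>
   ('w, 'f) tensor \<Rightarrow> ('f \<Rightarrow> 'm, 'w) tensor"
  where "Hodge_bar K E h = liftF K E (\<lambda>\<omega> x. tensD K E (h x) (Hodge K (conj K \<omega>)))"

definition metricF ::
  "('a, 'm::complex_star_algebra, 'w::complex_algebra_1) kaehler \<Rightarrow>
   ('a, 'm, 'w, 'f::complex_vector) bundle_data \<Rightarrow> ('f \<Rightarrow> 'f \<Rightarrow> 'm) \<Rightarrow>
   ('w, 'f) tensor \<Rightarrow> ('w, 'f) tensor \<Rightarrow> 'm"
  where "metricF K E h \<alpha> \<beta> = vol K (ev K E \<alpha> (Hodge_bar K E h \<beta>))"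

definition innerF ::
  "('a, 'm::complex_star_algebra, 'w::complex_algebra_1) kaehler \<Rightarrow>
   ('a, 'm, 'w, 'f::complex_vector) bundle_data \<Rightarrow> ('f \<Rightarrow> 'f \<Rightarrow> 'm) \<Rightarrow> ('m \<Rightarrow> complex) \<Rightarrow>
   ('w, 'f) tensor \<Rightarrow> ('w, 'f) tensor \<Rightarrow> complex"
  where "innerF K E h f \<alpha> \<beta> = f (metricF K E h \<alpha> \<beta>)"

definition dbar_adjoint ::
  "('a, 'm::complex_star_algebra, 'w::complex_algebra_1) kaehler \<Rightarrow>
   ('a, 'm, 'w, 'f::complex_vector) bundle_data \<Rightarrow> ('f \<Rightarrow> 'f \<Rightarrow> 'm) \<Rightarrow> ('m \<Rightarrow> complex) \<Rightarrow>
   ('w, 'f) tensor \<Rightarrow> ('w, 'f) tensor"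
  where "dbar_adjoint K E h f \<beta> = (THE \<gamma>. \<gamma> \<in> formsF K E UNIV \<and>
    (\<forall>\<alpha>\<in>formsF K E UNIV. innerF K E h f (dbar_ext K E \<alpha>) \<beta> = innerF K E h f \<alpha> \<gamma>))"

definition diagonalisable_on :: "'v::complex_vector set \<Rightarrow> ('v \<Rightarrow> 'v) \<Rightarrow> bool"
  where "diagonalisable_on V T \<longleftrightarrow>
    (\<exists>B. cvec.independent B \<and> cvec.span B = V \<and> (\<forall>v\<in>B. \<exists>c. T v = c *\<^sub>C v))"

definition diagonalisable_kaehler ::
  "('a, 'm::complex_star_algebra, 'w::complex_algebra_1) kaehler \<Rightarrow>
   ('a, 'm, 'w, 'f::complex_vector) bundle_data \<Rightarrow> ('f \<Rightarrow> 'f \<Rightarrow> 'm) \<Rightarrow> ('m \<Rightarrow> complex) \<Rightarrow> bool"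
  where "diagonalisable_kaehler K E h f \<longleftrightarrow>
    diagonalisable_on (formsF K E UNIV) (\<lambda>\<alpha>. dbar_ext K E \<alpha> + dbar_adjoint K E h f \<alpha>)"


section \<open>Cohomology and pairings\<close>

definition coset :: "'v::complex_vector set \<Rightarrow> 'v \<Rightarrow> 'v set"
  where "coset B z = {z + b | b. b \<in> B}"

definition cocyclesF ::
  "('a, 'm::complex_star_algebra, 'w::complex_algebra_1) kaehler \<Rightarrow>
   ('a, 'm, 'w, 'f::complex_vector) bundle_data \<Rightarrow> nat \<Rightarrow> nat \<Rightarrow> ('w, 'f) tensor set"
  where "cocyclesF K E a b = {\<alpha> \<in> formsF K E (biforms K (a, b)). dbar_ext K E \<alpha> = 0}"

definition coboundariesF ::
  "('a, 'm::complex_star_algebra, 'w::complex_algebra_1) kaehler \<Rightarrow>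
   ('a, 'm, 'w, 'f::complex_vector) bundle_data \<Rightarrow> nat \<Rightarrow> nat \<Rightarrow> ('w, 'f) tensor set"
  where "coboundariesF K E a b =
    (case b of 0 \<Rightarrow> {0} | Suc b' \<Rightarrow> dbar_ext K E ` formsF K E (biforms K (a, b')))"

definition cohomologyF ::
  "('a, 'm::complex_star_algebra, 'w::complex_algebra_1) kaehler \<Rightarrow>
   ('a, 'm, 'w, 'f::complex_vector) bundle_data \<Rightarrow> nat \<Rightarrow> nat \<Rightarrow> ('w, 'f) tensor set set"
  where "cohomologyF K E a b = coset (coboundariesF K E a b) ` cocyclesF K E a b"

definition cocyclesD ::
  "('a, 'm::complex_star_algebra, 'w::complex_algebra_1) kaehler \<Rightarrow>
   ('a, 'm, 'w, 'f::complex_vector) bundle_data \<Rightarrow> nat \<Rightarrow> nat \<Rightarrow> ('f \<Rightarrow> 'm, 'w) tensor set"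
  where "cocyclesD K E a b = {\<beta> \<in> formsD K E (biforms K (a, b)). dbar_dual_ext K E \<beta> = 0}"

definition coboundariesD ::
  "('a, 'm::complex_star_algebra, 'w::complex_algebra_1) kaehler \<Rightarrow>
   ('a, 'm, 'w, 'f::complex_vector) bundle_data \<Rightarrow> nat \<Rightarrow> nat \<Rightarrow> ('f \<Rightarrow> 'm, 'w) tensor set"
  where "coboundariesD K E a b =
    (case b of 0 \<Rightarrow> {0} | Suc b' \<Rightarrow> dbar_dual_ext K E ` formsD K E (biforms K (a, b')))"

definition cohomologyD ::
  "('a, 'm::complex_star_algebra, 'w::complex_algebra_1) kaehler \<Rightarrow>
   ('a, 'm, 'w, 'f::complex_vector) bundle_data \<Rightarrow> nat \<Rightarrow> nat \<Rightarrow> ('f \<Rightarrow> 'm, 'w) tensor set set"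
  where "cohomologyD K E a b = coset (coboundariesD K E a b) ` cocyclesD K E a b"

text \<open>
  The vector space operations of a quotient by \<open>B\<close>, on cosets.  The summand from \<open>B\<close> in
  \<open>coset_scale\<close> is needed for the scalar 0.  The zero of the quotient is \<open>B\<close> itself.
\<close>

definition coset_add :: "'v::complex_vector set \<Rightarrow> 'v set \<Rightarrow> 'v set"
  where "coset_add X Y = {x + y | x y. x \<in> X \<and> y \<in> Y}"

definition coset_scale :: "'v::complex_vector set \<Rightarrow> complex \<Rightarrow> 'v set \<Rightarrow> 'v set"
  where "coset_scale B c X = {c *\<^sub>C x + b | x b. x \<in> X \<and> b \<in> B}"

text \<open>Here \<open>Q\<close> and \<open>Q'\<close> are quotient spaces by \<open>B\<close> and \<open>B'\<close>.\<close>

definition bilinear_pairing ::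
  "'v::complex_vector set \<Rightarrow> 'v set set \<Rightarrow> 'w::complex_vector set \<Rightarrow> 'w set set \<Rightarrow>
   ('v set \<Rightarrow> 'w set \<Rightarrow> complex) \<Rightarrow> bool"
  where "bilinear_pairing B Q B' Q' P \<longleftrightarrow>
    (\<forall>X\<in>Q. \<forall>X'\<in>Q. \<forall>Y\<in>Q'. P (coset_add X X') Y = P X Y + P X' Y) \<and>
    (\<forall>X\<in>Q. \<forall>Y\<in>Q'. \<forall>Y'\<in>Q'. P X (coset_add Y Y') = P X Y + P X Y') \<and>
    (\<forall>c. \<forall>X\<in>Q. \<forall>Y\<in>Q'. P (coset_scale B c X) Y = c * P X Y \<and> P X (coset_scale B' c Y) = c * P X Y)"

definition nondegenerate_pairing ::
  "'v set \<Rightarrow> 'v set set \<Rightarrow> 'w set \<Rightarrow> 'w set set \<Rightarrow> ('v set \<Rightarrow> 'w set \<Rightarrow> complex) \<Rightarrow> bool"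
  where "nondegenerate_pairing B Q B' Q' P \<longleftrightarrow>
    (\<forall>X\<in>Q. (\<forall>Y\<in>Q'. P X Y = 0) \<longrightarrow> X = B) \<and>
    (\<forall>Y\<in>Q'. (\<forall>X\<in>Q. P X Y = 0) \<longrightarrow> Y = B')"

end

theory Submission
  imports Defs
begin

text \<open>
  Write \<open>D\<close> for the holomorphic structure extended to \<open>V = \<Omega> \<otimes> F\<close>, \<open>D'\<close> for that of the dual bundle, and
  \<open>\<langle>\<alpha>, \<beta>\<rangle>\<close> for the integral of the evaluation product of \<open>\<alpha> \<in> V\<close> and a dual-valued form \<open>\<beta>\<close>.  The
  evaluation product satisfies a graded Leibniz rule (\<open>delbar_ev\<close>) and the integral vanishes on
  the image of \<open>delbar\<close> (\<open>integral_delbar\<close>), because the top forms are exactly those of bidegree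
  \<open>(n, n)\<close>.  Hence \<open>D\<close> and \<open>D'\<close> are transposes of each other up to sign (\<open>pair_D\<close>), and the pairing
  descends to cohomology.

  For non-degeneracy the Hodge operator \<open>S(\<omega> \<otimes> x) = h(x) \<otimes> \<star>(\<omega>*)\<close> is used.  It maps forms of bidegree
  \<open>(a, b)\<close> onto dual-valued forms of bidegree \<open>(n - a, n - b)\<close>, so \<open>\<langle>\<alpha>, S \<gamma>\<rangle>\<close> is a sesquilinear form on
  \<open>V\<close>, and the adjoint \<open>A\<close> of \<open>D\<close> for it is characterised by \<open>S A = \<plusminus> D' S\<close>: dual-valued cocycles are
  the images under \<open>S\<close> of the forms killed by \<open>A\<close>.  Two properties of this form are needed.  It is
  Hermitian (\<open>pair_hermitian\<close>), which follows by polarisation from the positivity of the integral of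
  \<open>\<omega> \<star>(\<omega>*)\<close>.  It is non-degenerate (\<open>metric_nondegenerate\<close>): the same positivity and the
  surjectivity of the Hodge map show that \<open>\<omega>, \<nu> \<mapsto> \<integral> \<omega> \<nu>\<close> is non-degenerate, and a dual basis of the
  projective module \<open>F\<close> carries this over to bundle-valued forms.

  Diagonalisability of \<open>D + A\<close> says that \<open>V\<close> is the sum of the kernel of \<open>D + A\<close> and the image of
  \<open>(D + A)\<^sup>2 = D A + A D\<close>, and that these two operators have the same kernel.  The square preserves
  bidegrees, so the decomposition can be taken inside one bidegree, where the kernel consists of the
  forms killed by both \<open>D\<close> and \<open>A\<close>, the harmonic ones (\<open>hodge_decomposition\<close>).  A cocycle of \<open>D\<close> is
  then a harmonic form plus a coboundary, a form killed by \<open>A\<close> is a harmonic form plus an element of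
  the image of \<open>A\<close>, and \<open>\<langle>\<alpha>, S \<gamma>\<rangle>\<close> is non-degenerate on harmonic forms because these are orthogonal to
  the images of \<open>D\<close> and \<open>A\<close> (\<open>harmonic_nondegenerate\<close>).  A cocycle on either side that pairs to zero
  with all cocycles of the other side therefore has harmonic part zero and is a coboundary.

  The Hodge map itself is given by a formula on the summands \<open>L\<^sup>j P\<^sup>(\<^sup>a\<^sup>,\<^sup>b\<^sup>)\<close>, and the Lefschetz
  decomposition (\<open>lefschetz_exists\<close>, \<open>lefschetz_unique\<close>) is what makes this a definition.
\<close>

text \<open>
  Tensors are functions, and the two rules below would evaluate their sums pointwise.
\<close>

declare zero_fun_apply [simp del] plus_fun_apply [simp del]

section \<open>Linear maps and direct sums\<close>

lemma clinearI:
  assumes "\<And>x y. T (x + y) = T x + T y" "\<And>c x. T (c *\<^sub>C x) = c *\<^sub>C T x"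
  shows "clinear T"
  by unfold_locales (use assms in auto)

lemma clinear_add: "clinear T \<Longrightarrow> T (x + y) = T x + T y"
  by (simp add: Vector_Spaces.linear_iff_module_hom module_hom.add)

lemma clinear_scale: "clinear T \<Longrightarrow> T (c *\<^sub>C x) = c *\<^sub>C T x"
  by (simp add: Vector_Spaces.linear_iff_module_hom module_hom.scale)

lemma clinear_0: "clinear T \<Longrightarrow> T 0 = 0"
  by (simp add: Vector_Spaces.linear_iff_module_hom module_hom.zero)

lemma clinear_sum: "clinear T \<Longrightarrow> T (\<Sum>i\<in>I. g i) = (\<Sum>i\<in>I. T (g i))"
  by (simp add: Vector_Spaces.linear_iff_module_hom module_hom.sum)

lemma clinear_comp:
  fixes T :: "'x::complex_vector \<Rightarrow> 'y::complex_vector" and T' :: "'y \<Rightarrow> 'z::complex_vector"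
  shows "clinear T \<Longrightarrow> clinear T' \<Longrightarrow> clinear (\<lambda>x. T' (T x))"
  by (rule clinearI) (simp_all add: clinear_add clinear_scale)

lemma clinear_scaleC: "clinear T \<Longrightarrow> clinear (\<lambda>x. c *\<^sub>C T x)"
  by (rule clinearI) (simp_all add: clinear_add clinear_scale scaleC_add_right scaleC_scaleC mult.commute)

lemma clinear_sumI: "(\<And>i. i \<in> I \<Longrightarrow> clinear (T i)) \<Longrightarrow> clinear (\<lambda>x. \<Sum>i\<in>I. T i x)"
  by (rule clinearI) (simp_all add: clinear_add clinear_scale sum.distrib cvec.scale_sum_right)

lemma clinear_mult_left: "clinear (\<lambda>x :: 'w::complex_algebra_1. y * x)"
  by (rule clinearI) (simp_all add: distrib_left mult_scaleC_right)

definition decomposition :: "'i set \<Rightarrow> ('i \<Rightarrow> 'v::complex_vector set) \<Rightarrow> ('i \<Rightarrow> 'v) \<Rightarrow> 'v \<Rightarrow> bool"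
  where "decomposition I U d v \<longleftrightarrow> (\<forall>i\<in>I. d i \<in> U i) \<and> (\<forall>i. i \<notin> I \<longrightarrow> d i = 0) \<and>
    finite {i. d i \<noteq> 0} \<and> v = (\<Sum>i | d i \<noteq> 0. d i)"

lemma sum_support_superset:
  fixes d :: "'i \<Rightarrow> 'v::comm_monoid_add"
  assumes "finite S" "{i. d i \<noteq> 0} \<subseteq> S"
  shows "(\<Sum>i | d i \<noteq> 0. d i) = (\<Sum>i\<in>S. d i)"
  using assms by (intro sum.mono_neutral_left) auto

lemma decomposition_add:
  assumes U: "\<And>i. i \<in> I \<Longrightarrow> cvec.subspace (U i)"
    and d: "decomposition I U d v" and e: "decomposition I U e w"
  shows "decomposition I U (\<lambda>i. d i + e i) (v + w)"
proof -
  let ?S = "{i. d i \<noteq> 0} \<union> {i. e i \<noteq> 0}"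
  have S: "finite ?S" using d e by (auto simp: decomposition_def)
  have sub: "{i. d i + e i \<noteq> 0} \<subseteq> ?S" by auto
  have "v = (\<Sum>i\<in>?S. d i)" "w = (\<Sum>i\<in>?S. e i)"
    using d e S sum_support_superset[of ?S d] sum_support_superset[of ?S e]
    by (auto simp: decomposition_def)
  moreover have "(\<Sum>i | d i + e i \<noteq> 0. d i + e i) = (\<Sum>i\<in>?S. d i + e i)"
    by (rule sum_support_superset[OF S sub])
  ultimately show ?thesis
    using d e finite_subset[OF sub S] U
    by (auto simp: decomposition_def sum.distrib cvec.subspace_add)
qed

lemma decomposition_scale:
  assumes U: "\<And>i. i \<in> I \<Longrightarrow> cvec.subspace (U i)" and d: "decomposition I U d v"
  shows "decomposition I U (\<lambda>i. c *\<^sub>C d i) (c *\<^sub>C v)"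
proof -
  let ?S = "{i. d i \<noteq> 0}"
  have S: "finite ?S" using d by (auto simp: decomposition_def)
  have sub: "{i. c *\<^sub>C d i \<noteq> 0} \<subseteq> ?S" by auto
  have "c *\<^sub>C v = (\<Sum>i\<in>?S. c *\<^sub>C d i)" using d by (simp add: decomposition_def cvec.scale_sum_right)
  also have "\<dots> = (\<Sum>i | c *\<^sub>C d i \<noteq> 0. c *\<^sub>C d i)" by (rule sum_support_superset[OF S sub, symmetric])
  finally show ?thesis
    using d finite_subset[OF sub S] U by (auto simp: decomposition_def cvec.subspace_scale)
qed

lemma decomposition_single:
  assumes U: "\<And>i. i \<in> I \<Longrightarrow> cvec.subspace (U i)" and "j \<in> I" "u \<in> U j"
  shows "decomposition I U (\<lambda>i. if i = j then u else 0) u"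
proof -
  have sub: "{i. (if i = j then u else 0) \<noteq> 0} \<subseteq> {j}" by auto
  show ?thesis
    unfolding decomposition_def using assms finite_subset[OF sub]
    by (subst sum_support_superset[OF _ sub]) (auto simp: cvec.subspace_0)
qed

text \<open>
  For \<open>I = UNIV\<close> this is \<open>component\<close>.  The index set is kept general because the bidegree
  decomposition of the forms of one degree is indexed by a subset of all bidegrees.
\<close>

definition coord :: "'i set \<Rightarrow> ('i \<Rightarrow> 'v::complex_vector set) \<Rightarrow> 'v \<Rightarrow> 'i \<Rightarrow> 'v"
  where "coord I U v = (THE d. decomposition I U d v)"

lemma coord_UNIV: "coord UNIV U v i = component U i v"
  by (simp add: coord_def component_def decomposition_def)

context
  fixes V :: "'v::complex_vector set" and I :: "'i set" and U :: "'i \<Rightarrow> 'v set"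
  assumes sum: "internal_direct_sum V I U"
begin

lemma summand_subspace: "i \<in> I \<Longrightarrow> cvec.subspace (U i)"
  using sum by (simp add: internal_direct_sum_def)

lemma ex1_decomposition: "v \<in> V \<Longrightarrow> \<exists>!d. decomposition I U d v"
  using sum by (simp add: internal_direct_sum_def decomposition_def)

lemma decomposition_coord: "v \<in> V \<Longrightarrow> decomposition I U (coord I U v) v"
  unfolding coord_def by (rule theI'[OF ex1_decomposition])

lemma coord_unique: "v \<in> V \<Longrightarrow> decomposition I U d v \<Longrightarrow> coord I U v = d"
  using ex1_decomposition[of v] decomposition_coord[of v] by blast

lemma coord_in: "v \<in> V \<Longrightarrow> i \<in> I \<Longrightarrow> coord I U v i \<in> U i"
  using decomposition_coord[of v] by (simp add: decomposition_def)

lemma coord_add: "v \<in> V \<Longrightarrow> w \<in> V \<Longrightarrow> v + w \<in> V \<Longrightarrow>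
    coord I U (v + w) i = coord I U v i + coord I U w i"
  by (subst coord_unique[OF _ decomposition_add[OF summand_subspace decomposition_coord decomposition_coord]]) auto

lemma coord_scale: "v \<in> V \<Longrightarrow> c *\<^sub>C v \<in> V \<Longrightarrow> coord I U (c *\<^sub>C v) i = c *\<^sub>C coord I U v i"
  by (subst coord_unique[OF _ decomposition_scale[OF summand_subspace decomposition_coord]]) auto

lemma coord_single: "u \<in> V \<Longrightarrow> j \<in> I \<Longrightarrow> u \<in> U j \<Longrightarrow> coord I U u i = (if i = j then u else 0)"
  by (subst coord_unique[OF _ decomposition_single[OF summand_subspace]]) auto

lemma coord_sum:
  assumes "v \<in> V" "finite S" "\<And>i. i \<notin> S \<Longrightarrow> coord I U v i = 0"
  shows "(\<Sum>i\<in>S. coord I U v i) = v"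
proof -
  have "{i. coord I U v i \<noteq> 0} \<subseteq> S" using assms(3) by auto
  from sum_support_superset[OF assms(2) this] show ?thesis
    using decomposition_coord[OF assms(1)] by (simp add: decomposition_def)
qed

lemma coord_outside: "v \<in> V \<Longrightarrow> i \<notin> I \<Longrightarrow> coord I U v i = 0"
  using decomposition_coord[of v] by (simp add: decomposition_def)

end

section \<open>Maps on tensor products\<close>

text \<open>
  The hypotheses of the universal property, packaged; \<open>s\<close> is the identity or complex conjugation,
  according to whether the map is linear or conjugate-linear in both arguments.
\<close>

definition balanced_map ::
  "(complex \<Rightarrow> complex) \<Rightarrow> 'v::complex_vector set \<Rightarrow> ('v \<Rightarrow> 'r \<Rightarrow> 'v) \<Rightarrow>
   ('r \<Rightarrow> 'w::complex_vector \<Rightarrow> 'w) \<Rightarrow> ('v \<Rightarrow> 'w \<Rightarrow> 'x::complex_vector) \<Rightarrow> bool"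
  where "balanced_map s V ract lact \<beta> \<longleftrightarrow> (s = id \<or> s = cnj) \<and>
    (\<forall>v\<in>V. \<forall>v'\<in>V. \<forall>w. \<beta> (v + v') w = \<beta> v w + \<beta> v' w) \<and>
    (\<forall>v\<in>V. \<forall>w w'. \<beta> v (w + w') = \<beta> v w + \<beta> v w') \<and>
    (\<forall>c. \<forall>v\<in>V. \<forall>w. \<beta> (c *\<^sub>C v) w = s c *\<^sub>C \<beta> v w) \<and>
    (\<forall>c. \<forall>v\<in>V. \<forall>w. \<beta> v (c *\<^sub>C w) = s c *\<^sub>C \<beta> v w) \<and>
    (\<forall>v\<in>V. \<forall>r w. \<beta> (ract v r) w = \<beta> v (lact r w))"

lemma tens_add_left: "v \<in> V \<Longrightarrow> v' \<in> V \<Longrightarrow>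
    tens V ract lact (v + v') w = tens V ract lact v w + tens V ract lact v' w"
  by (auto simp: tens_def balanced_form_def fun_eq_iff plus_fun_apply)

lemma tens_add_right: "v \<in> V \<Longrightarrow>
    tens V ract lact v (w + w') = tens V ract lact v w + tens V ract lact v w'"
  by (auto simp: tens_def balanced_form_def fun_eq_iff plus_fun_apply)

lemma tens_scale_left: "v \<in> V \<Longrightarrow>
    tens V ract lact (c *\<^sub>C v) w = c *\<^sub>C tens V ract lact v w"
  by (auto simp: tens_def balanced_form_def fun_eq_iff scaleC_fun_def scaleC_complex_def)

lemma tens_scale_right: "v \<in> V \<Longrightarrow>
    tens V ract lact v (c *\<^sub>C w) = c *\<^sub>C tens V ract lact v w"
  by (auto simp: tens_def balanced_form_def fun_eq_iff scaleC_fun_def scaleC_complex_def)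

text \<open>
  A scalar multiple of a pure tensor is a pure tensor, so the span of pure tensors is reached by
  adding pure tensors one at a time.
\<close>

lemma tens_span_induct [consumes 1, case_names scale zero step]:
  assumes "x \<in> cvec.span {tens V ract lact v w | v w. v \<in> X \<and> w \<in> Y}"
    and X: "\<And>c v. v \<in> X \<Longrightarrow> v \<in> V \<and> c *\<^sub>C v \<in> X"
    and "P 0"
    and step: "\<And>v w y. v \<in> X \<Longrightarrow> w \<in> Y \<Longrightarrow>
      y \<in> cvec.span {tens V ract lact v w | v w. v \<in> X \<and> w \<in> Y} \<Longrightarrow> P y \<Longrightarrow>
      P (tens V ract lact v w + y)"
  shows "P x"
proof -
  let ?S = "{tens V ract lact v w | v w. v \<in> X \<and> w \<in> Y}"
  have "x \<in> cvec.span ?S \<and> P x"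
    using assms(1)
  proof (induction rule: cvec.span_induct_alt)
    case base
    then show ?case using \<open>P 0\<close> by (simp add: cvec.span_zero)
  next
    case (step c t y)
    then obtain v w where t: "t = tens V ract lact v w" "v \<in> X" "w \<in> Y" by blast
    then have "c *\<^sub>C t = tens V ract lact (c *\<^sub>C v) w" using X by (simp add: tens_scale_left)
    moreover have "c *\<^sub>C t + y \<in> cvec.span ?S"
      using step(2) cvec.span_add[OF cvec.span_scale[OF cvec.span_base[OF step(1)]]] by blast
    ultimately show ?case using assms(4)[of "c *\<^sub>C v" w y] t X step by simp
  qed
  then show ?thesis ..
qed

lemma tens_span_sum:
  assumes "x \<in> cvec.span {tens V ract lact v w | v w. v \<in> X \<and> w \<in> Y}"
    and X: "\<And>c v. v \<in> X \<Longrightarrow> v \<in> V \<and> c *\<^sub>C v \<in> X"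
  shows "\<exists>(N::nat) v w. (\<forall>i<N. v i \<in> V) \<and> x = (\<Sum>i<N. tens V ract lact (v i) (w i))"
  using assms
proof (induction rule: tens_span_induct)
  case zero
  show ?case by (rule exI[of _ 0]) auto
next
  case (step v w y)
  then obtain N :: nat and v' w' where *: "\<forall>i<N. v' i \<in> V" "y = (\<Sum>i<N. tens V ract lact (v' i) (w' i))"
    by blast
  have "(\<Sum>i<Suc N. tens V ract lact ((v'(N := v)) i) ((w'(N := w)) i)) = tens V ract lact v w + y"
    by (simp add: *(2) add.commute)
  moreover have "\<forall>i<Suc N. (v'(N := v)) i \<in> V" using * step X by (auto simp: less_Suc_eq)
  ultimately show ?case by metis
qed (use X in auto)

lemma tens_lift_of_sum:
  assumes "balanced_map s V ract lact \<beta>" "\<forall>i<N. v i \<in> V"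
  shows "tens_lift V ract lact \<beta> (\<Sum>i<N. tens V ract lact (v i) (w i)) = (\<Sum>i<(N::nat). \<beta> (v i) (w i))"
  by (rule tens_lift_sum[where s = s]) (use assms in \<open>auto simp: balanced_map_def\<close>)

lemma tens_lift_tens:
  assumes "balanced_map s V ract lact \<beta>" "v \<in> V"
  shows "tens_lift V ract lact \<beta> (tens V ract lact v w) = \<beta> v w"
  using tens_lift_of_sum[OF assms(1), of 1 "\<lambda>_. v" "\<lambda>_. w"] assms(2) by simp

lemma tens_lift_0: "balanced_map s V ract lact \<beta> \<Longrightarrow> tens_lift V ract lact \<beta> 0 = 0"
  using tens_lift_of_sum[of s V ract lact \<beta> 0] by simp

lemma tens_lift_tens_add:
  assumes \<beta>: "balanced_map s V ract lact \<beta>" and V: "\<And>c v. v \<in> V \<Longrightarrow> c *\<^sub>C v \<in> V" and v: "v \<in> V"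
    and y: "y \<in> cvec.span {tens V ract lact v w | v w. v \<in> V \<and> w \<in> Y}"
  shows "tens_lift V ract lact \<beta> (tens V ract lact v w + y) = \<beta> v w + tens_lift V ract lact \<beta> y"
proof -
  obtain N :: nat and v' w' where *: "\<forall>i<N. v' i \<in> V" "y = (\<Sum>i<N. tens V ract lact (v' i) (w' i))"
    using tens_span_sum[OF y] V by blast
  have 1: "(\<Sum>i<Suc N. tens V ract lact ((v'(N := v)) i) ((w'(N := w)) i)) = tens V ract lact v w + y"
    by (simp add: *(2) add.commute)
  have 2: "\<forall>i<Suc N. (v'(N := v)) i \<in> V" using * v by (auto simp: less_Suc_eq)
  show ?thesis
    using tens_lift_of_sum[OF \<beta> 2, of "w'(N := w)"] tens_lift_of_sum[OF \<beta> *(1), of w']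
    unfolding 1 by (simp add: *(2) add.commute)
qed

lemma tens_lift_add:
  assumes \<beta>: "balanced_map s V ract lact \<beta>" and V: "cvec.subspace V"
    and x: "x \<in> cvec.span {tens V ract lact v w | v w. v \<in> V \<and> w \<in> Y}"
    and y: "y \<in> cvec.span {tens V ract lact v w | v w. v \<in> V \<and> w \<in> Y}"
  shows "tens_lift V ract lact \<beta> (x + y) = tens_lift V ract lact \<beta> x + tens_lift V ract lact \<beta> y"
  using x
proof (induction rule: tens_span_induct)
  case (scale c v)
  then show ?case using V by (simp add: cvec.subspace_scale)
next
  case zero
  then show ?case by (simp add: tens_lift_0[OF \<beta>])
next
  case (step v w x')
  then show ?case
    using tens_lift_tens_add[OF \<beta> _ step(1), of "x' + y" Y w] tens_lift_tens_add[OF \<beta> _ step(1,3), of w]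
      cvec.span_add[OF step(3) y] V
    by (simp add: cvec.subspace_scale add.assoc)
qed

lemma tens_lift_scale:
  assumes \<beta>: "balanced_map s V ract lact \<beta>" and V: "cvec.subspace V"
    and x: "x \<in> cvec.span {tens V ract lact v w | v w. v \<in> V \<and> w \<in> Y}"
  shows "tens_lift V ract lact \<beta> (c *\<^sub>C x) = s c *\<^sub>C tens_lift V ract lact \<beta> x"
  using x
proof (induction rule: tens_span_induct)
  case (scale c v)
  then show ?case using V by (simp add: cvec.subspace_scale)
next
  case zero
  then show ?case by (simp add: tens_lift_0[OF \<beta>])
next
  case (step v w x')
  have cv: "c *\<^sub>C v \<in> V" using step V by (simp add: cvec.subspace_scale)
  have "tens_lift V ract lact \<beta> (c *\<^sub>C (tens V ract lact v w + x')) =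
      tens_lift V ract lact \<beta> (tens V ract lact (c *\<^sub>C v) w + c *\<^sub>C x')"
    using step by (simp add: tens_scale_left scaleC_add_right)
  also have "\<dots> = \<beta> (c *\<^sub>C v) w + tens_lift V ract lact \<beta> (c *\<^sub>C x')"
    by (rule tens_lift_tens_add[OF \<beta> _ cv cvec.span_scale[OF step(3)]])
       (use V in \<open>simp add: cvec.subspace_scale\<close>)
  also have "\<dots> = s c *\<^sub>C tens_lift V ract lact \<beta> (tens V ract lact v w + x')"
    using tens_lift_tens_add[OF \<beta> _ step(1,3), of w] step \<beta> V
    by (simp add: cvec.subspace_scale balanced_map_def scaleC_add_right)
  finally show ?case .
qed

section \<open>The bigrading and the Lefschetz decomposition\<close>

locale kaehler_calculus =
  fixes H :: "'a::complex_star_algebra hopf"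
    and K :: "('a, 'm::complex_star_algebra, 'w::complex_algebra_1) kaehler"
  assumes kaehler: "kaehler_structure H K"
begin

abbreviation n :: nat where "n \<equiv> half_dim K"
abbreviation \<kappa> :: 'w where "\<kappa> \<equiv> kform K"

lemma calculus: "differential_star_calculus H K" and complex_str: "complex_structure K"
  using kaehler by (auto simp: kaehler_structure_def)

lemma forms_sum: "internal_direct_sum UNIV UNIV (forms K)"
  and incl_linear: "clinear (incl K)" and incl_inj: "inj (incl K)"
  and incl_range: "range (incl K) = forms K 0" and incl_1: "incl K 1 = 1"
  and incl_mult: "incl K (m * m') = incl K m * incl K m'"
  and conj_add: "conj K (\<omega> + \<nu>) = conj K \<omega> + conj K \<nu>"
  and conj_scale: "conj K (c *\<^sub>C \<omega>) = cnj c *\<^sub>C conj K \<omega>"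
  and conj_conj: "conj K (conj K \<omega>) = \<omega>"
  and conj_incl: "conj K (incl K m) = incl K (star m)"
  using calculus by (simp_all add: differential_star_calculus_def)

lemma diffl_mult: "\<omega> \<in> forms K k \<Longrightarrow> diffl K (\<omega> * \<nu>) = diffl K \<omega> * \<nu> + (-1) ^ k *\<^sub>C (\<omega> * diffl K \<nu>)"
  using calculus by (simp add: differential_star_calculus_def)

lemma conj_mult: "\<omega> \<in> forms K k \<Longrightarrow> \<nu> \<in> forms K l \<Longrightarrow>
    conj K (\<omega> * \<nu>) = (-1) ^ (k * l) *\<^sub>C (conj K \<nu> * conj K \<omega>)"
  using calculus by (simp add: differential_star_calculus_def)

lemma biforms_sum: "internal_direct_sum (forms K k) {(a, b). a + b = k} (biforms K)"
  and biforms_mult: "\<omega> \<in> biforms K (a, b) \<Longrightarrow> \<nu> \<in> biforms K (a', b') \<Longrightarrow>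
    \<omega> * \<nu> \<in> biforms K (a + a', b + b')"
  and biforms_incl_left: "\<omega> \<in> biforms K p \<Longrightarrow> incl K m * \<omega> \<in> biforms K p"
  and biforms_incl_right: "\<omega> \<in> biforms K p \<Longrightarrow> \<omega> * incl K m \<in> biforms K p"
  and conj_biforms: "conj K ` biforms K (a, b) = biforms K (b, a)"
  and delbar_linear: "clinear (delbar K)"
  and del_biforms: "\<omega> \<in> biforms K (a, b) \<Longrightarrow> del K \<omega> \<in> biforms K (a + 1, b)"
  and delbar_biforms: "\<omega> \<in> biforms K (a, b) \<Longrightarrow> delbar K \<omega> \<in> biforms K (a, b + 1)"
  and diffl_split: "diffl K \<omega> = del K \<omega> + delbar K \<omega>"
  using complex_str by (simp_all add: complex_structure_def del: split_paired_All)

lemma forms_top: "k > 2 * n \<Longrightarrow> forms K k = {0}"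
  and kform_biform: "\<kappa> \<in> biforms K (1, 1)"
  and kform_central: "\<kappa> * \<omega> = \<omega> * \<kappa>"
  and lefschetz: "k < n \<Longrightarrow> bij_betw (Lef K ^^ (n - k)) (forms K k) (forms K (2 * n - k))"
  using kaehler by (simp_all add: kaehler_structure_def)

lemma forms_subspace: "cvec.subspace (forms K k)"
  using summand_subspace[OF forms_sum] by simp

lemma biforms_subspace: "cvec.subspace (biforms K p)"
  using summand_subspace[OF biforms_sum[of "fst p + snd p"], of p] by (cases p) auto

lemma biforms_forms: "\<omega> \<in> biforms K (a, b) \<Longrightarrow> \<omega> \<in> forms K (a + b)"
  using biforms_sum[of "a + b"] by (auto simp: internal_direct_sum_def)

lemma component_linear: "clinear (component (forms K) k)"
  by (rule clinearI) (simp_all add: coord_UNIV[symmetric] coord_add[OF forms_sum] coord_scale[OF forms_sum])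

lemma component_in: "component (forms K) k \<omega> \<in> forms K k"
  by (simp add: coord_UNIV[symmetric] coord_in[OF forms_sum])

lemma component_forms: "\<omega> \<in> forms K l \<Longrightarrow> component (forms K) k \<omega> = (if k = l then \<omega> else 0)"
  by (simp add: coord_UNIV[symmetric] coord_single[OF forms_sum])

lemma component_sum: "(\<Sum>k\<le>2 * n. component (forms K) k \<omega>) = \<omega>"
proof -
  have "component (forms K) k \<omega> = 0" if "k \<notin> {..2 * n}" for k
    using component_in[of k \<omega>] forms_top[of k] that by auto
  then show ?thesis
    using coord_sum[OF forms_sum, of \<omega> "{..2 * n}"] by (simp add: coord_UNIV)
qed

text \<open>
  The bigrading is given degree by degree, so the part of bidegree \<open>(a, b)\<close> is extracted from the part
  of degree \<open>a + b\<close>.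
\<close>

definition bipart :: "nat \<times> nat \<Rightarrow> 'w \<Rightarrow> 'w"
  where "bipart p \<omega> = coord {(a, b). a + b = fst p + snd p} (biforms K)
    (component (forms K) (fst p + snd p) \<omega>) p"

lemma bipart_linear: "clinear (bipart p)"
proof -
  note mem = cvec.subspace_add[OF forms_subspace component_in component_in]
    cvec.subspace_scale[OF forms_subspace component_in]
  show ?thesis
    by (rule clinearI)
      (simp_all add: bipart_def clinear_add[OF component_linear] clinear_scale[OF component_linear]
        coord_add[OF biforms_sum component_in component_in mem(1)]
        coord_scale[OF biforms_sum component_in mem(2)])
qed

lemma bipart_in: "bipart p \<omega> \<in> biforms K p"
  unfolding bipart_def by (rule coord_in[OF biforms_sum component_in]) (cases p, auto)

lemma bipart_biforms: "\<omega> \<in> biforms K q \<Longrightarrow> bipart p \<omega> = (if p = q then \<omega> else 0)"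
proof -
  assume \<omega>: "\<omega> \<in> biforms K q"
  obtain a b c d where pq: "p = (a, b)" "q = (c, d)" by (cases p, cases q)
  have *: "component (forms K) (a + b) \<omega> = (if a + b = c + d then \<omega> else 0)"
    using \<omega> component_forms biforms_forms pq by blast
  show ?thesis
  proof (cases "a + b = c + d")
    case True
    then show ?thesis
      using * \<omega> biforms_forms[of \<omega> c d] coord_single[OF biforms_sum, of \<omega> "c + d" "(c, d)" "(a, b)"] pq
      by (simp add: bipart_def)
  next
    case False
    then have "(a, b) \<noteq> (c, d)" by auto
    moreover have "coord {(x, y). x + y = a + b} (biforms K) 0 (a, b) = 0"
      using coord_single[OF biforms_sum, of 0 "a + b" "(a, b)" "(a, b)"]
        cvec.subspace_0[OF biforms_subspace] cvec.subspace_0[OF forms_subspace] by simp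
    ultimately show ?thesis using * False pq by (auto simp: bipart_def)
  qed
qed

definition bidegrees :: "(nat \<times> nat) set"
  where "bidegrees = {(a, b). a + b \<le> 2 * n}"

lemma finite_bidegrees: "finite bidegrees"
  by (rule finite_subset[of _ "{..2 * n} \<times> {..2 * n}"]) (auto simp: bidegrees_def)

lemma component_bipart: "component (forms K) k \<omega> = (\<Sum>p | p \<in> {(a, b). a + b = k}. bipart p \<omega>)"
proof -
  have fin: "finite {(a, b). a + b = k}"
    by (rule finite_subset[of _ "{..k} \<times> {..k}"]) auto
  have "(\<Sum>p\<in>{(a, b). a + b = k}. bipart p \<omega>) =
      (\<Sum>p\<in>{(a, b). a + b = k}. coord {(a, b). a + b = k} (biforms K) (component (forms K) k \<omega>) p)"
    by (rule sum.cong) (auto simp: bipart_def)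
  also have "\<dots> = component (forms K) k \<omega>"
    by (rule coord_sum[OF biforms_sum component_in fin]) (simp add: coord_outside[OF biforms_sum component_in])
  finally show ?thesis by simp
qed

lemma sum_bipart: "(\<Sum>p\<in>bidegrees. bipart p \<omega>) = \<omega>"
proof -
  have "(\<Sum>p\<in>bidegrees. bipart p \<omega>) =
      (\<Sum>k\<le>2 * n. \<Sum>p | p \<in> bidegrees \<and> fst p + snd p = k. bipart p \<omega>)"
    by (rule sum.group[symmetric, OF finite_bidegrees]) (auto simp: bidegrees_def)
  also have "\<dots> = (\<Sum>k\<le>2 * n. component (forms K) k \<omega>)"
    by (rule sum.cong) (auto simp: component_bipart bidegrees_def intro!: sum.cong)
  finally show ?thesis by (simp add: component_sum)
qed

lemma biform_induct [case_names biform add]: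
  assumes "\<And>p \<omega>. \<omega> \<in> biforms K p \<Longrightarrow> P \<omega>" "\<And>\<omega> \<nu>. P \<omega> \<Longrightarrow> P \<nu> \<Longrightarrow> P (\<omega> + \<nu>)"
  shows "P \<omega>"
proof -
  have "P (\<Sum>p\<in>S. bipart p \<omega>)" if "finite S" for S
    using that
  proof (induction S)
    case empty
    show ?case using assms(1)[of 0 "(0, 0)"] cvec.subspace_0[OF biforms_subspace] by simp
  next
    case (insert p S)
    then show ?case using assms bipart_in[of p \<omega>] by simp
  qed
  from this[OF finite_bidegrees] show ?thesis by (simp add: sum_bipart)
qed

lemma forms_0_biforms: "forms K 0 = biforms K (0, 0)"
proof
  show "biforms K (0, 0) \<subseteq> forms K 0" using biforms_forms[of _ 0 0] by auto
  show "forms K 0 \<subseteq> biforms K (0, 0)"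
  proof
    fix \<omega> assume "\<omega> \<in> forms K 0"
    then have "\<omega> = component (forms K) 0 \<omega>" by (simp add: component_forms)
    also have "\<dots> = bipart (0, 0) \<omega>"
    proof -
      have "{(a, b). a + b = (0::nat)} = {(0, 0)}" by auto
      then show ?thesis by (simp add: component_bipart)
    qed
    finally show "\<omega> \<in> biforms K (0, 0)" using bipart_in[of "(0, 0)" \<omega>] by simp
  qed
qed

lemma incl_biform: "incl K m \<in> biforms K (0, 0)"
  using incl_range forms_0_biforms by auto

lemma conj_biform: "\<omega> \<in> biforms K (a, b) \<Longrightarrow> conj K \<omega> \<in> biforms K (b, a)"
  using conj_biforms by blast

lemma Lef_power: "(Lef K ^^ j) \<omega> = \<kappa> ^ j * \<omega>"
  by (induction j) (simp_all add: Lef_def mult.assoc)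

lemma kform_power_biform: "\<kappa> ^ j \<in> biforms K (j, j)"
proof (induction j)
  case 0
  show ?case using incl_biform[of 1] by (simp add: incl_1)
next
  case (Suc j)
  then show ?case using biforms_mult[OF kform_biform Suc] by simp
qed

lemma kform_power_mult_biform: "\<omega> \<in> biforms K (a, b) \<Longrightarrow> \<kappa> ^ j * \<omega> \<in> biforms K (a + j, b + j)"
  using biforms_mult[OF kform_power_biform] by (simp add: add.commute)

lemma kform_power_central: "\<kappa> ^ j * \<omega> = \<omega> * \<kappa> ^ j"
  by (induction j) (simp_all add: mult.assoc, metis kform_central mult.assoc)

lemma lefschetz_inj:
  assumes "k \<le> n" "\<omega> \<in> forms K k" "\<kappa> ^ (n - k) * \<omega> = 0"
  shows "\<omega> = 0"
proof (cases "k = n")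
  case False
  then have "inj_on (Lef K ^^ (n - k)) (forms K k)"
    using assms lefschetz[of k] by (auto simp: bij_betw_def)
  from inj_onD[OF this, of \<omega> 0] show ?thesis
    using assms cvec.subspace_0[OF forms_subspace] by (simp add: Lef_power)
qed (use assms in auto)

lemma lefschetz_surj:
  assumes "k \<le> n" "\<nu> \<in> forms K (2 * n - k)"
  shows "\<exists>\<omega>\<in>forms K k. \<kappa> ^ (n - k) * \<omega> = \<nu>"
proof (cases "k = n")
  case True
  then show ?thesis using assms by (auto intro: bexI[of _ \<nu>])
next
  case False
  then have "(Lef K ^^ (n - k)) ` forms K k = forms K (2 * n - k)"
    using assms lefschetz[of k] by (auto simp: bij_betw_def)
  then obtain \<omega> where "\<omega> \<in> forms K k" "(Lef K ^^ (n - k)) \<omega> = \<nu>" using assms(2) by (metis imageE)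
  then show ?thesis by (auto simp: Lef_power)
qed

text \<open>
  A triple \<open>(a, b, j)\<close> stands for the summand \<open>L\<^sup>j P\<^sup>(\<^sup>a\<^sup>,\<^sup>b\<^sup>)\<close> of the Lefschetz decomposition.
\<close>

definition lefschetz_index :: "(nat \<times> nat \<times> nat) set"
  where "lefschetz_index = {(a, b, j). a + b + j \<le> n}"

text \<open>
  Independent of \<open>j\<close>; triples are used so that a family of primitive forms is indexed by the Lefschetz
  summands to which its members contribute.
\<close>

definition prim :: "nat \<times> nat \<times> nat \<Rightarrow> 'w set"
  where "prim = (\<lambda>(a, b, j). primitive K (a + b) \<inter> biforms K (a, b))"

definition lefschetz_sum :: "(nat \<times> nat \<times> nat \<Rightarrow> 'w) \<Rightarrow> 'w"
  where "lefschetz_sum A = (\<Sum>(a, b, j)\<in>lefschetz_index. \<kappa> ^ j * A (a, b, j))"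

lemma finite_lefschetz_index: "finite lefschetz_index"
  by (rule finite_subset[of _ "{..n} \<times> {..n} \<times> {..n}"]) (auto simp: lefschetz_index_def)

lemma primitive_iff: "k \<le> n \<Longrightarrow> \<alpha> \<in> primitive K k \<longleftrightarrow> \<alpha> \<in> forms K k \<and> \<kappa> ^ (n - k + 1) * \<alpha> = 0"
  by (simp only: primitive_def Lef_power if_True mem_Collect_eq)

lemma prim_iff: "(a, b, j) \<in> lefschetz_index \<Longrightarrow>
    \<alpha> \<in> prim (a, b, j) \<longleftrightarrow> \<alpha> \<in> biforms K (a, b) \<and> \<kappa> ^ (n - (a + b) + 1) * \<alpha> = 0"
  using primitive_iff[of "a + b" \<alpha>] biforms_forms[of \<alpha> a b] by (auto simp: prim_def lefschetz_index_def)

lemma prim_subspace: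
  assumes "i \<in> lefschetz_index"
  shows "cvec.subspace (prim i)"
proof -
  obtain a b j where i: "i = (a, b, j)" by (cases i)
  show ?thesis
    using assms cvec.subspace_0[OF biforms_subspace] cvec.subspace_add[OF biforms_subspace]
      cvec.subspace_scale[OF biforms_subspace]
    unfolding i cvec.subspace_def
    by (simp add: prim_iff distrib_left mult_scaleC_right)
qed

lemma prim_power_zero:
  assumes "(a, b, j) \<in> lefschetz_index" "\<alpha> \<in> prim (a, b, j)" "n - (a + b) + 1 \<le> l"
  shows "\<kappa> ^ l * \<alpha> = 0"
proof -
  have "\<kappa> ^ l = \<kappa> ^ (l - (n - (a + b) + 1)) * \<kappa> ^ (n - (a + b) + 1)"
    using assms(3) by (simp only: power_add[symmetric]) simp
  then show ?thesis using assms prim_iff[of a b j \<alpha>] by (simp add: mult.assoc)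
qed

text \<open>
  Consider the terms of one bidegree, and let \<open>\<alpha>\<^sub>j\<close> have degree \<open>k\<close>.  A term \<open>L\<^sup>i \<alpha>\<^sub>i\<close> with \<open>i < j\<close> has
  \<open>\<alpha>\<^sub>i\<close> of degree \<open>k + 2(j - i)\<close> and is killed by \<open>L\<^sup>n\<^sup>-\<^sup>k\<^sup>-\<^sup>j\<close>, since \<open>\<alpha>\<^sub>i\<close> is primitive.  If the terms with
  \<open>i > j\<close> are already known to vanish, only \<open>L\<^sup>n\<^sup>-\<^sup>k \<alpha>\<^sub>j\<close> survives, and \<open>L\<^sup>n\<^sup>-\<^sup>k\<close> is injective in degree \<open>k\<close>.
\<close>

lemma lefschetz_unique:
  assumes A: "\<And>i. i \<in> lefschetz_index \<Longrightarrow> A i \<in> prim i" and sum: "lefschetz_sum A = 0"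
    and ij: "(a, b, j) \<in> lefschetz_index"
  shows "A (a, b, j) = 0"
  using ij
proof (induction "n - j" arbitrary: a b j rule: less_induct)
  case (less j a b)
  let ?T = "\<lambda>\<omega>. \<kappa> ^ (n - (a + b + j)) * bipart (a + j, b + j) \<omega>"
  have lin: "clinear ?T"
    by (rule clinear_comp[OF bipart_linear clinear_mult_left])
  have *: "?T (\<kappa> ^ j' * A (a', b', j')) = (if (a', b', j') = (a, b, j) then \<kappa> ^ (n - (a + b)) * A (a, b, j) else 0)"
    if i: "(a', b', j') \<in> lefschetz_index" for a' b' j'
  proof -
    have mem: "\<kappa> ^ j' * A (a', b', j') \<in> biforms K (a' + j', b' + j')"
      using A[OF i] prim_iff[OF i] by (intro kform_power_mult_biform) auto
    show ?thesis
    proof (cases "a' + j' = a + j \<and> b' + j' = b + j")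
      case False
      then show ?thesis
        using bipart_biforms[OF mem, of "(a + j, b + j)"] by auto
    next
      case True
      then have T: "?T (\<kappa> ^ j' * A (a', b', j')) = \<kappa> ^ (n - (a + b + j) + j') * A (a', b', j')"
        using bipart_biforms[OF mem, of "(a + j, b + j)"] by (simp add: power_add mult.assoc)
      consider "j' = j" | "j' > j" | "j' < j" by linarith
      then show ?thesis
      proof cases
        case 1
        have "n - (a + b + j) + j = n - (a + b)" using less.prems by (auto simp: lefschetz_index_def)
        then show ?thesis using True T 1 by (simp add: power_add)
      next
        case 2
        have "j' \<le> n" using i by (auto simp: lefschetz_index_def)
        then have "A (a', b', j') = 0" using less.hyps[of j' a' b'] 2 i by simp
        then show ?thesis using T 2 by simp
      next
        case 3
        have "\<kappa> ^ (n - (a + b + j) + j') * A (a', b', j') = 0"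
          by (rule prim_power_zero[OF i A[OF i]])
            (use True 3 i less.prems in \<open>auto simp: lefschetz_index_def\<close>)
        then show ?thesis using T 3 by simp
      qed
    qed
  qed
  have "0 = ?T (lefschetz_sum A)" using sum clinear_0[OF lin] by simp
  also have "\<dots> = (\<Sum>i\<in>lefschetz_index. ?T (case i of (a, b, j) \<Rightarrow> \<kappa> ^ j * A (a, b, j)))"
    unfolding lefschetz_sum_def by (rule clinear_sum[OF lin])
  also have "\<dots> = (\<Sum>i\<in>lefschetz_index. if i = (a, b, j) then \<kappa> ^ (n - (a + b)) * A (a, b, j) else 0)"
    by (rule sum.cong) (use * in \<open>auto split: prod.split\<close>)
  also have "\<dots> = \<kappa> ^ (n - (a + b)) * A (a, b, j)"
    using less.prems finite_lefschetz_index by simp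
  finally have "\<kappa> ^ (n - (a + b)) * A (a, b, j) = 0" by simp
  moreover have "A (a, b, j) \<in> forms K (a + b)"
    using A[OF less.prems] prim_iff[OF less.prems] biforms_forms by blast
  ultimately show ?case
    using lefschetz_inj[of "a + b" "A (a, b, j)"] less.prems by (auto simp: lefschetz_index_def)
qed

lemma lefschetz_sum_add: "lefschetz_sum (\<lambda>i. A i + A' i) = lefschetz_sum A + lefschetz_sum A'"
  by (simp add: lefschetz_sum_def distrib_left case_prod_beta sum.distrib)

lemma lefschetz_sum_scale: "lefschetz_sum (\<lambda>i. c *\<^sub>C A i) = c *\<^sub>C lefschetz_sum A"
  by (simp add: lefschetz_sum_def mult_scaleC_right case_prod_beta cvec.scale_sum_right)

definition lefschetz_family :: "'w \<Rightarrow> (nat \<times> nat \<times> nat \<Rightarrow> 'w) \<Rightarrow> bool"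
  where "lefschetz_family \<omega> A \<longleftrightarrow> (\<forall>i\<in>lefschetz_index. A i \<in> prim i) \<and>
    (\<forall>i. i \<notin> lefschetz_index \<longrightarrow> A i = 0) \<and> lefschetz_sum A = \<omega>"

lemma lefschetz_family_add:
  "lefschetz_family \<omega> A \<Longrightarrow> lefschetz_family \<nu> A' \<Longrightarrow> lefschetz_family (\<omega> + \<nu>) (\<lambda>i. A i + A' i)"
  by (auto simp: lefschetz_family_def lefschetz_sum_add cvec.subspace_add[OF prim_subspace])

lemma lefschetz_family_scale:
  "lefschetz_family \<omega> A \<Longrightarrow> lefschetz_family (c *\<^sub>C \<omega>) (\<lambda>i. c *\<^sub>C A i)"
  by (auto simp: lefschetz_family_def lefschetz_sum_scale cvec.subspace_scale[OF prim_subspace])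

lemma lefschetz_family_single:
  assumes "(a, b, j) \<in> lefschetz_index" "\<alpha> \<in> prim (a, b, j)"
  shows "lefschetz_family (\<kappa> ^ j * \<alpha>) (\<lambda>i. if i = (a, b, j) then \<alpha> else 0)"
proof -
  have "lefschetz_sum (\<lambda>i. if i = (a, b, j) then \<alpha> else 0) =
      (\<Sum>i\<in>lefschetz_index. if i = (a, b, j) then \<kappa> ^ j * \<alpha> else 0)"
    unfolding lefschetz_sum_def by (rule sum.cong) (auto split: if_split_asm)
  then show ?thesis
    using assms finite_lefschetz_index
    by (auto simp: lefschetz_family_def cvec.subspace_0[OF prim_subspace])
qed

lemma lefschetz_family_unique:
  assumes "lefschetz_family \<omega> A" "lefschetz_family \<omega> A'"
  shows "A = A'"
proof
  fix i :: "nat \<times> nat \<times> nat"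
  obtain a b j where i: "i = (a, b, j)" by (cases i)
  have d: "lefschetz_family (\<omega> + (-1) *\<^sub>C \<omega>) (\<lambda>i. A i + (-1) *\<^sub>C A' i)"
    by (intro lefschetz_family_add lefschetz_family_scale assms)
  show "A i = A' i"
  proof (cases "i \<in> lefschetz_index")
    case True
    then have "A (a, b, j) + (-1) *\<^sub>C A' (a, b, j) = 0"
      using d unfolding i
      by (intro lefschetz_unique[of "\<lambda>i. A i + (-1) *\<^sub>C A' i"]) (auto simp: lefschetz_family_def scaleC_one)
    then show ?thesis by (simp add: i scaleC_one)
  qed (use assms in \<open>auto simp: lefschetz_family_def i\<close>)
qed

text \<open>
  Multiplication by powers of the Kaehler form shifts bidegrees, so the defining equation of
  primitivity holds for each bihomogeneous part.
\<close>

lemma primitive_bipart: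
  assumes "k \<le> n" "\<alpha> \<in> primitive K k" "a + b = k"
  shows "bipart (a, b) \<alpha> \<in> prim (a, b, j)"
proof -
  have shift: "\<kappa> ^ l * bipart (a, b) \<omega> = bipart (a + l, b + l) (\<kappa> ^ l * \<omega>)" for l \<omega>
  proof (induction \<omega> rule: biform_induct)
    case (biform p \<omega>)
    obtain c d where p: "p = (c, d)" by (cases p)
    show ?case
      using bipart_biforms[OF biform, of "(a, b)"]
        bipart_biforms[OF kform_power_mult_biform, of \<omega> c d "(a + l, b + l)" l] biform p
      by auto
  next
    case (add \<omega> \<nu>)
    then show ?case by (simp add: clinear_add[OF bipart_linear] distrib_left)
  qed
  have "\<kappa> ^ (n - (a + b) + 1) * \<alpha> = 0"
    using assms primitive_iff[of k \<alpha>] by simp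
  then have "\<kappa> ^ (n - (a + b) + 1) * bipart (a, b) \<alpha> = 0"
    by (simp only: shift clinear_0[OF bipart_linear])
  then show ?thesis
    using bipart_in[of "(a, b)" \<alpha>] primitive_iff[of "a + b"] biforms_forms[of _ a b] assms
    by (auto simp: prim_def)
qed

text \<open>
  The classical argument: by surjectivity of \<open>L\<^sup>n\<^sup>-\<^sup>k\<^sup>+\<^sup>2\<close> on forms of degree \<open>k - 2\<close>, a form of degree
  \<open>k \<le> n\<close> is primitive modulo the image of \<open>L\<close>.
\<close>

lemma lefschetz_step:
  assumes "k \<le> n" "\<omega> \<in> forms K k"
  shows "\<omega> \<in> primitive K k \<or> (\<exists>\<alpha>\<in>primitive K k. \<exists>\<omega>'\<in>forms K (k - 2). 2 \<le> k \<and> \<omega> = \<alpha> + \<kappa> * \<omega>')"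
proof -
  have deg: "\<kappa> ^ j * \<nu> \<in> forms K (l + 2 * j)" if "\<nu> \<in> forms K l" for j l \<nu>
  proof -
    have "\<kappa> ^ j \<in> forms K (2 * j)" using biforms_forms[OF kform_power_biform[of j]] by (simp add: mult_2)
    then have "\<kappa> ^ j * \<nu> \<in> forms K (2 * j + l)"
      using calculus that by (simp add: differential_star_calculus_def)
    then show ?thesis by (simp add: add.commute)
  qed
  have mem: "\<kappa> ^ (n - k + 1) * \<omega> \<in> forms K (k + 2 * (n - k + 1))"
    by (rule deg[OF assms(2)])
  show ?thesis
  proof (cases "k < 2")
    case True
    then have "forms K (k + 2 * (n - k + 1)) = {0}" using assms by (intro forms_top) arith
    then show ?thesis using mem assms by (simp add: primitive_iff)
  next
    case False
    then have "k + 2 * (n - k + 1) = 2 * n - (k - 2)" using assms by arith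
    from mem[unfolded this] have top: "\<kappa> ^ (n - k + 1) * \<omega> \<in> forms K (2 * n - (k - 2))" .
    have "k - 2 \<le> n" using assms by arith
    from lefschetz_surj[OF this top] obtain \<omega>' where \<omega>': "\<omega>' \<in> forms K (k - 2)" "\<kappa> ^ (n - (k - 2)) * \<omega>' = \<kappa> ^ (n - k + 1) * \<omega>" by blast
    have e: "n - (k - 2) = n - k + 1 + 1" using False assms by linarith
    have "k - 2 + 2 * 1 = k" using False by simp
    from deg[OF \<omega>'(1), of 1, unfolded this] have k': "\<kappa> * \<omega>' \<in> forms K k" by simp
    have z: "\<kappa> ^ (n - k + 1) * (\<omega> - \<kappa> * \<omega>') = \<kappa> ^ (n - k + 1) * \<omega> - \<kappa> ^ (n - k + 1) * (\<kappa> * \<omega>')"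
      by (rule right_diff_distrib)
    have "\<kappa> ^ (n - (k - 2)) * \<omega>' = \<kappa> ^ (n - k + 1) * (\<kappa> * \<omega>')"
      unfolding e power_add[of _ _ 1] by (simp only: power_one_right mult.assoc)
    then have "\<kappa> ^ (n - k + 1) * (\<omega> - \<kappa> * \<omega>') = 0" using \<omega>' z by simp
    then have "\<omega> - \<kappa> * \<omega>' \<in> primitive K k"
      using k' assms cvec.subspace_diff[OF forms_subspace] by (subst primitive_iff) auto
    then show ?thesis using \<omega>' False by (intro disjI2 bexI[of _ "\<omega> - \<kappa> * \<omega>'"] bexI[of _ \<omega>']) auto
  qed
qed

text \<open>
  In degrees up to \<open>n\<close> one iterates \<open>lefschetz_step\<close>; every form of degree above \<open>n\<close> is a power of \<open>L\<close>
  applied to a form of degree below \<open>n\<close>.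
\<close>

lemma lefschetz_exists: "\<exists>A. lefschetz_family \<omega> A"
proof -
  have sums: "\<exists>A. lefschetz_family (\<Sum>p\<in>S. g p) A"
    if "finite S" "\<And>p. p \<in> S \<Longrightarrow> \<exists>A. lefschetz_family (g p) A" for S :: "'i set" and g
    using that
  proof (induction S)
    case empty
    have "lefschetz_family 0 (\<lambda>_. 0)"
      by (auto simp: lefschetz_family_def lefschetz_sum_def cvec.subspace_0[OF prim_subspace])
    then show ?case by auto
  next
    case (insert p S)
    then obtain A A' where "lefschetz_family (g p) A" "lefschetz_family (\<Sum>p\<in>S. g p) A'" by blast
    from lefschetz_family_add[OF this] show ?case using insert by auto
  qed
  have prim: "\<exists>A. lefschetz_family (\<kappa> ^ j * \<alpha>) A" if "k \<le> n" "\<alpha> \<in> primitive K k" for k j \<alpha>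
  proof (cases "j \<le> n - k")
    case True
    have \<alpha>: "\<alpha> = (\<Sum>p | p \<in> {(a, b). a + b = k}. bipart p \<alpha>)"
      using that component_forms[of \<alpha> k k] primitive_iff[of k \<alpha>]
      by (subst component_bipart[symmetric]) metis
    have "\<kappa> ^ j * \<alpha> = (\<Sum>p | p \<in> {(a, b). a + b = k}. \<kappa> ^ j * bipart p \<alpha>)"
      by (rule trans[OF arg_cong[OF \<alpha>, of "(*) (\<kappa> ^ j)"] sum_distrib_left])
    moreover have "finite {p. p \<in> {(a, b). a + b = k}}"
      by (rule finite_subset[of _ "{..k} \<times> {..k}"]) auto
    moreover have "\<exists>A. lefschetz_family (\<kappa> ^ j * bipart p \<alpha>) A" if p: "p \<in> {(a, b). a + b = k}" for p
    proof -
      obtain a b where ab: "p = (a, b)" "a + b = k" using p by auto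
      have "(a, b, j) \<in> lefschetz_index" using ab True \<open>k \<le> n\<close> by (simp add: lefschetz_index_def)
      from lefschetz_family_single[OF this primitive_bipart[OF \<open>k \<le> n\<close> \<open>\<alpha> \<in> primitive K k\<close> ab(2)]]
      show ?thesis using ab by auto
    qed
    ultimately show ?thesis using sums[of "{p. p \<in> {(a, b). a + b = k}}"] by simp
  next
    case False
    then have "\<kappa> ^ j * \<alpha> = \<kappa> ^ (j - (n - k + 1)) * (\<kappa> ^ (n - k + 1) * \<alpha>)"
      unfolding mult.assoc[symmetric] power_add[symmetric] by simp
    also have "\<dots> = 0" using that by (simp only: primitive_iff mult_zero_right)
    finally show ?thesis using sums[of "{}"] by simp
  qed
  \<comment> \<open>the exponent \<open>j\<close> is general because a factor \<open>\<kappa>\<close> is split off in each induction step\<close>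
  have low: "\<exists>A. lefschetz_family (\<kappa> ^ j * \<omega>) A" if "k \<le> n" "\<omega> \<in> forms K k" for k j \<omega>
    using that
  proof (induction k arbitrary: j \<omega> rule: less_induct)
    case (less k)
    from lefschetz_step[OF less.prems] show ?case
    proof
      assume "\<omega> \<in> primitive K k"
      then show ?thesis using prim less.prems by blast
    next
      assume "\<exists>\<alpha>\<in>primitive K k. \<exists>\<omega>'\<in>forms K (k - 2). 2 \<le> k \<and> \<omega> = \<alpha> + \<kappa> * \<omega>'"
      then obtain \<alpha> \<omega>' where *: "\<alpha> \<in> primitive K k" "\<omega>' \<in> forms K (k - 2)" "2 \<le> k" "\<omega> = \<alpha> + \<kappa> * \<omega>'" by blast
      obtain A where A: "lefschetz_family (\<kappa> ^ j * \<alpha>) A" using prim[OF less.prems(1) *(1)] by blast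
      have "k - 2 \<le> n" using less.prems by arith
      then obtain A' where "lefschetz_family (\<kappa> ^ Suc j * \<omega>') A'"
        using less.IH[of "k - 2" \<omega>' "Suc j"] * less.prems by auto
      from lefschetz_family_add[OF A this]
      have "lefschetz_family (\<kappa> ^ j * \<omega>) (\<lambda>i. A i + A' i)"
        using *(4) by (simp add: distrib_left power_commutes mult.assoc[symmetric])
      then show ?thesis by blast
    qed
  qed
  have all: "\<exists>A. lefschetz_family \<omega> A" if "\<omega> \<in> forms K k" "k \<le> 2 * n" for k \<omega>
  proof (cases "k \<le> n")
    case True
    then show ?thesis using low[of k \<omega> 0] that by simp
  next
    case False
    have "2 * n - (2 * n - k) = k" using that by simp
    then have top: "\<omega> \<in> forms K (2 * n - (2 * n - k))" using that by (simp only:)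
    have le: "2 * n - k \<le> n" using False by arith
    from lefschetz_surj[OF le top] obtain \<nu>
      where \<nu>: "\<nu> \<in> forms K (2 * n - k)" "\<kappa> ^ (n - (2 * n - k)) * \<nu> = \<omega>" by blast
    from low[OF le \<nu>(1), of "n - (2 * n - k)"] show ?thesis by (simp only: \<nu>(2))
  qed
  have "\<exists>A. lefschetz_family (\<Sum>k\<in>{..2 * n}. component (forms K) k \<omega>) A"
    by (rule sums) (auto intro!: all[OF component_in])
  then show ?thesis by (simp add: component_sum)
qed

definition lefschetz_coord :: "'w \<Rightarrow> nat \<times> nat \<times> nat \<Rightarrow> 'w"
  where "lefschetz_coord \<omega> = (SOME A. lefschetz_family \<omega> A)"

lemma lefschetz_coord: "lefschetz_family \<omega> (lefschetz_coord \<omega>)"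
  unfolding lefschetz_coord_def by (rule someI_ex[OF lefschetz_exists])

lemma lefschetz_coord_eq: "lefschetz_family \<omega> A \<Longrightarrow> lefschetz_coord \<omega> = A"
  by (rule lefschetz_family_unique[OF lefschetz_coord])

lemma lefschetz_coord_linear: "clinear (\<lambda>\<omega>. lefschetz_coord \<omega> i)"
proof (rule clinearI)
  show "lefschetz_coord (x + y) i = lefschetz_coord x i + lefschetz_coord y i" for x y
    using lefschetz_coord_eq[OF lefschetz_family_add[OF lefschetz_coord lefschetz_coord]] by simp
  show "lefschetz_coord (c *\<^sub>C x) i = c *\<^sub>C lefschetz_coord x i" for c x
    using lefschetz_coord_eq[OF lefschetz_family_scale[OF lefschetz_coord]] by simp
qed

lemma lefschetz_coord_in: "i \<in> lefschetz_index \<Longrightarrow> lefschetz_coord \<omega> i \<in> prim i"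
  using lefschetz_coord[of \<omega>] by (simp add: lefschetz_family_def)

lemma lefschetz_coord_sum: "\<omega> = (\<Sum>(a, b, j)\<in>lefschetz_index. \<kappa> ^ j * lefschetz_coord \<omega> (a, b, j))"
  using lefschetz_coord[of \<omega>] by (simp add: lefschetz_family_def lefschetz_sum_def)

text \<open>The Lefschetz decomposition, projected to bidegree \<open>(p, q)\<close>.\<close>

lemma biform_lefschetz_sum:
  assumes "\<omega> \<in> biforms K (p, q)"
  shows "\<omega> = (\<Sum>(a, b, j) | (a, b, j) \<in> lefschetz_index \<and> a + j = p \<and> b + j = q.
    \<kappa> ^ j * lefschetz_coord \<omega> (a, b, j))"
proof -
  let ?J = "{(a, b, j). (a, b, j) \<in> lefschetz_index \<and> a + j = p \<and> b + j = q}"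
  let ?g = "\<lambda>(a, b, j). \<kappa> ^ j * lefschetz_coord \<omega> (a, b, j)"
  have mem: "?g (a, b, j) \<in> biforms K (a + j, b + j)" if "(a, b, j) \<in> lefschetz_index" for a b j
    using lefschetz_coord_in[OF that, of \<omega>] prim_iff[OF that] by (auto intro: kform_power_mult_biform)
  have bp: "bipart (p, q) (?g (a, b, j)) = (if a + j = p \<and> b + j = q then ?g (a, b, j) else 0)"
    if "(a, b, j) \<in> lefschetz_index" for a b j
    using bipart_biforms[OF mem[OF that], of "(p, q)"] by auto
  have "\<omega> = bipart (p, q) \<omega>" using assms by (simp add: bipart_biforms)
  also have "\<dots> = bipart (p, q) (\<Sum>i\<in>lefschetz_index. ?g i)"
    using lefschetz_coord_sum[of \<omega>] by simp
  also have "\<dots> = (\<Sum>i\<in>lefschetz_index. bipart (p, q) (?g i))"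
    by (rule clinear_sum[OF bipart_linear])
  also have "\<dots> = (\<Sum>i\<in>?J. bipart (p, q) (?g i))"
  proof (rule sum.mono_neutral_right[OF finite_lefschetz_index])
    show "?J \<subseteq> lefschetz_index" by auto
    show "\<forall>i\<in>lefschetz_index - ?J. bipart (p, q) (?g i) = 0"
    proof
      fix i assume "i \<in> lefschetz_index - ?J"
      then obtain a b j where "i = (a, b, j)" "(a, b, j) \<in> lefschetz_index" "\<not> (a + j = p \<and> b + j = q)"
        by (cases i) auto
      then show "bipart (p, q) (?g i) = 0" using bp[of a b j] by auto
    qed
  qed
  also have "\<dots> = (\<Sum>i\<in>?J. ?g i)"
  proof (rule sum.cong)
    fix i assume "i \<in> ?J"
    then obtain a b j where "i = (a, b, j)" "(a, b, j) \<in> lefschetz_index" "a + j = p" "b + j = q"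
      by (cases i) auto
    then show "bipart (p, q) (?g i) = ?g i" using bp[of a b j] by auto
  qed simp
  finally show ?thesis .
qed

text \<open>
  A summand \<open>L\<^sup>j P\<^sup>(\<^sup>a\<^sup>,\<^sup>b\<^sup>)\<close> lies in bidegree \<open>(a + j, b + j)\<close> with \<open>a + b + j \<le> n\<close>.
\<close>

lemma biforms_outside: "\<not> (p \<le> n \<and> q \<le> n) \<Longrightarrow> \<omega> \<in> biforms K (p, q) \<Longrightarrow> \<omega> = 0"
proof -
  assume pq: "\<not> (p \<le> n \<and> q \<le> n)" and \<omega>: "\<omega> \<in> biforms K (p, q)"
  have empty: "{(a, b, j). (a, b, j) \<in> lefschetz_index \<and> a + j = p \<and> b + j = q} = {}"
    using pq by (auto simp: lefschetz_index_def)
  show "\<omega> = 0" using biform_lefschetz_sum[OF \<omega>] unfolding empty by simp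
qed

end

section \<open>The Hodge map and the volume functional\<close>

context kaehler_calculus
begin

definition hodge_coeff :: "nat \<times> nat \<times> nat \<Rightarrow> complex"
  where "hodge_coeff = (\<lambda>(a, b, j). (-1) ^ ((a + b) * (a + b + 1) div 2) * \<i> powi (int a - int b) *
    (fact j / fact (n - j - (a + b))))"

lemma hodge_coeff_nonzero: "hodge_coeff i \<noteq> 0"
  by (cases i) (simp add: hodge_coeff_def)

definition hodge_map :: "'w \<Rightarrow> 'w"
  where "hodge_map \<omega> = (\<Sum>(a, b, j)\<in>lefschetz_index.
    hodge_coeff (a, b, j) *\<^sub>C (\<kappa> ^ (n - j - (a + b)) * lefschetz_coord \<omega> (a, b, j)))"

lemma hodge_map_linear: "clinear hodge_map"
  unfolding hodge_map_def case_prod_beta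
  by (intro clinear_sumI clinear_scaleC clinear_comp[OF lefschetz_coord_linear clinear_mult_left])

lemma hodge_map_lefschetz:
  assumes "(a, b, j) \<in> lefschetz_index" "\<alpha> \<in> prim (a, b, j)"
  shows "hodge_map (\<kappa> ^ j * \<alpha>) = hodge_coeff (a, b, j) *\<^sub>C (\<kappa> ^ (n - j - (a + b)) * \<alpha>)"
proof -
  have "hodge_map (\<kappa> ^ j * \<alpha>) = (\<Sum>i\<in>lefschetz_index. if i = (a, b, j)
      then hodge_coeff (a, b, j) *\<^sub>C (\<kappa> ^ (n - j - (a + b)) * \<alpha>) else 0)"
    unfolding hodge_map_def lefschetz_coord_eq[OF lefschetz_family_single[OF assms]]
    by (rule sum.cong) (auto split: if_split_asm)
  then show ?thesis using assms finite_lefschetz_index by simp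
qed

text \<open>
  The Lefschetz coordinates provide one linear map with the prescribed values, and the Lefschetz
  summands span, so there is no other.
\<close>

lemma Hodge_eq: "Hodge K = hodge_map"
  unfolding Hodge_def
proof (rule the_equality)
  show "clinear hodge_map \<and>
    (\<forall>a b j \<alpha>. \<alpha> \<in> primitive K (a + b) \<inter> biforms K (a, b) \<and> a + b + j \<le> n \<longrightarrow>
       hodge_map ((Lef K ^^ j) \<alpha>) =
         ((-1) ^ ((a + b) * (a + b + 1) div 2) * \<i> powi (int a - int b) *
           (fact j / fact (n - j - (a + b)))) *\<^sub>C (Lef K ^^ (n - j - (a + b))) \<alpha>)"
    using hodge_map_linear hodge_map_lefschetz
    by (auto simp: Lef_power prim_def lefschetz_index_def hodge_coeff_def)
next
  fix s :: "'w \<Rightarrow> 'w"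
  assume s: "clinear s \<and>
    (\<forall>a b j \<alpha>. \<alpha> \<in> primitive K (a + b) \<inter> biforms K (a, b) \<and> a + b + j \<le> n \<longrightarrow>
       s ((Lef K ^^ j) \<alpha>) =
         ((-1) ^ ((a + b) * (a + b + 1) div 2) * \<i> powi (int a - int b) *
           (fact j / fact (n - j - (a + b)))) *\<^sub>C (Lef K ^^ (n - j - (a + b))) \<alpha>)"
  show "s = hodge_map"
  proof
    fix \<omega>
    have summand: "s (\<kappa> ^ j * \<alpha>) = hodge_coeff (a, b, j) *\<^sub>C (\<kappa> ^ (n - j - (a + b)) * \<alpha>)"
      if "(a, b, j) \<in> lefschetz_index" "\<alpha> \<in> prim (a, b, j)" for a b j \<alpha>
      using s that by (simp add: Lef_power prim_def lefschetz_index_def hodge_coeff_def)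
    have "s \<omega> = s (\<Sum>(a, b, j)\<in>lefschetz_index. \<kappa> ^ j * lefschetz_coord \<omega> (a, b, j))"
      by (subst lefschetz_coord_sum[of \<omega>]) (rule refl)
    also have "\<dots> = (\<Sum>i\<in>lefschetz_index. s (case i of (a, b, j) \<Rightarrow> \<kappa> ^ j * lefschetz_coord \<omega> (a, b, j)))"
      using s by (intro clinear_sum) simp
    also have "\<dots> = hodge_map \<omega>"
      unfolding hodge_map_def by (rule sum.cong) (auto simp: summand[OF _ lefschetz_coord_in] simp del: diff_diff_left)
    finally show "s \<omega> = hodge_map \<omega>" .
  qed
qed

lemma Hodge_linear: "clinear (Hodge K)"
  by (simp add: Hodge_eq hodge_map_linear)

lemma Hodge_lefschetz:
  assumes "(a, b, j) \<in> lefschetz_index" "\<alpha> \<in> prim (a, b, j)"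
  shows "Hodge K (\<kappa> ^ j * \<alpha>) = hodge_coeff (a, b, j) *\<^sub>C (\<kappa> ^ (n - j - (a + b)) * \<alpha>)"
  by (simp add: Hodge_eq hodge_map_lefschetz[OF assms])

lemma lefschetz_induct [case_names lefschetz add]:
  assumes P: "\<And>a b j \<alpha>. (a, b, j) \<in> lefschetz_index \<Longrightarrow> \<alpha> \<in> prim (a, b, j) \<Longrightarrow> P (\<kappa> ^ j * \<alpha>)"
    and add: "\<And>\<omega> \<nu>. P \<omega> \<Longrightarrow> P \<nu> \<Longrightarrow> P (\<omega> + \<nu>)"
  shows "P \<omega>"
proof -
  have "P (\<Sum>(a, b, j)\<in>S. \<kappa> ^ j * lefschetz_coord \<omega> (a, b, j))" if "S \<subseteq> lefschetz_index" for S
    using finite_subset[OF that finite_lefschetz_index] that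
  proof (induction S)
    case empty
    have "(0, 0, 0) \<in> lefschetz_index" by (simp add: lefschetz_index_def)
    from P[OF this cvec.subspace_0[OF prim_subspace[OF this]]] show ?case by simp
  next
    case (insert i S)
    then show ?case using P lefschetz_coord_in[of i \<omega>] by (cases i) (auto intro!: add)
  qed
  from this[of lefschetz_index] show ?thesis by (simp flip: lefschetz_coord_sum)
qed

lemma Hodge_biform:
  assumes "\<omega> \<in> biforms K (p, q)"
  shows "Hodge K \<omega> \<in> biforms K (n - q, n - p)"
proof -
  let ?J = "{(a, b, j). (a, b, j) \<in> lefschetz_index \<and> a + j = p \<and> b + j = q}"
  let ?g = "\<lambda>i. case i of (a, b, j) \<Rightarrow> \<kappa> ^ j * lefschetz_coord \<omega> (a, b, j)"
  have "Hodge K \<omega> = Hodge K (\<Sum>i\<in>?J. ?g i)"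
    by (rule arg_cong[OF biform_lefschetz_sum[OF assms]])
  also have "\<dots> = (\<Sum>i\<in>?J. Hodge K (?g i))"
    by (rule clinear_sum[OF Hodge_linear])
  also have "\<dots> \<in> biforms K (n - q, n - p)"
  proof (rule cvec.subspace_sum[OF biforms_subspace])
    fix i assume "i \<in> ?J"
    then obtain a b j where i: "i = (a, b, j)" and L: "(a, b, j) \<in> lefschetz_index"
      and ab: "a + j = p" "b + j = q" by auto
    have e: "a + (n - j - (a + b)) = n - q" "b + (n - j - (a + b)) = n - p"
      using L ab by (auto simp: lefschetz_index_def)
    have "lefschetz_coord \<omega> (a, b, j) \<in> biforms K (a, b)"
      using lefschetz_coord_in[OF L, of \<omega>] prim_iff[OF L] by simp
    from kform_power_mult_biform[OF this, of "n - j - (a + b)"]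
    show "Hodge K (?g i) \<in> biforms K (n - q, n - p)"
      unfolding e by (simp add: i Hodge_lefschetz[OF L lefschetz_coord_in[OF L]] cvec.subspace_scale[OF biforms_subspace])
  qed
  finally show ?thesis .
qed

text \<open>
  Up to a non-zero scalar the Hodge map exchanges \<open>L\<^sup>j \<alpha>\<close> and \<open>L\<^sup>n\<^sup>-\<^sup>j\<^sup>-\<^sup>k \<alpha>\<close>, so it hits each
  Lefschetz summand.
\<close>

lemma Hodge_surj:
  assumes "p \<le> n" "q \<le> n" and \<omega>: "\<omega> \<in> biforms K (p, q)"
  shows "\<exists>\<nu>\<in>biforms K (n - q, n - p). Hodge K \<nu> = \<omega>"
proof -
  let ?J = "{(a, b, j). (a, b, j) \<in> lefschetz_index \<and> a + j = p \<and> b + j = q}"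
  let ?g = "\<lambda>i. case i of (a, b, j) \<Rightarrow> \<kappa> ^ j * lefschetz_coord \<omega> (a, b, j)"
  have "\<exists>\<nu>\<in>biforms K (n - q, n - p). Hodge K \<nu> = ?g i" if iJ: "i \<in> ?J" for i
  proof -
    obtain a b j where i: "i = (a, b, j)" and L: "(a, b, j) \<in> lefschetz_index"
      and ab: "a + j = p" "b + j = q" using iJ by auto
    let ?l = "n - j - (a + b)" and ?\<alpha> = "lefschetz_coord \<omega> (a, b, j)"
    have e: "a + ?l = n - q" "b + ?l = n - p" "n - ?l - (a + b) = j"
      and L': "(a, b, ?l) \<in> lefschetz_index"
      using L ab by (auto simp: lefschetz_index_def)
    have \<alpha>: "?\<alpha> \<in> prim (a, b, ?l)" using lefschetz_coord_in[OF L, of \<omega>] by (simp add: prim_def)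
    have "?\<alpha> \<in> biforms K (a, b)" using \<alpha> prim_iff[OF L'] by simp
    from kform_power_mult_biform[OF this, of ?l]
    have "\<kappa> ^ ?l * ?\<alpha> \<in> biforms K (n - q, n - p)" by (simp only: e)
    then have mem: "inverse (hodge_coeff (a, b, ?l)) *\<^sub>C (\<kappa> ^ ?l * ?\<alpha>) \<in> biforms K (n - q, n - p)"
      by (rule cvec.subspace_scale[OF biforms_subspace])
    have "Hodge K (inverse (hodge_coeff (a, b, ?l)) *\<^sub>C (\<kappa> ^ ?l * ?\<alpha>)) = \<kappa> ^ j * ?\<alpha>"
      unfolding clinear_scale[OF Hodge_linear] Hodge_lefschetz[OF L' \<alpha>] e(3)
      by (simp add: scaleC_scaleC hodge_coeff_nonzero scaleC_one)
    with mem show ?thesis by (auto simp: i)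
  qed
  then have "\<forall>i\<in>?J. \<exists>\<nu>. \<nu> \<in> biforms K (n - q, n - p) \<and> Hodge K \<nu> = ?g i" by blast
  from bchoice[OF this] obtain \<nu>
    where "\<forall>i\<in>?J. \<nu> i \<in> biforms K (n - q, n - p) \<and> Hodge K (\<nu> i) = ?g i" ..
  then have \<nu>: "\<nu> i \<in> biforms K (n - q, n - p)" "Hodge K (\<nu> i) = ?g i" if "i \<in> ?J" for i
    using that by blast+
  have "Hodge K (\<Sum>i\<in>?J. \<nu> i) = (\<Sum>i\<in>?J. Hodge K (\<nu> i))" by (rule clinear_sum[OF Hodge_linear])
  also have "\<dots> = (\<Sum>i\<in>?J. ?g i)" by (rule sum.cong[OF refl \<nu>(2)])
  also have "\<dots> = \<omega>" by (rule biform_lefschetz_sum[OF \<omega>, symmetric])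
  finally have "Hodge K (\<Sum>i\<in>?J. \<nu> i) = \<omega>" .
  moreover have "(\<Sum>i\<in>?J. \<nu> i) \<in> biforms K (n - q, n - p)"
    by (rule cvec.subspace_sum[OF biforms_subspace \<nu>(1)])
  ultimately show ?thesis by blast
qed

lemma Hodge_surj_all: "\<exists>\<nu>. Hodge K \<nu> = \<omega>"
proof (induction \<omega> rule: biform_induct)
  case (biform p \<omega>)
  then show ?case
    using Hodge_surj[of "fst p" "snd p" \<omega>] biforms_outside[of "fst p" "snd p" \<omega>] clinear_0[OF Hodge_linear]
    by (cases "fst p \<le> n \<and> snd p \<le> n") auto
next
  case (add \<omega> \<nu>)
  then obtain x y where "Hodge K x = \<omega>" "Hodge K y = \<nu>" by blast
  then have "Hodge K (x + y) = \<omega> + \<nu>" by (simp add: clinear_add[OF Hodge_linear])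
  then show ?case ..
qed

text \<open>
  Multiplication by \<open>M\<close> commutes with \<open>L\<close> and preserves primitive forms.
\<close>

lemma Hodge_incl_left: "Hodge K (incl K m * \<omega>) = incl K m * Hodge K \<omega>"
proof (induction \<omega> rule: lefschetz_induct)
  case (lefschetz a b j \<alpha>)
  have comm: "incl K m * (\<kappa> ^ l * \<alpha>) = \<kappa> ^ l * (incl K m * \<alpha>)" for l
    by (metis kform_power_central mult.assoc)
  have "incl K m * \<alpha> \<in> prim (a, b, j)"
    using lefschetz(2) unfolding prim_iff[OF lefschetz(1)]
    by (simp add: biforms_incl_left comm[symmetric] del: power_Suc add_Suc_right One_nat_def)
  then show ?case
    using lefschetz by (simp add: comm Hodge_lefschetz mult_scaleC_right)
next
  case (add \<omega> \<nu>)
  then show ?case by (simp add: distrib_left clinear_add[OF Hodge_linear])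
qed

text \<open>
  \<open>(n, n)\<close> is the only bidegree of total degree \<open>2n\<close> with both entries at most \<open>n\<close>.
\<close>

lemma component_top: "component (forms K) (2 * n) \<omega> = bipart (n, n) \<omega>"
proof -
  have fin: "finite {(a, b). a + b = 2 * n}"
    by (rule finite_subset[of _ "{..2 * n} \<times> {..2 * n}"]) auto
  have "bipart p \<omega> = (if p = (n, n) then bipart (n, n) \<omega> else 0)" if "p \<in> {(a, b). a + b = 2 * n}" for p
    using biforms_outside[of "fst p" "snd p" "bipart p \<omega>"] bipart_in[of p \<omega>] that by force
  then have "(\<Sum>p\<in>{(a, b). a + b = 2 * n}. bipart p \<omega>) =
      (\<Sum>p\<in>{(a, b). a + b = 2 * n}. if p = (n, n) then bipart (n, n) \<omega> else 0)"
    by (rule sum.cong[OF refl])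
  also have "\<dots> = bipart (n, n) \<omega>" using fin by simp
  finally show ?thesis by (simp add: component_bipart)
qed

lemma incl_vol: "incl K (vol K \<omega>) = Hodge K (bipart (n, n) \<omega>)"
proof -
  have "Hodge K (bipart (n, n) \<omega>) \<in> range (incl K)"
    using Hodge_biform[OF bipart_in[of "(n, n)" \<omega>]] incl_range forms_0_biforms by simp
  then show ?thesis by (simp add: vol_def component_top f_inv_into_f)
qed

lemma vol_linear: "clinear (vol K)"
proof (rule clinearI)
  show "vol K (x + y) = vol K x + vol K y" for x y
    by (rule injD[OF incl_inj])
      (simp add: incl_vol clinear_add[OF incl_linear] clinear_add[OF bipart_linear] clinear_add[OF Hodge_linear])
  show "vol K (c *\<^sub>C x) = c *\<^sub>C vol K x" for c x
    by (rule injD[OF incl_inj])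
      (simp add: incl_vol clinear_scale[OF incl_linear] clinear_scale[OF bipart_linear] clinear_scale[OF Hodge_linear])
qed

lemma vol_biform: "\<omega> \<in> biforms K p \<Longrightarrow> p \<noteq> (n, n) \<Longrightarrow> vol K \<omega> = 0"
  by (rule injD[OF incl_inj])
    (simp add: incl_vol clinear_0[OF incl_linear] clinear_0[OF Hodge_linear] bipart_biforms)

section \<open>The Dolbeault operator\<close>

text \<open>
  The part of bidegree \<open>(a + c, b + d + 1)\<close> of the Leibniz rule for \<open>d\<close>, where \<open>(c, d)\<close> is the
  bidegree of the second factor.
\<close>

lemma delbar_mult_biform:
  assumes \<omega>: "\<omega> \<in> biforms K (a, b)"
  shows "delbar K (\<omega> * \<nu>) = delbar K \<omega> * \<nu> + (-1) ^ (a + b) *\<^sub>C (\<omega> * delbar K \<nu>)"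
proof (induction \<nu> rule: biform_induct)
  case (biform p \<nu>)
  obtain c d where p: "p = (c, d)" by (cases p)
  have \<nu>: "\<nu> \<in> biforms K (c, d)" using biform p by simp
  let ?q = "(a + c, b + d + 1)"
  let ?s = "(-1) ^ (a + b) :: complex"
  note bp = clinear_add[OF bipart_linear] clinear_scale[OF bipart_linear]
  have "del K (\<omega> * \<nu>) + delbar K (\<omega> * \<nu>) =
      (del K \<omega> * \<nu> + delbar K \<omega> * \<nu>) + ?s *\<^sub>C (\<omega> * del K \<nu> + \<omega> * delbar K \<nu>)"
    using diffl_mult[OF biforms_forms[OF \<omega>], of \<nu>] by (simp add: diffl_split distrib_left distrib_right)
  then have "bipart ?q (del K (\<omega> * \<nu>) + delbar K (\<omega> * \<nu>)) =
      bipart ?q ((del K \<omega> * \<nu> + delbar K \<omega> * \<nu>) + ?s *\<^sub>C (\<omega> * del K \<nu> + \<omega> * delbar K \<nu>))"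
    by simp
  then show ?case
    using bipart_biforms[OF del_biforms[OF biforms_mult[OF \<omega> \<nu>]], of ?q]
      bipart_biforms[OF delbar_biforms[OF biforms_mult[OF \<omega> \<nu>]], of ?q]
      bipart_biforms[OF biforms_mult[OF del_biforms[OF \<omega>] \<nu>], of ?q]
      bipart_biforms[OF biforms_mult[OF delbar_biforms[OF \<omega>] \<nu>], of ?q]
      bipart_biforms[OF biforms_mult[OF \<omega> del_biforms[OF \<nu>]], of ?q]
      bipart_biforms[OF biforms_mult[OF \<omega> delbar_biforms[OF \<nu>]], of ?q]
    by (simp add: bp)
next
  case (add \<nu> \<nu>')
  then show ?case by (simp add: clinear_add[OF delbar_linear] distrib_left scaleC_add_right algebra_simps)
qed

lemma grading_involution_sum:
  "grading_involution K \<omega> = (\<Sum>k\<le>2 * n. (-1) ^ k *\<^sub>C component (forms K) k \<omega>)"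
  unfolding grading_involution_def
proof (rule sum.mono_neutral_left)
  show "{k. component (forms K) k \<omega> \<noteq> 0} \<subseteq> {..2 * n}"
    using component_in[of _ \<omega>] forms_top by (force simp: not_le[symmetric])
qed auto

lemma grading_involution_linear: "clinear (grading_involution K)"
  unfolding grading_involution_sum by (intro clinear_sumI clinear_scaleC component_linear)

lemma grading_involution_biform:
  assumes "\<omega> \<in> biforms K (a, b)"
  shows "grading_involution K \<omega> = (-1) ^ (a + b) *\<^sub>C \<omega>"
proof (cases "\<omega> = 0")
  case True
  then show ?thesis by (simp add: clinear_0[OF grading_involution_linear])
next
  case False
  have "component (forms K) k \<omega> = (if k = a + b then \<omega> else 0)" for k
    by (rule component_forms[OF biforms_forms[OF assms]])
  then have "{k. component (forms K) k \<omega> \<noteq> 0} = {a + b}" using False by auto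
  then show ?thesis
    using component_forms[OF biforms_forms[OF assms], of "a + b"] by (simp add: grading_involution_def)
qed

lemma grading_involution_incl: "grading_involution K (incl K m) = incl K m"
  using grading_involution_biform[OF incl_biform] by (simp add: scaleC_one)

lemma grading_involution_mult_incl:
  "grading_involution K (\<omega> * incl K m) = grading_involution K \<omega> * incl K m"
proof (induction \<omega> rule: biform_induct)
  case (biform p \<omega>)
  then show ?case
    by (cases p) (simp add: grading_involution_biform biforms_incl_right mult_scaleC_left)
qed (simp add: distrib_right clinear_add[OF grading_involution_linear])

lemma delbar_mult: "delbar K (\<omega> * \<nu>) = delbar K \<omega> * \<nu> + grading_involution K \<omega> * delbar K \<nu>"
proof (induction \<omega> rule: biform_induct)
  case (biform p \<omega>)
  then show ?case
    by (cases p) (simp add: grading_involution_biform mult_scaleC_left delbar_mult_biform)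
qed (simp add: distrib_right clinear_add[OF delbar_linear] clinear_add[OF grading_involution_linear] algebra_simps)

lemma conj_mult_incl: "conj K (\<omega> * incl K m) = incl K (star m) * conj K \<omega>"
proof (induction \<omega> rule: biform_induct)
  case (biform p \<omega>)
  then have "\<omega> \<in> forms K (fst p + snd p)" using biforms_forms by (cases p) auto
  moreover have "incl K m \<in> forms K 0" using incl_range by auto
  ultimately show ?case using conj_mult[of \<omega> _ "incl K m" 0] by (simp add: conj_incl scaleC_one)
qed (simp add: distrib_left distrib_right conj_add)

end

section \<open>The integral\<close>

text \<open>Polarisation, with the vectors \<open>x + y\<close> and \<open>x + \<i> y\<close>.\<close>

lemma sesquilinear_hermitian:
  fixes g :: "'v::complex_vector \<Rightarrow> 'v \<Rightarrow> complex"
  assumes add: "\<And>x y z. g (x + y) z = g x z + g y z" "\<And>x y z. g x (y + z) = g x y + g x z"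
    and scale: "\<And>c x y. g (c *\<^sub>C x) y = c * g x y" "\<And>c x y. g x (c *\<^sub>C y) = cnj c * g x y"
    and real: "\<And>x. cnj (g x x) = g x x"
  shows "g x y = cnj (g y x)"
proof -
  have 1: "g x y + g y x = cnj (g x y) + cnj (g y x)"
    using real[of "x + y"] by (simp add: add real algebra_simps)
  have "- \<i> * g x y + \<i> * g y x = cnj (- \<i> * g x y + \<i> * g y x)"
    using real[of "x + \<i> *\<^sub>C y"] by (simp add: add scale real algebra_simps)
  then have "\<i> * (- g x y + g y x) = \<i> * (cnj (g x y) - cnj (g y x))"
    by (simp add: algebra_simps)
  then have "- g x y + g y x = cnj (g x y) - cnj (g y x)"
    by simp
  then have "(g x y + g y x) + (- g x y + g y x) =
      (cnj (g x y) + cnj (g y x)) + (cnj (g x y) - cnj (g y x))"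
    using 1 by (simp only:)
  then have "2 * g y x = 2 * cnj (g x y)" by simp
  then show ?thesis by simp
qed

locale kaehler_state = kaehler_calculus H K
  for H :: "'a::complex_star_algebra hopf"
    and K :: "('a, 'm::complex_star_algebra, 'w::complex_algebra_1) kaehler" +
  fixes f :: "'m \<Rightarrow> complex"
  assumes positive: "positive_definite_kaehler K" and state: "state f" and closed: "closed_integral K f"
begin

abbreviation \<I> :: "'w \<Rightarrow> complex" where "\<I> \<equiv> form_integral K f"

lemma integral_linear: "clinear \<I>"
proof -
  have "clinear f" using state by (simp add: state_def)
  from clinear_comp[OF vol_linear this] show ?thesis by (simp add: form_integral_def[abs_def])
qed

lemma integral_add: "\<I> (\<omega> + \<nu>) = \<I> \<omega> + \<I> \<nu>" and integral_0: "\<I> 0 = 0"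
  and integral_scale: "\<I> (c *\<^sub>C \<omega>) = c * \<I> \<omega>"
  using clinear_add[OF integral_linear] clinear_0[OF integral_linear] clinear_scale[OF integral_linear]
  by (simp_all add: scaleC_complex_def)

lemma integral_biform: "\<omega> \<in> biforms K p \<Longrightarrow> p \<noteq> (n, n) \<Longrightarrow> \<I> \<omega> = 0"
  using state by (simp add: form_integral_def vol_biform state_def clinear_0)

text \<open>
  Only forms of bidegree \<open>(n, n - 1)\<close> matter.  For these \<open>\<partial>\<omega>\<close> would have bidegree \<open>(n + 1, n - 1)\<close>
  and vanishes, so the operator agrees with \<open>d\<close> and closedness of the integral applies.
\<close>

lemma integral_delbar: "\<I> (delbar K \<omega>) = 0"
proof (induction \<omega> rule: biform_induct)
  case (biform p \<omega>)
  obtain a b where p: "p = (a, b)" by (cases p)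
  have mem: "delbar K \<omega> \<in> biforms K (a, b + 1)" using biform p delbar_biforms by simp
  show ?case
  proof (cases "(a, b + 1) = (n, n)")
    case False
    then show ?thesis by (rule integral_biform[OF mem])
  next
    case True
    have "del K \<omega> \<in> biforms K (n + 1, b)" using biform p True del_biforms[of \<omega> a b] by simp
    then have "del K \<omega> = 0" using biforms_outside[of "n + 1" b] by simp
    then have "diffl K \<omega> = delbar K \<omega>" by (simp add: diffl_split)
    moreover have "\<omega> \<in> forms K (a + b)" using biform p biforms_forms by simp
    moreover have "a + b + 1 = 2 * n" using True by simp
    ultimately show ?thesis using closed by (metis closed_integral_def)
  qed
qed (simp add: clinear_add[OF delbar_linear] integral_add)

lemma integral_Hodge_pos: "\<omega> \<noteq> 0 \<Longrightarrow> \<exists>r>0. \<I> (\<omega> * Hodge K (conj K \<omega>)) = complex_of_real r"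
  using positive state by (auto simp: positive_definite_kaehler_def state_def form_integral_def)

text \<open>
  Write \<open>\<nu> = \<star>\<eta>\<close> and test against \<open>\<eta>*\<close>.
\<close>

lemma integral_nondegenerate_right:
  assumes "\<And>\<omega>. \<I> (\<omega> * \<nu>) = 0"
  shows "\<nu> = 0"
proof -
  obtain \<eta> where \<eta>: "Hodge K \<eta> = \<nu>" using Hodge_surj_all by blast
  have "conj K \<eta> = 0"
    using integral_Hodge_pos[of "conj K \<eta>"] assms[of "conj K \<eta>"] \<eta> by (auto simp: conj_conj)
  then have "\<eta> = 0" using conj_conj[of \<eta>] conj_scale[of 0 0] by simp
  then show ?thesis using \<eta> clinear_0[OF Hodge_linear] by simp
qed

lemma integral_nondegenerate_left:
  assumes "\<And>\<nu>. \<I> (\<omega> * \<nu>) = 0"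
  shows "\<omega> = 0"
  using integral_Hodge_pos[of \<omega>] assms by auto

text \<open>
  Positive definiteness makes the diagonal values real.
\<close>

lemma integral_Hodge_hermitian: "\<I> (\<omega> * Hodge K (conj K \<nu>)) = cnj (\<I> (\<nu> * Hodge K (conj K \<omega>)))"
proof (rule sesquilinear_hermitian[where g = "\<lambda>\<omega> \<nu>. \<I> (\<omega> * Hodge K (conj K \<nu>))"])
  show "cnj (\<I> (x * Hodge K (conj K x))) = \<I> (x * Hodge K (conj K x))" for x
    using integral_Hodge_pos[of x] by (cases "x = 0") (auto simp: integral_0)
qed (simp_all add: distrib_right distrib_left conj_add conj_scale clinear_add[OF Hodge_linear]
    clinear_scale[OF Hodge_linear] integral_add integral_scale mult_scaleC_left mult_scaleC_right)

text \<open>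
  The form in which Hermitian symmetry is used for bundles: there \<open>m\<close> is a value of the Hermitian
  structure, and \<open>star m\<close> the value with its arguments exchanged.
\<close>

lemma integral_Hodge_incl_hermitian:
  "\<I> (\<omega> * incl K m * Hodge K (conj K \<nu>)) = cnj (\<I> (\<nu> * incl K (star m) * Hodge K (conj K \<omega>)))"
  using integral_Hodge_hermitian[of "\<omega> * incl K m" \<nu>] by (simp add: conj_mult_incl Hodge_incl_left mult.assoc)

end

section \<open>Forms with values in a bundle and in its dual\<close>

locale kaehler_bundle = kaehler_calculus H K
  for H :: "'a::complex_star_algebra hopf"
    and K :: "('a, 'm::complex_star_algebra, 'w::complex_algebra_1) kaehler" +
  fixes E :: "('a, 'm, 'w, 'f::complex_vector) bundle_data"
  assumes holomorphic: "holomorphic_vector_bundle H K E"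
begin

abbreviation tF :: "'w \<Rightarrow> 'f \<Rightarrow> ('w, 'f) tensor" where "tF \<equiv> tensF K E"
abbreviation tD :: "('f \<Rightarrow> 'm) \<Rightarrow> 'w \<Rightarrow> ('f \<Rightarrow> 'm, 'w) tensor" where "tD \<equiv> tensD K E"
abbreviation VF :: "('w, 'f) tensor set" where "VF \<equiv> formsF K E UNIV"
abbreviation VD :: "('f \<Rightarrow> 'm, 'w) tensor set" where "VD \<equiv> formsD K E UNIV"
abbreviation balF :: "(complex \<Rightarrow> complex) \<Rightarrow> ('w \<Rightarrow> 'f \<Rightarrow> 'x::complex_vector) \<Rightarrow> bool"
  where "balF s \<equiv> balanced_map s UNIV (\<lambda>\<omega> m. \<omega> * incl K m) (act E)"
abbreviation balD :: "(complex \<Rightarrow> complex) \<Rightarrow> (('f \<Rightarrow> 'm) \<Rightarrow> 'w \<Rightarrow> 'x::complex_vector) \<Rightarrow> bool"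
  where "balD s \<equiv> balanced_map s (dual E) dual_act (\<lambda>m \<omega>. incl K m * \<omega>)"

lemma E_vector_bundle: "vector_bundle H K E"
  and dbarF_linear: "clinear (dbarF E)" and dbarF_in: "dbarF E x \<in> formsF K E (biforms K (0, 1))"
  and dbarF_act: "dbarF E (act E m x) = tF (delbar K (incl K m)) x + wedgeF K E (incl K m) (dbarF E x)"
  and dbar_ext_squared: "\<alpha> \<in> VF \<Longrightarrow> dbar_ext K E (dbar_ext K E \<alpha>) = 0"
  using holomorphic by (simp_all add: holomorphic_vector_bundle_def)

lemma act_1: "act E 1 x = x"
  and act_scale_left: "act E (c *\<^sub>C m) x = c *\<^sub>C act E m x"
  and projective: "finitely_generated_projective (act E)"
  using E_vector_bundle by (simp_all add: vector_bundle_def)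

lemma dual_add: "\<phi> \<in> dual E \<Longrightarrow> \<phi> (x + y) = \<phi> x + \<phi> y"
  and dual_act_left: "\<phi> \<in> dual E \<Longrightarrow> \<phi> (act E m x) = m * \<phi> x"
  by (simp_all add: dual_def)

lemma dual_scale: "\<phi> \<in> dual E \<Longrightarrow> \<phi> (c *\<^sub>C x) = c *\<^sub>C \<phi> x"
  using dual_act_left[of \<phi> "c *\<^sub>C 1" x] by (simp add: act_scale_left act_1 mult_scaleC_left)

lemma dual_subspace: "cvec.subspace (dual E)"
  by (auto simp: cvec.subspace_def dual_def scaleC_fun_def zero_fun_apply plus_fun_apply
      scaleC_add_right mult_scaleC_right distrib_left algebra_simps)

lemma dual_act_in: "\<phi> \<in> dual E \<Longrightarrow> dual_act \<phi> m \<in> dual E"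
  by (simp add: dual_def dual_act_def distrib_right mult.assoc)

lemma tensF_add_left: "tF (\<omega> + \<omega>') x = tF \<omega> x + tF \<omega>' x"
  and tensF_add_right: "tF \<omega> (x + y) = tF \<omega> x + tF \<omega> y"
  and tensF_scale_left: "tF (c *\<^sub>C \<omega>) x = c *\<^sub>C tF \<omega> x"
  and tensF_scale_right: "tF \<omega> (c *\<^sub>C x) = c *\<^sub>C tF \<omega> x"
  and tensF_balanced: "tF (\<omega> * incl K m) x = tF \<omega> (act E m x)"
  unfolding tensF_def by (simp_all add: tens_add_left tens_add_right tens_scale_left tens_scale_right
      tens_balanced[of \<omega> UNIV "\<lambda>\<omega> m. \<omega> * incl K m"])

lemma tensD_add_left: "\<phi> \<in> dual E \<Longrightarrow> \<phi>' \<in> dual E \<Longrightarrow> tD (\<phi> + \<phi>') \<nu> = tD \<phi> \<nu> + tD \<phi>' \<nu>"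
  and tensD_add_right: "\<phi> \<in> dual E \<Longrightarrow> tD \<phi> (\<nu> + \<nu>') = tD \<phi> \<nu> + tD \<phi> \<nu>'"
  and tensD_scale_left: "\<phi> \<in> dual E \<Longrightarrow> tD (c *\<^sub>C \<phi>) \<nu> = c *\<^sub>C tD \<phi> \<nu>"
  and tensD_scale_right: "\<phi> \<in> dual E \<Longrightarrow> tD \<phi> (c *\<^sub>C \<nu>) = c *\<^sub>C tD \<phi> \<nu>"
  and tensD_balanced: "\<phi> \<in> dual E \<Longrightarrow> tD (dual_act \<phi> m) \<nu> = tD \<phi> (incl K m * \<nu>)"
  unfolding tensD_def by (simp_all add: tens_add_left tens_add_right tens_scale_left tens_scale_right
      tens_balanced[of \<phi> "dual E" dual_act])

lemma tensF_0: "tF 0 x = 0" "tF \<omega> 0 = 0"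
  using tensF_scale_left[of 0 0 x] tensF_scale_right[of \<omega> 0 0] by simp_all

lemma tensD_0: "\<phi> \<in> dual E \<Longrightarrow> tD \<phi> 0 = 0" "tD 0 \<nu> = 0"
  using tensD_scale_right[of \<phi> 0 0] tensD_scale_left[of 0 0 \<nu>] cvec.subspace_0[OF dual_subspace] by simp_all

lemma formsF_span: "formsF K E X = cvec.span {tens UNIV (\<lambda>\<omega> m. \<omega> * incl K m) (act E) v w | v w. v \<in> X \<and> w \<in> UNIV}"
  by (simp add: formsF_def tensF_def)

lemma formsD_span: "formsD K E X = cvec.span {tens (dual E) dual_act (\<lambda>m \<omega>. incl K m * \<omega>) v w | v w. v \<in> dual E \<and> w \<in> X}"
  by (simp add: formsD_def tensD_def)

lemma formsF_subspace: "cvec.subspace (formsF K E X)"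
  by (simp add: formsF_def)

lemma formsD_subspace: "cvec.subspace (formsD K E X)"
  by (simp add: formsD_def)

lemmas formsF_closed = cvec.subspace_0[OF formsF_subspace] cvec.subspace_add[OF formsF_subspace]
  cvec.subspace_scale[OF formsF_subspace] cvec.subspace_diff[OF formsF_subspace]
lemmas formsD_closed = cvec.subspace_0[OF formsD_subspace] cvec.subspace_add[OF formsD_subspace]
  cvec.subspace_scale[OF formsD_subspace] cvec.subspace_diff[OF formsD_subspace]

lemma tensF_in: "\<omega> \<in> X \<Longrightarrow> tF \<omega> x \<in> formsF K E X"
  unfolding formsF_def by (rule cvec.span_base) auto

lemma tensD_in: "\<phi> \<in> dual E \<Longrightarrow> \<nu> \<in> X \<Longrightarrow> tD \<phi> \<nu> \<in> formsD K E X"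
  unfolding formsD_def by (rule cvec.span_base) auto

lemma formsF_UNIV: "\<alpha> \<in> formsF K E X \<Longrightarrow> \<alpha> \<in> VF"
  using cvec.span_mono[of "{tF \<omega> x | \<omega> x. \<omega> \<in> X}" "{tF \<omega> x | \<omega> x. \<omega> \<in> UNIV}"]
  by (auto simp: formsF_def)

lemma formsD_UNIV: "\<beta> \<in> formsD K E X \<Longrightarrow> \<beta> \<in> VD"
  using cvec.span_mono[of "{tD \<phi> \<nu> | \<phi> \<nu>. \<phi> \<in> dual E \<and> \<nu> \<in> X}" "{tD \<phi> \<nu> | \<phi> \<nu>. \<phi> \<in> dual E \<and> \<nu> \<in> UNIV}"]
  by (auto simp: formsD_def)

lemma formsF_induct [consumes 2, case_names tens add]:
  assumes \<alpha>: "\<alpha> \<in> formsF K E X" and X: "cvec.subspace X"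
    and tens: "\<And>\<omega> x. \<omega> \<in> X \<Longrightarrow> P (tF \<omega> x)"
    and add: "\<And>\<alpha> \<alpha>'. \<alpha> \<in> formsF K E X \<Longrightarrow> \<alpha>' \<in> formsF K E X \<Longrightarrow> P \<alpha> \<Longrightarrow> P \<alpha>' \<Longrightarrow> P (\<alpha> + \<alpha>')"
  shows "P \<alpha>"
  using \<alpha> unfolding formsF_span
proof (induction rule: tens_span_induct)
  case (scale c v)
  then show ?case using X by (simp add: cvec.subspace_scale)
next
  case zero
  then show ?case using tens[OF cvec.subspace_0[OF X], of 0] by (simp add: tensF_0)
next
  case (step v w y)
  then show ?case using add[OF tensF_in[OF step(1), of w], of y] tens[of v w]
    by (simp add: formsF_span) (simp add: tensF_def)
qed

lemma formsD_induct [consumes 2, case_names tens add]: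
  assumes \<beta>: "\<beta> \<in> formsD K E X" and X: "cvec.subspace X"
    and tens: "\<And>\<phi> \<nu>. \<phi> \<in> dual E \<Longrightarrow> \<nu> \<in> X \<Longrightarrow> P (tD \<phi> \<nu>)"
    and add: "\<And>\<beta> \<beta>'. \<beta> \<in> formsD K E X \<Longrightarrow> \<beta>' \<in> formsD K E X \<Longrightarrow> P \<beta> \<Longrightarrow> P \<beta>' \<Longrightarrow> P (\<beta> + \<beta>')"
  shows "P \<beta>"
  using \<beta> unfolding formsD_span
proof (induction rule: tens_span_induct)
  case (scale c v)
  then show ?case using dual_subspace by (simp add: cvec.subspace_scale)
next
  case zero
  then show ?case
    using tens[OF cvec.subspace_0[OF dual_subspace] cvec.subspace_0[OF X]] by (simp add: tensD_0)
next
  case (step v w y)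
  then show ?case using add[OF tensD_in[OF step(1,2)], of y] tens[of v w]
    by (simp add: formsD_span) (simp add: tensD_def)
qed

lemmas VF_induct [consumes 1, case_names tens add] = formsF_induct[OF _ cvec.subspace_UNIV]
lemmas VD_induct [consumes 1, case_names tens add] = formsD_induct[OF _ cvec.subspace_UNIV]

lemma liftF_tens: "balF s \<beta> \<Longrightarrow> liftF K E \<beta> (tF \<omega> x) = \<beta> \<omega> x"
  by (simp add: liftF_def tensF_def tens_lift_tens)

lemma liftF_add: "balF s \<beta> \<Longrightarrow> \<alpha> \<in> VF \<Longrightarrow> \<alpha>' \<in> VF \<Longrightarrow> liftF K E \<beta> (\<alpha> + \<alpha>') = liftF K E \<beta> \<alpha> + liftF K E \<beta> \<alpha>'"
  unfolding liftF_def formsF_span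
  by (rule tens_lift_add[where Y = UNIV]; (assumption | rule cvec.subspace_UNIV))

lemma liftF_scale: "balF s \<beta> \<Longrightarrow> \<alpha> \<in> VF \<Longrightarrow> liftF K E \<beta> (c *\<^sub>C \<alpha>) = s c *\<^sub>C liftF K E \<beta> \<alpha>"
  unfolding liftF_def formsF_span
  by (rule tens_lift_scale[where Y = UNIV]; (assumption | rule cvec.subspace_UNIV))

lemma liftD_tens: "balD s \<beta> \<Longrightarrow> \<phi> \<in> dual E \<Longrightarrow> liftD K E \<beta> (tD \<phi> \<nu>) = \<beta> \<phi> \<nu>"
  by (simp add: liftD_def tensD_def tens_lift_tens)

lemma liftD_add: "balD s \<beta> \<Longrightarrow> \<alpha> \<in> VD \<Longrightarrow> \<alpha>' \<in> VD \<Longrightarrow> liftD K E \<beta> (\<alpha> + \<alpha>') = liftD K E \<beta> \<alpha> + liftD K E \<beta> \<alpha>'"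
  unfolding liftD_def formsD_span
  by (rule tens_lift_add[where Y = UNIV]; (assumption | rule dual_subspace))

lemma liftD_scale: "balD s \<beta> \<Longrightarrow> \<alpha> \<in> VD \<Longrightarrow> liftD K E \<beta> (c *\<^sub>C \<alpha>) = s c *\<^sub>C liftD K E \<beta> \<alpha>"
  unfolding liftD_def formsD_span
  by (rule tens_lift_scale[where Y = UNIV]; (assumption | rule dual_subspace))

subsection \<open>Multiplication by forms and the evaluation pairing\<close>

lemma wedgeF_bal: "balF id (\<lambda>\<eta> x. tF (\<omega> * \<eta>) x)"
  by (simp add: balanced_map_def distrib_left tensF_add_left tensF_add_right tensF_scale_left
      tensF_scale_right mult_scaleC_right tensF_balanced mult.assoc[symmetric])

lemma wedgeF_tens: "wedgeF K E \<omega> (tF \<eta> x) = tF (\<omega> * \<eta>) x"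
  by (simp add: wedgeF_def liftF_tens[OF wedgeF_bal])

lemma wedgeF_add: "\<alpha> \<in> VF \<Longrightarrow> \<alpha>' \<in> VF \<Longrightarrow> wedgeF K E \<omega> (\<alpha> + \<alpha>') = wedgeF K E \<omega> \<alpha> + wedgeF K E \<omega> \<alpha>'"
  by (simp add: wedgeF_def liftF_add[OF wedgeF_bal])

lemma wedgeF_scale: "\<alpha> \<in> VF \<Longrightarrow> wedgeF K E \<omega> (c *\<^sub>C \<alpha>) = c *\<^sub>C wedgeF K E \<omega> \<alpha>"
  by (simp add: wedgeF_def liftF_scale[OF wedgeF_bal])

lemma wedgeF_biforms:
  assumes "\<omega> \<in> biforms K (a, b)" "\<alpha> \<in> formsF K E (biforms K (c, d))"
  shows "wedgeF K E \<omega> \<alpha> \<in> formsF K E (biforms K (a + c, b + d))"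
  using assms(2) biforms_subspace
proof (induction rule: formsF_induct)
  case (tens \<eta> x)
  then show ?case using assms(1) by (simp add: wedgeF_tens tensF_in biforms_mult)
qed (simp add: wedgeF_add formsF_closed formsF_UNIV)

lemma wedgeF_in: "\<alpha> \<in> VF \<Longrightarrow> wedgeF K E \<omega> \<alpha> \<in> VF"
  by (induction rule: VF_induct) (simp_all add: wedgeF_tens tensF_in wedgeF_add formsF_closed)

lemma wedgeF_add_left: "\<alpha> \<in> VF \<Longrightarrow> wedgeF K E (\<omega> + \<omega>') \<alpha> = wedgeF K E \<omega> \<alpha> + wedgeF K E \<omega>' \<alpha>"
  by (induction rule: VF_induct) (simp_all add: wedgeF_tens wedgeF_add distrib_right tensF_add_left)

lemma wedgeF_scale_left: "\<alpha> \<in> VF \<Longrightarrow> wedgeF K E (c *\<^sub>C \<omega>) \<alpha> = c *\<^sub>C wedgeF K E \<omega> \<alpha>"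
  by (induction rule: VF_induct)
    (simp_all add: wedgeF_tens wedgeF_add mult_scaleC_left tensF_scale_left scaleC_add_right)

lemma wedgeF_assoc: "\<alpha> \<in> VF \<Longrightarrow> wedgeF K E (\<omega> * \<omega>') \<alpha> = wedgeF K E \<omega> (wedgeF K E \<omega>' \<alpha>)"
  by (induction rule: VF_induct) (simp_all add: wedgeF_tens wedgeF_add wedgeF_in mult.assoc)

lemma wedgeD_bal: "balD id (\<lambda>\<phi> \<nu>. tD \<phi> (\<nu> * \<omega>))"
  by (simp add: balanced_map_def distrib_right tensD_add_left tensD_add_right tensD_scale_left
      tensD_scale_right mult_scaleC_left tensD_balanced mult.assoc)

lemma wedgeD_tens: "\<phi> \<in> dual E \<Longrightarrow> wedgeD K E (tD \<phi> \<nu>) \<omega> = tD \<phi> (\<nu> * \<omega>)"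
  by (simp add: wedgeD_def liftD_tens[OF wedgeD_bal])

lemma wedgeD_add: "\<beta> \<in> VD \<Longrightarrow> \<beta>' \<in> VD \<Longrightarrow> wedgeD K E (\<beta> + \<beta>') \<omega> = wedgeD K E \<beta> \<omega> + wedgeD K E \<beta>' \<omega>"
  by (simp add: wedgeD_def liftD_add[OF wedgeD_bal])

lemma wedgeD_scale: "\<beta> \<in> VD \<Longrightarrow> wedgeD K E (c *\<^sub>C \<beta>) \<omega> = c *\<^sub>C wedgeD K E \<beta> \<omega>"
  by (simp add: wedgeD_def liftD_scale[OF wedgeD_bal])

lemma wedgeD_biforms:
  assumes "\<omega> \<in> biforms K (a, b)" "\<beta> \<in> formsD K E (biforms K (c, d))"
  shows "wedgeD K E \<beta> \<omega> \<in> formsD K E (biforms K (c + a, d + b))"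
  using assms(2) biforms_subspace
proof (induction rule: formsD_induct)
  case (tens \<phi> \<nu>)
  then show ?case using assms(1) by (simp add: wedgeD_tens tensD_in biforms_mult)
qed (simp add: wedgeD_add formsD_closed formsD_UNIV)

lemma wedgeD_in: "\<beta> \<in> VD \<Longrightarrow> wedgeD K E \<beta> \<omega> \<in> VD"
  by (induction rule: VD_induct) (simp_all add: wedgeD_tens tensD_in wedgeD_add formsD_closed)

lemma wedgeD_add_right: "\<beta> \<in> VD \<Longrightarrow> wedgeD K E \<beta> (\<omega> + \<omega>') = wedgeD K E \<beta> \<omega> + wedgeD K E \<beta> \<omega>'"
  by (induction rule: VD_induct) (simp_all add: wedgeD_tens wedgeD_add distrib_left tensD_add_right)

lemma wedgeD_scale_right: "\<beta> \<in> VD \<Longrightarrow> wedgeD K E \<beta> (c *\<^sub>C \<omega>) = c *\<^sub>C wedgeD K E \<beta> \<omega>"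
  by (induction rule: VD_induct)
    (simp_all add: wedgeD_tens wedgeD_add mult_scaleC_right tensD_scale_right scaleC_add_right)

lemma wedgeD_assoc: "\<beta> \<in> VD \<Longrightarrow> wedgeD K E \<beta> (\<omega> * \<omega>') = wedgeD K E (wedgeD K E \<beta> \<omega>) \<omega>'"
  by (induction rule: VD_induct) (simp_all add: wedgeD_tens wedgeD_add wedgeD_in mult.assoc)

text \<open>
  Evaluation on a pure tensor.  That it is balanced in \<open>\<omega>\<close> and \<open>x\<close> is checked on pure dual-valued
  tensors, and this is what makes the outer lift in \<open>ev\<close> well defined.
\<close>

definition ev_pure :: "'w \<Rightarrow> 'f \<Rightarrow> ('f \<Rightarrow> 'm, 'w) tensor \<Rightarrow> 'w"
  where "ev_pure \<omega> x = liftD K E (\<lambda>\<phi> \<nu>. \<omega> * incl K (\<phi> x) * \<nu>)"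

lemma ev_pure_bal: "balD id (\<lambda>\<phi> \<nu>. \<omega> * incl K (\<phi> x) * \<nu>)"
  by (simp add: balanced_map_def plus_fun_apply scaleC_fun_def dual_act_def clinear_add[OF incl_linear]
      clinear_scale[OF incl_linear] incl_mult distrib_left distrib_right mult_scaleC_left mult_scaleC_right
      mult.assoc)

lemma ev_pure_tens: "\<phi> \<in> dual E \<Longrightarrow> ev_pure \<omega> x (tD \<phi> \<nu>) = \<omega> * incl K (\<phi> x) * \<nu>"
  unfolding ev_pure_def by (rule liftD_tens[OF ev_pure_bal])

lemma ev_pure_add: "\<beta> \<in> VD \<Longrightarrow> \<beta>' \<in> VD \<Longrightarrow> ev_pure \<omega> x (\<beta> + \<beta>') = ev_pure \<omega> x \<beta> + ev_pure \<omega> x \<beta>'"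
  unfolding ev_pure_def by (rule liftD_add[OF ev_pure_bal])

lemma ev_pure_scale: "\<beta> \<in> VD \<Longrightarrow> ev_pure \<omega> x (c *\<^sub>C \<beta>) = c *\<^sub>C ev_pure \<omega> x \<beta>"
  using liftD_scale[OF ev_pure_bal] by (simp add: ev_pure_def)

lemma ev_bal:
  assumes "\<beta> \<in> VD"
  shows "balF id (\<lambda>\<omega> x. ev_pure \<omega> x \<beta>)"
  unfolding balanced_map_def
proof (intro conjI ballI allI)
  note rules = ev_pure_tens ev_pure_add dual_add dual_act_left dual_scale clinear_add[OF incl_linear]
      clinear_scale[OF incl_linear] incl_mult distrib_left distrib_right mult_scaleC_left mult_scaleC_right
      mult.assoc scaleC_add_right
  show "id = id \<or> id = cnj" by simp
  show "ev_pure (\<omega> + \<omega>') x \<beta> = ev_pure \<omega> x \<beta> + ev_pure \<omega>' x \<beta>" for \<omega> \<omega>' x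
    using assms by (induction rule: VD_induct) (simp_all add: rules)
  show "ev_pure \<omega> (x + y) \<beta> = ev_pure \<omega> x \<beta> + ev_pure \<omega> y \<beta>" for \<omega> x y
    using assms by (induction rule: VD_induct) (simp_all add: rules)
  show "ev_pure (c *\<^sub>C \<omega>) x \<beta> = id c *\<^sub>C ev_pure \<omega> x \<beta>" for c \<omega> x
    using assms by (induction rule: VD_induct) (simp_all add: rules)
  show "ev_pure \<omega> (c *\<^sub>C x) \<beta> = id c *\<^sub>C ev_pure \<omega> x \<beta>" for c \<omega> x
    using assms by (induction rule: VD_induct) (simp_all add: rules)
  show "ev_pure (\<omega> * incl K m) x \<beta> = ev_pure \<omega> (act E m x) \<beta>" for \<omega> m x
    using assms by (induction rule: VD_induct) (simp_all add: rules)
qed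

lemma ev_eq_lift: "ev K E \<alpha> \<beta> = liftF K E (\<lambda>\<omega> x. ev_pure \<omega> x \<beta>) \<alpha>"
  by (simp add: ev_def ev_pure_def)

lemma ev_tens_left: "\<beta> \<in> VD \<Longrightarrow> ev K E (tF \<omega> x) \<beta> = ev_pure \<omega> x \<beta>"
  by (simp add: ev_eq_lift liftF_tens[OF ev_bal])

lemma ev_tens: "\<phi> \<in> dual E \<Longrightarrow> ev K E (tF \<omega> x) (tD \<phi> \<nu>) = \<omega> * incl K (\<phi> x) * \<nu>"
  by (simp add: ev_tens_left tensD_in ev_pure_tens)

lemma ev_add_left: "\<alpha> \<in> VF \<Longrightarrow> \<alpha>' \<in> VF \<Longrightarrow> \<beta> \<in> VD \<Longrightarrow> ev K E (\<alpha> + \<alpha>') \<beta> = ev K E \<alpha> \<beta> + ev K E \<alpha>' \<beta>"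
  by (simp add: ev_eq_lift liftF_add[OF ev_bal])

lemma ev_scale_left: "\<alpha> \<in> VF \<Longrightarrow> \<beta> \<in> VD \<Longrightarrow> ev K E (c *\<^sub>C \<alpha>) \<beta> = c *\<^sub>C ev K E \<alpha> \<beta>"
  by (simp add: ev_eq_lift liftF_scale[OF ev_bal])

lemma ev_add_right: "\<alpha> \<in> VF \<Longrightarrow> \<beta> \<in> VD \<Longrightarrow> \<beta>' \<in> VD \<Longrightarrow> ev K E \<alpha> (\<beta> + \<beta>') = ev K E \<alpha> \<beta> + ev K E \<alpha> \<beta>'"
  by (induction rule: VF_induct)
    (simp_all add: ev_tens_left formsD_closed ev_pure_add ev_add_left)

lemma ev_scale_right: "\<alpha> \<in> VF \<Longrightarrow> \<beta> \<in> VD \<Longrightarrow> ev K E \<alpha> (c *\<^sub>C \<beta>) = c *\<^sub>C ev K E \<alpha> \<beta>"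
  by (induction rule: VF_induct)
    (simp_all add: ev_tens_left formsD_closed ev_pure_scale ev_add_left scaleC_add_right)

lemma ev_wedgeF: 
  assumes \<alpha>: "\<alpha> \<in> VF" and \<beta>: "\<beta> \<in> VD"
  shows "ev K E (wedgeF K E \<omega> \<alpha>) \<beta> = \<omega> * ev K E \<alpha> \<beta>"
  using \<alpha>
proof (induction rule: VF_induct)
  case (tens \<eta> x)
  from \<beta> show ?case
  proof (induction rule: VD_induct)
    case (tens \<phi> \<nu>)
    then show ?case by (simp add: wedgeF_tens ev_tens mult.assoc)
  next
    case (add \<beta> \<beta>')
    then show ?case by (simp add: ev_add_right wedgeF_in tensF_in distrib_left)
  qed
next
  case (add \<alpha> \<alpha>')
  then show ?case using \<beta> by (simp add: wedgeF_add wedgeF_in ev_add_left distrib_left)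
qed

lemma ev_wedgeD:
  assumes \<alpha>: "\<alpha> \<in> VF" and \<beta>: "\<beta> \<in> VD"
  shows "ev K E \<alpha> (wedgeD K E \<beta> \<omega>) = ev K E \<alpha> \<beta> * \<omega>"
  using \<beta>
proof (induction rule: VD_induct)
  case (tens \<phi> \<nu>)
  from \<alpha> tens show ?case
  proof (induction rule: VF_induct)
    case (tens \<eta> x)
    then show ?case by (simp add: wedgeD_tens ev_tens mult.assoc)
  next
    case (add \<alpha> \<alpha>')
    then show ?case by (simp add: ev_add_left wedgeD_in tensD_in distrib_right)
  qed
next
  case (add \<beta> \<beta>')
  then show ?case using \<alpha> by (simp add: wedgeD_add wedgeD_in ev_add_right distrib_right)
qed

lemma ev_biforms:
  assumes \<alpha>: "\<alpha> \<in> formsF K E (biforms K (a, b))" and \<beta>: "\<beta> \<in> formsD K E (biforms K (c, d))"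
  shows "ev K E \<alpha> \<beta> \<in> biforms K (a + c, b + d)"
  using \<alpha> biforms_subspace
proof (induction rule: formsF_induct)
  case (tens \<omega> x)
  from \<beta> biforms_subspace show ?case
  proof (induction rule: formsD_induct)
    case (tens \<phi> \<nu>)
    then show ?case using \<open>\<omega> \<in> biforms K (a, b)\<close> by (simp add: ev_tens biforms_mult biforms_incl_right)
  next
    case (add \<beta> \<beta>')
    then show ?case by (simp add: ev_add_right tensF_in formsD_UNIV cvec.subspace_add[OF biforms_subspace])
  qed
next
  case (add \<alpha> \<alpha>')
  then show ?case
    using \<beta> by (simp add: ev_add_left formsF_UNIV formsD_UNIV cvec.subspace_add[OF biforms_subspace])
qed

subsection \<open>Dual bases\<close>

text \<open>
  For the splitting of a free module of rank \<open>N\<close> onto \<open>F\<close>: the images of the unit vectors, and the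
  coordinates of the section.
\<close>

lemma dual_basis_exists:
  "\<exists>(N::nat) e \<epsilon>. (\<forall>k. \<epsilon> k \<in> dual E) \<and> (\<forall>x. (\<Sum>k<N. act E (\<epsilon> k x) (e k)) = x)"
proof -
  have "\<exists>N (s :: 'f \<Rightarrow> nat \<Rightarrow> 'm) (p :: (nat \<Rightarrow> 'm) \<Rightarrow> 'f).
      (\<forall>x k. N \<le> k \<longrightarrow> s x k = 0) \<and> (\<forall>x y. s (x + y) = s x + s y) \<and>
      (\<forall>m x. s (act E m x) = (\<lambda>k. m * s x k)) \<and>
      (\<forall>u. (\<forall>k\<ge>N. u k = 0) \<longrightarrow> (\<forall>v. (\<forall>k\<ge>N. v k = 0) \<longrightarrow> p (u + v) = p u + p v)) \<and>
      (\<forall>m v. (\<forall>k\<ge>N. v k = 0) \<longrightarrow> p (\<lambda>k. m * v k) = act E m (p v)) \<and> (\<forall>x. p (s x) = x)"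
    using projective by (simp add: finitely_generated_projective_def)
  then obtain N and s :: "'f \<Rightarrow> nat \<Rightarrow> 'm" and p :: "(nat \<Rightarrow> 'm) \<Rightarrow> 'f"
    where s': "\<forall>x k. N \<le> k \<longrightarrow> s x k = 0" "\<forall>x y. s (x + y) = s x + s y"
        "\<forall>m x. s (act E m x) = (\<lambda>k. m * s x k)"
      and p': "\<forall>u. (\<forall>k\<ge>N. u k = 0) \<longrightarrow> (\<forall>v. (\<forall>k\<ge>N. v k = 0) \<longrightarrow> p (u + v) = p u + p v)"
        "\<forall>m v. (\<forall>k\<ge>N. v k = 0) \<longrightarrow> p (\<lambda>k. m * v k) = act E m (p v)"
      and ps: "\<forall>x. p (s x) = x"
    by (elim exE conjE) (rule that)
  note s = s'[rule_format] and p = p'[rule_format]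
  let ?\<delta> = "\<lambda>k j. if j = k then 1 else 0 :: 'm"
  have p0: "p (\<lambda>_. 0) = 0"
    using p(1)[of "\<lambda>_. 0" "\<lambda>_. 0"] by (simp add: plus_fun_def)
  have expand: "p (\<lambda>j. if j < l then v j else 0) = (\<Sum>k<l. act E (v k) (p (?\<delta> k)))"
    if "l \<le> N" for l v
    using that
  proof (induction l)
    case 0
    then show ?case by (simp add: p0)
  next
    case (Suc l)
    have "(\<lambda>j. if j < Suc l then v j else 0) = (\<lambda>j. if j < l then v j else 0) + (\<lambda>j. v l * ?\<delta> l j)"
      by (auto simp: fun_eq_iff plus_fun_apply less_Suc_eq)
    then show ?case using Suc p by (simp add: add.commute)
  qed
  have "(\<Sum>k<N. act E (s x k) (p (?\<delta> k))) = x" for x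
  proof -
    have "(\<lambda>j. if j < N then s x j else 0) = s x" using s(1) by (auto simp: fun_eq_iff)
    then show ?thesis using expand[of N "s x"] ps by simp
  qed
  moreover have "(\<lambda>x. s x k) \<in> dual E" for k by (simp add: dual_def s plus_fun_apply)
  ultimately show ?thesis by (intro exI[of _ N] exI[of _ "\<lambda>k. p (?\<delta> k)"] exI[of _ "\<lambda>k x. s x k"]) auto
qed

text \<open>
  On pure tensors the last two identities are the expansions of \<open>\<phi>\<close> along the \<open>\<epsilon> k\<close>, with coefficients
  \<open>\<phi> (e k)\<close>, and of \<open>x\<close> along the \<open>e k\<close>.
\<close>

lemma dual_basis:
  obtains N :: nat and e \<epsilon>
  where "\<And>k. \<epsilon> k \<in> dual E" "\<And>x. (\<Sum>k<N. act E (\<epsilon> k x) (e k)) = x"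
    "\<And>\<beta>. \<beta> \<in> VD \<Longrightarrow> (\<Sum>k<N. tD (\<epsilon> k) (ev K E (tF 1 (e k)) \<beta>)) = \<beta>"
    "\<And>\<alpha>. \<alpha> \<in> VF \<Longrightarrow> (\<Sum>k<N. tF (ev K E \<alpha> (tD (\<epsilon> k) 1)) (e k)) = \<alpha>"
proof -
  obtain N :: nat and e \<epsilon> where \<epsilon>: "\<And>k. \<epsilon> k \<in> dual E" and e: "\<And>x. (\<Sum>k<N. act E (\<epsilon> k x) (e k)) = x"
    using dual_basis_exists by blast
  have D: "(\<Sum>k<N. tD (\<epsilon> k) (ev K E (tF 1 (e k)) \<beta>)) = \<beta>" if "\<beta> \<in> VD" for \<beta>
    using that
  proof (induction rule: VD_induct)
    case (tens \<phi> \<nu>)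
    have sum: "(\<Sum>k\<in>S. tD (g k) \<nu>) = tD (\<Sum>k\<in>S. g k) \<nu> \<and> (\<Sum>k\<in>S. g k) \<in> dual E"
      if "finite S" "\<And>k. k \<in> S \<Longrightarrow> g k \<in> dual E" for g and S :: "nat set"
      using that
    proof (induction S)
      case empty
      then show ?case by (simp add: tensD_0 cvec.subspace_0[OF dual_subspace])
    next
      case (insert k S)
      then show ?case by (simp add: tensD_add_left cvec.subspace_add[OF dual_subspace])
    qed
    have \<phi>_sum: "\<phi> (\<Sum>k\<in>S. g k) = (\<Sum>k\<in>S. \<phi> (g k))" if "finite S" for g and S :: "nat set"
      using that
    proof (induction S)
      case empty
      then show ?case using dual_scale[OF tens(1), of 0 0] by simp
    qed (simp add: dual_add[OF tens(1)])
    have "(\<Sum>k<N. dual_act (\<epsilon> k) (\<phi> (e k))) = \<phi>"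
    proof
      fix x
      have "\<phi> x = \<phi> (\<Sum>k<N. act E (\<epsilon> k x) (e k))" by (simp add: e)
      then show "(\<Sum>k<N. dual_act (\<epsilon> k) (\<phi> (e k))) x = \<phi> x"
        by (simp add: sum_fun_apply \<phi>_sum dual_act_left[OF tens(1)] dual_act_def)
    qed
    moreover have "(\<Sum>k<N. tD (dual_act (\<epsilon> k) (\<phi> (e k))) \<nu>) = tD (\<Sum>k<N. dual_act (\<epsilon> k) (\<phi> (e k))) \<nu>"
      using sum[of "{..<N}" "\<lambda>k. dual_act (\<epsilon> k) (\<phi> (e k))"] dual_act_in[OF \<epsilon>] by simp
    ultimately show ?case
      using tens \<epsilon> by (simp add: ev_tens tensD_balanced)
  next
    case (add \<beta> \<beta>')
    then show ?case
      by (simp add: ev_add_right tensF_in tensD_add_right[OF \<epsilon>] sum.distrib)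
  qed
  have F: "(\<Sum>k<N. tF (ev K E \<alpha> (tD (\<epsilon> k) 1)) (e k)) = \<alpha>" if "\<alpha> \<in> VF" for \<alpha>
    using that
  proof (induction rule: VF_induct)
    case (tens \<omega> x)
    have sum: "(\<Sum>k\<in>S. tF \<omega> (g k)) = tF \<omega> (\<Sum>k\<in>S. g k)" if "finite S" for g and S :: "nat set"
      using that by (induction S) (simp_all add: tensF_0 tensF_add_right)
    show ?case by (simp add: ev_tens[OF \<epsilon>] tensF_balanced sum e)
  next
    case (add \<alpha> \<alpha>')
    then show ?case
      by (simp add: ev_add_left tensD_in[OF \<epsilon>] tensF_add_left sum.distrib)
  qed
  show thesis by (rule that[OF \<epsilon> e D F])
qed

lemma formsD_eqI:
  assumes "\<beta> \<in> VD" "\<beta>' \<in> VD" "\<And>x. ev K E (tF 1 x) \<beta> = ev K E (tF 1 x) \<beta>'"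
  shows "\<beta> = \<beta>'"
proof -
  obtain N :: nat and e \<epsilon> where
    D: "\<And>\<beta>. \<beta> \<in> VD \<Longrightarrow> (\<Sum>k<N. tD (\<epsilon> k) (ev K E (tF 1 (e k)) \<beta>)) = \<beta>"
    by (rule dual_basis) (rule that)
  have "(\<Sum>k<N. tD (\<epsilon> k) (ev K E (tF 1 (e k)) \<beta>)) = (\<Sum>k<N. tD (\<epsilon> k) (ev K E (tF 1 (e k)) \<beta>'))"
    by (simp only: assms(3))
  then show ?thesis by (simp only: D[OF assms(1)] D[OF assms(2)])
qed

subsection \<open>The holomorphic structures\<close>

text \<open>
  Moving \<open>m\<close> across the tensor sign is harmless: the term \<open>\<omega> (delbar m) \<otimes> x\<close>, up to sign, comes from
  differentiating \<open>\<omega> m\<close> on one side and from the Leibniz rule for \<open>m x\<close> on the other.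
\<close>

lemma dbar_ext_bal: "balF id (\<lambda>\<omega> x. tF (delbar K \<omega>) x + wedgeF K E (grading_involution K \<omega>) (dbarF E x))"
  using formsF_UNIV[OF dbarF_in]
  by (simp add: balanced_map_def clinear_add[OF delbar_linear] clinear_scale[OF delbar_linear]
      clinear_add[OF grading_involution_linear] clinear_scale[OF grading_involution_linear]
      clinear_add[OF dbarF_linear] clinear_scale[OF dbarF_linear]
      tensF_add_left tensF_add_right tensF_scale_left tensF_scale_right tensF_balanced[symmetric]
      wedgeF_add_left wedgeF_scale_left wedgeF_add wedgeF_scale scaleC_add_right
      delbar_mult grading_involution_mult_incl dbarF_act tensF_in wedgeF_in wedgeF_assoc wedgeF_tens
      add.assoc add.left_commute)

lemma dbar_ext_tens:
  "dbar_ext K E (tF \<omega> x) = tF (delbar K \<omega>) x + wedgeF K E (grading_involution K \<omega>) (dbarF E x)"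
  by (simp add: dbar_ext_def liftF_tens[OF dbar_ext_bal])

lemma dbar_ext_add: "\<alpha> \<in> VF \<Longrightarrow> \<alpha>' \<in> VF \<Longrightarrow> dbar_ext K E (\<alpha> + \<alpha>') = dbar_ext K E \<alpha> + dbar_ext K E \<alpha>'"
  by (simp add: dbar_ext_def liftF_add[OF dbar_ext_bal])

lemma dbar_ext_scale: "\<alpha> \<in> VF \<Longrightarrow> dbar_ext K E (c *\<^sub>C \<alpha>) = c *\<^sub>C dbar_ext K E \<alpha>"
  by (simp add: dbar_ext_def liftF_scale[OF dbar_ext_bal])

lemma dbar_ext_in: "\<alpha> \<in> VF \<Longrightarrow> dbar_ext K E \<alpha> \<in> VF"
  by (induction rule: VF_induct)
    (simp_all add: dbar_ext_tens dbar_ext_add formsF_closed tensF_in wedgeF_in formsF_UNIV[OF dbarF_in])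

lemma dbar_ext_biforms:
  assumes "\<alpha> \<in> formsF K E (biforms K (a, b))"
  shows "dbar_ext K E \<alpha> \<in> formsF K E (biforms K (a, b + 1))"
  using assms biforms_subspace
proof (induction rule: formsF_induct)
  case (tens \<omega> x)
  have "grading_involution K \<omega> \<in> biforms K (a, b)"
    by (simp add: grading_involution_biform[OF tens] cvec.subspace_scale[OF biforms_subspace tens])
  from wedgeF_biforms[OF this dbarF_in]
  show ?case using delbar_biforms[OF tens] by (simp add: dbar_ext_tens formsF_closed tensF_in)
qed (simp add: dbar_ext_add formsF_closed formsF_UNIV)

text \<open>
  Pairing with \<open>1 \<otimes> x\<close> identifies dual-valued forms with \<open>M\<close>-linear maps out of the bundle; the map
  defining the dual structure is \<open>M\<close>-linear because the two inhomogeneous Leibniz terms cancel.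
\<close>

lemma dbar_dual_ex1:
  assumes \<phi>: "\<phi> \<in> dual E"
  shows "\<exists>!\<beta>. \<beta> \<in> formsD K E (biforms K (0, 1)) \<and> (\<forall>x. ev K E (tF 1 x) \<beta> =
    delbar K (incl K (\<phi> x)) - ev K E (dbarF E x) (tD \<phi> 1))"
proof -
  let ?g = "\<lambda>x. delbar K (incl K (\<phi> x)) - ev K E (dbarF E x) (tD \<phi> 1)"
  obtain N :: nat and e \<epsilon> where \<epsilon>: "\<And>k. \<epsilon> k \<in> dual E" and e: "\<And>x. (\<Sum>k<N. act E (\<epsilon> k x) (e k)) = x"
    by (rule dual_basis) (rule that)
  have dF: "dbarF E x \<in> VF" for x by (rule formsF_UNIV[OF dbarF_in])
  have td: "tD \<phi> \<nu> \<in> VD" for \<nu> using \<phi> by (simp add: tensD_in)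
  have g_add: "?g (x + y) = ?g x + ?g y" for x y
    using \<phi> by (simp add: dual_add clinear_add[OF incl_linear] clinear_add[OF delbar_linear]
        clinear_add[OF dbarF_linear] ev_add_left dF td)
  have g_act: "?g (act E m x) = incl K m * ?g x" for m x
    using \<phi> by (simp add: dual_act_left incl_mult delbar_mult grading_involution_incl dbarF_act
        ev_add_left ev_wedgeF ev_tens tensF_in wedgeF_in dF td right_diff_distrib)
  have "(0 :: 'f) = act E 0 0" using act_scale_left[of 0 0 0] by simp
  then have "?g 0 = incl K 0 * ?g 0" using g_act[of 0 0] by simp
  then have g_0: "?g 0 = 0" by (simp add: clinear_0[OF incl_linear])
  have g_sum: "?g (\<Sum>k\<in>S. u k) = (\<Sum>k\<in>S. ?g (u k))" if "finite S" for u and S :: "nat set"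
    using that by (induction S) (use g_0 g_add in auto)
  have g_in: "?g x \<in> biforms K (0, 1)" for x
  proof -
    have "delbar K (incl K (\<phi> x)) \<in> biforms K (0, 1)" using delbar_biforms[OF incl_biform] by simp
    moreover have "tD \<phi> 1 \<in> formsD K E (biforms K (0, 0))"
      using \<phi> incl_biform[of 1] by (simp add: tensD_in incl_1)
    then have "ev K E (dbarF E x) (tD \<phi> 1) \<in> biforms K (0, 1)"
      using ev_biforms[OF dbarF_in] by fastforce
    ultimately show ?thesis by (rule cvec.subspace_diff[OF biforms_subspace])
  qed
  let ?\<beta> = "\<Sum>k<N. tD (\<epsilon> k) (?g (e k))"
  have in_1: "?\<beta> \<in> formsD K E (biforms K (0, 1))"
    by (rule cvec.subspace_sum[OF formsD_subspace tensD_in[OF \<epsilon> g_in]])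
  have ev_sum: "ev K E (tF 1 x) (\<Sum>k\<in>S. tD (\<epsilon> k) (\<nu> k)) = (\<Sum>k\<in>S. incl K (\<epsilon> k x) * \<nu> k)
      \<and> (\<Sum>k\<in>S. tD (\<epsilon> k) (\<nu> k)) \<in> VD"
    if "finite S" for x \<nu> and S :: "nat set"
    using that
  proof (induction S)
    case empty
    have "(0 :: ('f \<Rightarrow> 'm, 'w) tensor) \<in> VD" by (rule formsD_closed)
    then show ?case using ev_scale_right[of "tF 1 x" 0 0] by (simp add: tensF_in)
  next
    case (insert k S)
    then show ?case by (simp add: ev_add_right tensF_in tensD_in \<epsilon> ev_tens formsD_closed)
  qed
  have ev_\<beta>: "ev K E (tF 1 x) ?\<beta> = ?g x" for x
  proof -
    have "ev K E (tF 1 x) ?\<beta> = (\<Sum>k<N. incl K (\<epsilon> k x) * ?g (e k))"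
      by (rule conjunct1[OF ev_sum]) simp
    also have "\<dots> = (\<Sum>k<N. ?g (act E (\<epsilon> k x) (e k)))" by (simp only: g_act)
    also have "\<dots> = ?g (\<Sum>k<N. act E (\<epsilon> k x) (e k))" by (rule g_sum[symmetric]) simp
    finally show ?thesis by (simp only: e)
  qed
  show ?thesis
  proof (rule ex1I[of _ ?\<beta>])
    show "?\<beta> \<in> formsD K E (biforms K (0, 1)) \<and> (\<forall>x. ev K E (tF 1 x) ?\<beta> = ?g x)"
      by (intro conjI allI in_1 ev_\<beta>)
    show "\<beta>' = ?\<beta>" if "\<beta>' \<in> formsD K E (biforms K (0, 1)) \<and> (\<forall>x. ev K E (tF 1 x) \<beta>' = ?g x)" for \<beta>'
      by (rule formsD_eqI[OF formsD_UNIV[OF conjunct1[OF that]] formsD_UNIV[OF in_1]])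
        (simp only: ev_\<beta> spec[OF conjunct2[OF that]])
  qed
qed

lemma dbar_dual_in: "\<phi> \<in> dual E \<Longrightarrow> dbar_dual K E \<phi> \<in> formsD K E (biforms K (0, 1))"
  and ev_dbar_dual: "\<phi> \<in> dual E \<Longrightarrow> ev K E (tF 1 x) (dbar_dual K E \<phi>) =
    delbar K (incl K (\<phi> x)) - ev K E (dbarF E x) (tD \<phi> 1)"
  using theI'[OF dbar_dual_ex1[of \<phi>]] unfolding dbar_dual_def by blast+

text \<open>
  Identities for the dual structure are checked by evaluating on \<open>1 \<otimes> x\<close>.
\<close>

lemma dbar_dual_add:
  assumes "\<phi> \<in> dual E" "\<phi>' \<in> dual E"
  shows "dbar_dual K E (\<phi> + \<phi>') = dbar_dual K E \<phi> + dbar_dual K E \<phi>'"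
  using assms cvec.subspace_add[OF dual_subspace assms]
  by (intro formsD_eqI)
    (simp_all add: formsD_UNIV[OF dbar_dual_in] formsD_closed ev_dbar_dual ev_add_right tensF_in
      formsF_UNIV[OF dbarF_in] tensD_in tensD_add_left plus_fun_apply clinear_add[OF incl_linear]
      clinear_add[OF delbar_linear])

lemma dbar_dual_scale:
  assumes "\<phi> \<in> dual E"
  shows "dbar_dual K E (c *\<^sub>C \<phi>) = c *\<^sub>C dbar_dual K E \<phi>"
  using assms cvec.subspace_scale[OF dual_subspace assms]
  by (intro formsD_eqI)
    (simp_all add: formsD_UNIV[OF dbar_dual_in] formsD_closed ev_dbar_dual ev_scale_right tensF_in
      formsF_UNIV[OF dbarF_in] tensD_in tensD_scale_left clinear_scale[OF incl_linear]
      clinear_scale[OF delbar_linear] cvec.scale_right_diff_distrib, simp add: scaleC_fun_def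
      clinear_scale[OF incl_linear] clinear_scale[OF delbar_linear])

lemma dbar_dual_act:
  assumes "\<phi> \<in> dual E"
  shows "dbar_dual K E (dual_act \<phi> m) = wedgeD K E (dbar_dual K E \<phi>) (incl K m) + tD \<phi> (delbar K (incl K m))"
proof (rule formsD_eqI)
  note mem = formsD_UNIV[OF dbar_dual_in] formsD_closed tensF_in tensD_in wedgeD_in formsF_UNIV[OF dbarF_in]
  show "dbar_dual K E (dual_act \<phi> m) \<in> VD"
    "wedgeD K E (dbar_dual K E \<phi>) (incl K m) + tD \<phi> (delbar K (incl K m)) \<in> VD"
    using assms dual_act_in[OF assms] by (simp_all add: mem)
  fix x
  have "tD (dual_act \<phi> m) 1 = wedgeD K E (tD \<phi> 1) (incl K m)"
    using assms by (simp add: wedgeD_tens tensD_balanced)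
  then have "ev K E (dbarF E x) (tD (dual_act \<phi> m) 1) = ev K E (dbarF E x) (tD \<phi> 1) * incl K m"
    using assms by (simp add: ev_wedgeD mem)
  then show "ev K E (tF 1 x) (dbar_dual K E (dual_act \<phi> m)) =
      ev K E (tF 1 x) (wedgeD K E (dbar_dual K E \<phi>) (incl K m) + tD \<phi> (delbar K (incl K m)))"
    using assms dual_act_in[OF assms]
    by (simp add: ev_dbar_dual ev_add_right ev_wedgeD ev_tens mem)
      (simp add: dual_act_def incl_mult delbar_mult grading_involution_incl left_diff_distrib)
qed

lemma dbar_dual_ext_bal: "balD id (\<lambda>\<phi> \<omega>. wedgeD K E (dbar_dual K E \<phi>) \<omega> + tD \<phi> (delbar K \<omega>))"
  by (simp add: balanced_map_def formsD_UNIV[OF dbar_dual_in] clinear_add[OF delbar_linear]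
      clinear_scale[OF delbar_linear] dbar_dual_add dbar_dual_scale dbar_dual_act
      tensD_add_left tensD_add_right tensD_scale_left tensD_scale_right tensD_balanced
      wedgeD_add_right wedgeD_scale_right wedgeD_add wedgeD_scale scaleC_add_right
      delbar_mult grading_involution_incl tensD_in wedgeD_in wedgeD_assoc wedgeD_tens
      cvec.subspace_add[OF dual_subspace] cvec.subspace_scale[OF dual_subspace] add.assoc add.left_commute)

lemma dbar_dual_ext_tens:
  "\<phi> \<in> dual E \<Longrightarrow> dbar_dual_ext K E (tD \<phi> \<omega>) = wedgeD K E (dbar_dual K E \<phi>) \<omega> + tD \<phi> (delbar K \<omega>)"
  by (simp add: dbar_dual_ext_def liftD_tens[OF dbar_dual_ext_bal])

lemma dbar_dual_ext_add: "\<beta> \<in> VD \<Longrightarrow> \<beta>' \<in> VD \<Longrightarrow>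
    dbar_dual_ext K E (\<beta> + \<beta>') = dbar_dual_ext K E \<beta> + dbar_dual_ext K E \<beta>'"
  by (simp add: dbar_dual_ext_def liftD_add[OF dbar_dual_ext_bal])

lemma dbar_dual_ext_scale: "\<beta> \<in> VD \<Longrightarrow> dbar_dual_ext K E (c *\<^sub>C \<beta>) = c *\<^sub>C dbar_dual_ext K E \<beta>"
  by (simp add: dbar_dual_ext_def liftD_scale[OF dbar_dual_ext_bal])

lemma dbar_dual_ext_biforms:
  assumes "\<beta> \<in> formsD K E (biforms K (a, b))"
  shows "dbar_dual_ext K E \<beta> \<in> formsD K E (biforms K (a, b + 1))"
  using assms biforms_subspace
proof (induction rule: formsD_induct)
  case (tens \<phi> \<omega>)
  show ?case
    using wedgeD_biforms[OF tens(2) dbar_dual_in[OF tens(1)]] delbar_biforms[OF tens(2)] tens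
    by (simp add: dbar_dual_ext_tens formsD_closed tensD_in)
qed (simp add: dbar_dual_ext_add formsD_closed formsD_UNIV)

lemma dbar_dual_ext_in: "\<beta> \<in> VD \<Longrightarrow> dbar_dual_ext K E \<beta> \<in> VD"
  by (induction rule: VD_induct)
    (simp_all add: dbar_dual_ext_tens dbar_dual_ext_add formsD_closed tensD_in wedgeD_in formsD_UNIV[OF dbar_dual_in])

text \<open>
  On pure tensors, the terms containing the holomorphic structure of the bundle occur once with each
  sign, because the dual structure was defined by subtracting them.
\<close>

lemma delbar_ev:
  assumes \<alpha>: "\<alpha> \<in> formsF K E (biforms K (a, b))" and \<beta>: "\<beta> \<in> VD"
  shows "delbar K (ev K E \<alpha> \<beta>) = ev K E (dbar_ext K E \<alpha>) \<beta> + (-1) ^ (a + b) *\<^sub>C ev K E \<alpha> (dbar_dual_ext K E \<beta>)"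
  using \<alpha> biforms_subspace
proof (induction rule: formsF_induct)
  case (tens \<omega> x)
  note mem = formsD_UNIV[OF dbar_dual_in] formsD_closed formsF_closed tensF_in tensD_in wedgeD_in wedgeF_in
    formsF_UNIV[OF dbarF_in] dbar_ext_in dbar_dual_ext_in
  from \<beta> show ?case
  proof (induction rule: VD_induct)
    case (tens \<phi> \<nu>)
    have 1: "tD \<phi> \<nu> = wedgeD K E (tD \<phi> 1) \<nu>" using tens by (simp add: wedgeD_tens)
    have "tF \<omega> x = wedgeF K E \<omega> (tF 1 x)" by (simp add: wedgeF_tens)
    then have 2: "ev K E (tF \<omega> x) (dbar_dual K E \<phi>) = \<omega> * (delbar K (incl K (\<phi> x)) - ev K E (dbarF E x) (tD \<phi> 1))"
      using tens by (simp add: ev_wedgeF mem ev_dbar_dual)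
    have 3: "ev K E (dbarF E x) (tD \<phi> \<nu>) = ev K E (dbarF E x) (tD \<phi> 1) * \<nu>"
      using tens unfolding 1 by (simp add: ev_wedgeD mem)
    have "delbar K (ev K E (tF \<omega> x) (tD \<phi> \<nu>)) = delbar K \<omega> * incl K (\<phi> x) * \<nu> +
        (-1) ^ (a + b) *\<^sub>C (\<omega> * delbar K (incl K (\<phi> x)) * \<nu> + \<omega> * incl K (\<phi> x) * delbar K \<nu>)"
      using tens \<open>\<omega> \<in> biforms K (a, b)\<close>
      by (simp add: ev_tens mult.assoc grading_involution_biform delbar_mult grading_involution_incl
          distrib_left mult_scaleC_left scaleC_add_right)
    moreover have "ev K E (dbar_ext K E (tF \<omega> x)) (tD \<phi> \<nu>) = delbar K \<omega> * incl K (\<phi> x) * \<nu> +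
        (-1) ^ (a + b) *\<^sub>C (\<omega> * ev K E (dbarF E x) (tD \<phi> 1) * \<nu>)"
      using tens \<open>\<omega> \<in> biforms K (a, b)\<close>
      by (simp add: dbar_ext_tens ev_add_left mem ev_tens ev_wedgeF 3 grading_involution_biform
          mult_scaleC_left mult.assoc)
    moreover have "ev K E (tF \<omega> x) (dbar_dual_ext K E (tD \<phi> \<nu>)) =
        \<omega> * (delbar K (incl K (\<phi> x)) - ev K E (dbarF E x) (tD \<phi> 1)) * \<nu> + \<omega> * incl K (\<phi> x) * delbar K \<nu>"
      using tens by (simp add: dbar_dual_ext_tens ev_add_right mem ev_tens ev_wedgeD 2)
    ultimately show ?case
      by (simp add: right_diff_distrib left_diff_distrib scaleC_add_right cvec.scale_right_diff_distrib)
  next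
    case (add \<beta> \<beta>')
    then show ?case
      by (simp add: ev_add_right dbar_dual_ext_add mem clinear_add[OF delbar_linear] scaleC_add_right)
  qed
next
  case (add \<alpha> \<alpha>')
  then show ?case
    using \<beta> by (simp add: ev_add_left dbar_ext_add dbar_ext_in dbar_dual_ext_in formsF_UNIV
        clinear_add[OF delbar_linear] scaleC_add_right)
qed

end

section \<open>Diagonalisable operators and pairings of quotients\<close>

text \<open>
  On a basis of eigenvectors both claims are visible: those with eigenvalue 0 are in the kernel, the
  others are in the image of the square, and an eigenvalue vanishes if its square does.
\<close>

lemma diagonalisable_on_decomposition:
  fixes V :: "'v::complex_vector set"
  assumes diag: "diagonalisable_on V T"
    and add: "\<And>x y. x \<in> V \<Longrightarrow> y \<in> V \<Longrightarrow> T (x + y) = T x + T y"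
    and scale: "\<And>c x. x \<in> V \<Longrightarrow> T (c *\<^sub>C x) = c *\<^sub>C T x"
    and in_V: "\<And>x. x \<in> V \<Longrightarrow> T x \<in> V"
  shows "v \<in> V \<Longrightarrow> \<exists>k\<in>V. \<exists>u\<in>V. T k = 0 \<and> v = k + T (T u)"
    and "v \<in> V \<Longrightarrow> T (T v) = 0 \<Longrightarrow> T v = 0"
proof -
  obtain B where B: "cvec.independent B" "cvec.span B = V" and "\<forall>b\<in>B. \<exists>c. T b = c *\<^sub>C b"
    using diag by (auto simp: diagonalisable_on_def)
  then obtain l where l: "\<And>b. b \<in> B \<Longrightarrow> T b = l b *\<^sub>C b" by metis
  have V: "cvec.subspace V" using B(2) cvec.subspace_span by blast
  note closed = cvec.subspace_0[OF V] cvec.subspace_add[OF V] cvec.subspace_scale[OF V]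
  have BV: "b \<in> B \<Longrightarrow> b \<in> V" for b using B(2) cvec.span_base by blast
  have T0: "T 0 = 0" using scale[of 0 0] closed by simp
  show "\<exists>k\<in>V. \<exists>u\<in>V. T k = 0 \<and> v = k + T (T u)" if "v \<in> V"
    using that unfolding B(2)[symmetric]
  proof (induction rule: cvec.span_induct_alt)
    case base
    show ?case using closed T0 by (intro bexI[of _ 0]) (auto simp: B(2))
  next
    case (step c b y)
    then obtain k u where y: "k \<in> V" "u \<in> V" "T k = 0" "y = k + T (T u)" by (auto simp: B(2))
    show ?case
    proof (cases "l b = 0")
      case True
      then have "T (c *\<^sub>C b + k) = 0"
        using BV[OF step(1)] y by (simp add: add scale closed l[OF step(1)])
      then show ?thesis
        using y closed BV[OF step(1)] by (intro bexI[of _ "c *\<^sub>C b + k"] bexI[of _ u]) (auto simp: B(2) add.assoc)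
    next
      case False
      \<comment> \<open>\<open>T\<^sup>2\<close> acts on \<open>b\<close> as multiplication by \<open>(l b)\<^sup>2\<close>\<close>
      let ?u = "(c / (l b * l b)) *\<^sub>C b"
      have "T (T ?u) = c *\<^sub>C b"
        using False BV[OF step(1)] by (simp add: scale closed l[OF step(1)] scaleC_scaleC)
      then have "T (T (?u + u)) = c *\<^sub>C b + T (T u)"
        using y closed BV[OF step(1)] by (simp add: add in_V)
      then show ?thesis
        using y closed BV[OF step(1)]
        by (intro bexI[of _ k] bexI[of _ "?u + u"]) (auto simp: B(2) add.left_commute)
    qed
  qed
  show "T v = 0" if v: "v \<in> V" and TT: "T (T v) = 0"
  proof -
    obtain S r where S: "finite S" "S \<subseteq> B" "v = (\<Sum>b\<in>S. r b *\<^sub>C b)"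
      using v B(2) by (auto simp: cvec.span_explicit)
    have T_sum: "T (\<Sum>b\<in>S. r b *\<^sub>C b) = (\<Sum>b\<in>S. (r b * l b) *\<^sub>C b) \<and> (\<Sum>b\<in>S. r b *\<^sub>C b) \<in> V" for r
      using S(1,2)
    proof (induction S)
      case empty
      then show ?case by (simp add: T0 closed)
    next
      case (insert b S)
      then show ?case
        by (simp add: BV closed add scale) (simp add: l scaleC_scaleC)
    qed
    have "(\<Sum>b\<in>S. (r b * l b * l b) *\<^sub>C b) = 0"
      using TT T_sum[of r] T_sum[of "\<lambda>b. r b * l b"] S(3) by simp
    then have "r b * l b * l b = 0" if "b \<in> S" for b
      using cvec.independentD[OF B(1) S(1,2), of "\<lambda>b. r b * l b * l b"] that by simp
    then have "r b * l b = 0" if "b \<in> S" for b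
      using that by auto
    then have "(\<Sum>b\<in>S. (r b * l b) *\<^sub>C b) = 0" by (intro sum.neutral) (auto simp del: mult_eq_0_iff)
    then show ?thesis using T_sum[of r] S(3) by simp
  qed
qed

lemma coset_self: "cvec.subspace B \<Longrightarrow> z \<in> coset B z"
  using cvec.subspace_0 by (force simp: coset_def)

lemma coset_eq: "cvec.subspace B \<Longrightarrow> b \<in> B \<Longrightarrow> coset B (z + b) = coset B z"
proof -
  assume B: "cvec.subspace B" "b \<in> B"
  have "z + b + c \<in> coset B z" if "c \<in> B" for c
    using cvec.subspace_add[OF B that] by (auto simp: coset_def add.assoc)
  moreover have "z + c \<in> coset B (z + b)" if "c \<in> B" for c
    using cvec.subspace_diff[OF B(1) that B(2)] unfolding coset_def
    by (intro CollectI exI[of _ "c - b"]) simp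
  ultimately show ?thesis by (auto simp: coset_def)
qed

lemma coset_zero: "coset B 0 = B"
  by (simp add: coset_def)

lemma coset_add_coset:
  assumes "cvec.subspace B"
  shows "coset_add (coset B x) (coset B y) = coset B (x + y)"
proof -
  have "x + b + (y + c) \<in> coset B (x + y)" if "b \<in> B" "c \<in> B" for b c
    using cvec.subspace_add[OF assms that] unfolding coset_def
    by (intro CollectI exI[of _ "b + c"]) (simp add: add_ac)
  moreover have "x + y + b \<in> coset_add (coset B x) (coset B y)" if "b \<in> B" for b
    using cvec.subspace_0[OF assms] that unfolding coset_add_def coset_def
    by (intro CollectI exI[of _ "x + b"] exI[of _ "y"]) (auto simp: add_ac)
  ultimately show ?thesis by (auto simp: coset_add_def coset_def)
qed

lemma coset_scale_coset:
  assumes "cvec.subspace B"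
  shows "coset_scale B c (coset B x) = coset B (c *\<^sub>C x)"
proof -
  have "c *\<^sub>C (x + b) + b' \<in> coset B (c *\<^sub>C x)" if "b \<in> B" "b' \<in> B" for b b'
    using cvec.subspace_add[OF assms cvec.subspace_scale[OF assms that(1)] that(2), of c]
    by (auto simp: coset_def scaleC_add_right add.assoc)
  moreover have "c *\<^sub>C x + b \<in> coset_scale B c (coset B x)" if "b \<in> B" for b
    using coset_self[OF assms, of x] that unfolding coset_scale_def by blast
  ultimately show ?thesis by (auto simp: coset_scale_def coset_def)
qed

text \<open>
  The pairing of two classes is read off from chosen representatives; since \<open>N\<close> pairs to zero with
  \<open>Z'\<close> and \<open>N'\<close> with \<open>Z\<close>, the choice does not matter.
\<close>

lemma pairing_on_cosets:
  fixes B :: "'v::complex_vector \<Rightarrow> 'w::complex_vector \<Rightarrow> complex"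
  assumes sub: "cvec.subspace Z" "cvec.subspace N" "cvec.subspace Z'" "cvec.subspace N'"
    and N: "N \<subseteq> Z" "N' \<subseteq> Z'"
    and add: "\<And>x y z. x \<in> Z \<Longrightarrow> y \<in> Z \<Longrightarrow> z \<in> Z' \<Longrightarrow> B (x + y) z = B x z + B y z"
      "\<And>x y z. x \<in> Z \<Longrightarrow> y \<in> Z' \<Longrightarrow> z \<in> Z' \<Longrightarrow> B x (y + z) = B x y + B x z"
    and scale: "\<And>c x z. x \<in> Z \<Longrightarrow> z \<in> Z' \<Longrightarrow> B (c *\<^sub>C x) z = c * B x z"
      "\<And>c x z. x \<in> Z \<Longrightarrow> z \<in> Z' \<Longrightarrow> B x (c *\<^sub>C z) = c * B x z"
    and van: "\<And>x z. x \<in> N \<Longrightarrow> z \<in> Z' \<Longrightarrow> B x z = 0" "\<And>x z. x \<in> Z \<Longrightarrow> z \<in> N' \<Longrightarrow> B x z = 0"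
    and nondeg: "\<And>x. x \<in> Z \<Longrightarrow> (\<And>z. z \<in> Z' \<Longrightarrow> B x z = 0) \<Longrightarrow> x \<in> N"
      "\<And>z. z \<in> Z' \<Longrightarrow> (\<And>x. x \<in> Z \<Longrightarrow> B x z = 0) \<Longrightarrow> z \<in> N'"
  shows "\<exists>P. (\<forall>x\<in>Z. \<forall>z\<in>Z'. P (coset N x) (coset N' z) = B x z) \<and>
    bilinear_pairing N (coset N ` Z) N' (coset N' ` Z') P \<and>
    nondegenerate_pairing N (coset N ` Z) N' (coset N' ` Z') P"
proof -
  define P where "P X Y = B (SOME x. x \<in> X) (SOME y. y \<in> Y)" for X Y
  have P: "P (coset N x) (coset N' z) = B x z" if x: "x \<in> Z" and z: "z \<in> Z'" for x z
  proof -
    have "(SOME x'. x' \<in> coset N x) \<in> coset N x"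
      by (rule someI[where P = "\<lambda>x'. x' \<in> coset N x", OF coset_self[OF sub(2)]])
    moreover have "(SOME z'. z' \<in> coset N' z) \<in> coset N' z"
      by (rule someI[where P = "\<lambda>z'. z' \<in> coset N' z", OF coset_self[OF sub(4)]])
    ultimately obtain b c where bc: "b \<in> N" "(SOME x'. x' \<in> coset N x) = x + b"
        "c \<in> N'" "(SOME z'. z' \<in> coset N' z) = z + c"
      unfolding coset_def by blast
    have "x + b \<in> Z" using bc x N sub cvec.subspace_add by blast
    then have "B (x + b) (z + c) = B (x + b) z" using bc z N add van by auto
    also have "\<dots> = B x z" using bc x z N add van by auto
    finally show ?thesis by (simp add: P_def bc)
  qed
  have mem: "x + y \<in> Z" "c *\<^sub>C x \<in> Z" if "x \<in> Z" "y \<in> Z" for x y c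
    using that sub cvec.subspace_add cvec.subspace_scale by blast+
  have mem': "x + y \<in> Z'" "c *\<^sub>C x \<in> Z'" if "x \<in> Z'" "y \<in> Z'" for x y c
    using that sub cvec.subspace_add cvec.subspace_scale by blast+
  have "bilinear_pairing N (coset N ` Z) N' (coset N' ` Z') P"
    unfolding bilinear_pairing_def
    by (auto simp: coset_add_coset coset_scale_coset sub P mem mem' add scale)
  moreover have "coset N x = N" if "x \<in> N" for x
    using coset_eq[OF sub(2) that, of 0] by (simp add: coset_zero)
  moreover have "coset N' z = N'" if "z \<in> N'" for z
    using coset_eq[OF sub(4) that, of 0] by (simp add: coset_zero)
  ultimately have "bilinear_pairing N (coset N ` Z) N' (coset N' ` Z') P \<and>
    nondegenerate_pairing N (coset N ` Z) N' (coset N' ` Z') P"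
    using nondeg by (auto simp: nondegenerate_pairing_def P)
  then show ?thesis using P by blast
qed

section \<open>The Hermitian metric and the adjoint\<close>

locale kaehler_hermitian = kaehler_state H K f + kaehler_bundle H K E
  for H :: "'a::complex_star_algebra hopf"
    and K :: "('a, 'm::complex_star_algebra, 'w::complex_algebra_1) kaehler"
    and f :: "'m \<Rightarrow> complex"
    and E :: "('a, 'm, 'w, 'f::complex_vector) bundle_data" +
  fixes h :: "'f \<Rightarrow> 'f \<Rightarrow> 'm"
  assumes hermitian: "hermitian_structure H K E h"
begin

abbreviation D :: "('w, 'f) tensor \<Rightarrow> ('w, 'f) tensor" where "D \<equiv> dbar_ext K E"
abbreviation D' :: "('f \<Rightarrow> 'm, 'w) tensor \<Rightarrow> ('f \<Rightarrow> 'm, 'w) tensor" where "D' \<equiv> dbar_dual_ext K E"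
abbreviation S :: "('w, 'f) tensor \<Rightarrow> ('f \<Rightarrow> 'm, 'w) tensor" where "S \<equiv> Hodge_bar K E h"
abbreviation F :: "nat \<times> nat \<Rightarrow> ('w, 'f) tensor set" where "F p \<equiv> formsF K E (biforms K p)"
abbreviation G :: "nat \<times> nat \<Rightarrow> ('f \<Rightarrow> 'm, 'w) tensor set" where "G p \<equiv> formsD K E (biforms K p)"

definition pair :: "('w, 'f) tensor \<Rightarrow> ('f \<Rightarrow> 'm, 'w) tensor \<Rightarrow> complex"
  where "pair \<alpha> \<beta> = \<I> (ev K E \<alpha> \<beta>)"

lemma h_add: "h (x + y) = h x + h y" and h_scale: "h (c *\<^sub>C x) = cnj c *\<^sub>C h x"
  and h_act_star: "h (act E (star m) x) = dual_act (h x) m"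
  and h_bij: "bij_betw h UNIV (dual E)" and h_sym: "h x y = star (h y x)"
  using hermitian unfolding hermitian_structure_def by (elim conjE, iprover)+

lemma h_act: "h (act E m x) = dual_act (h x) (star m)"
  using h_act_star[of "star m" x] by (simp add: star_star)

lemma h_in: "h x \<in> dual E"
  using h_bij by (auto simp: bij_betw_def)

lemma Hodge_bar_bal: "balF cnj (\<lambda>\<omega> x. tD (h x) (Hodge K (conj K \<omega>)))"
  by (simp add: balanced_map_def conj_add conj_scale conj_mult_incl clinear_add[OF Hodge_linear]
      clinear_scale[OF Hodge_linear] Hodge_incl_left h_add h_scale h_act h_in tensD_add_left tensD_add_right
      tensD_scale_left tensD_scale_right tensD_balanced)

lemma S_tens: "S (tF \<omega> x) = tD (h x) (Hodge K (conj K \<omega>))"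
  by (simp add: Hodge_bar_def liftF_tens[OF Hodge_bar_bal])

lemma S_add: "\<alpha> \<in> VF \<Longrightarrow> \<alpha>' \<in> VF \<Longrightarrow> S (\<alpha> + \<alpha>') = S \<alpha> + S \<alpha>'"
  by (simp add: Hodge_bar_def liftF_add[OF Hodge_bar_bal])

lemma S_scale: "\<alpha> \<in> VF \<Longrightarrow> S (c *\<^sub>C \<alpha>) = cnj c *\<^sub>C S \<alpha>"
  by (simp add: Hodge_bar_def liftF_scale[OF Hodge_bar_bal])

lemma S_in: "\<alpha> \<in> VF \<Longrightarrow> S \<alpha> \<in> VD"
  by (induction rule: VF_induct) (simp_all add: S_tens S_add tensD_in h_in formsD_closed)

lemma S_0: "S 0 = 0"
  using S_scale[of 0 0] by (simp add: formsF_closed)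

lemma S_biforms: "\<alpha> \<in> F (a, b) \<Longrightarrow> S \<alpha> \<in> G (n - a, n - b)"
proof -
  assume "\<alpha> \<in> F (a, b)"
  then show ?thesis
    using biforms_subspace
  proof (induction rule: formsF_induct)
    case (tens \<omega> x)
    then show ?case using Hodge_biform[OF conj_biform] by (simp add: S_tens tensD_in h_in)
  qed (simp add: S_add formsF_UNIV formsD_closed)
qed

lemma S_surj:
  assumes "a \<le> n" "b \<le> n" "\<beta> \<in> G (n - a, n - b)"
  shows "\<exists>\<alpha>\<in>F (a, b). S \<alpha> = \<beta>"
  using assms(3) biforms_subspace
proof (induction rule: formsD_induct)
  case (tens \<phi> \<nu>)
  obtain x where x: "h x = \<phi>" using tens h_bij by (metis bij_betw_imp_surj_on imageE)
  obtain \<eta> where \<eta>: "\<eta> \<in> biforms K (b, a)" "Hodge K \<eta> = \<nu>"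
    using Hodge_surj[OF _ _ tens(2)] assms(1,2) by auto
  have "S (tF (conj K \<eta>) x) = tD \<phi> \<nu>" by (simp add: S_tens conj_conj x \<eta>)
  then show ?case using tensF_in[OF conj_biform[OF \<eta>(1)], of x] by blast
next
  case (add \<beta> \<beta>')
  then obtain \<alpha> \<alpha>' where "\<alpha> \<in> F (a, b)" "S \<alpha> = \<beta>" "\<alpha>' \<in> F (a, b)" "S \<alpha>' = \<beta>'" by blast
  then show ?case by (intro bexI[of _ "\<alpha> + \<alpha>'"]) (simp_all add: S_add formsF_UNIV formsF_closed)
qed

lemma S_surj_all: "\<beta> \<in> VD \<Longrightarrow> \<exists>\<alpha>\<in>VF. S \<alpha> = \<beta>"
proof (induction rule: VD_induct)
  case (tens \<phi> \<nu>)
  obtain x where x: "h x = \<phi>" using tens h_bij by (metis bij_betw_imp_surj_on imageE)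
  obtain \<eta> where "Hodge K \<eta> = \<nu>" using Hodge_surj_all by blast
  then have "S (tF (conj K \<eta>) x) = tD \<phi> \<nu>" by (simp add: S_tens conj_conj x)
  then show ?case using tensF_in[of "conj K \<eta>" UNIV x] by blast
next
  case (add \<beta> \<beta>')
  then obtain \<alpha> \<alpha>' where "\<alpha> \<in> VF" "S \<alpha> = \<beta>" "\<alpha>' \<in> VF" "S \<alpha>' = \<beta>'" by blast
  then show ?case by (intro bexI[of _ "\<alpha> + \<alpha>'"]) (simp_all add: S_add formsF_closed)
qed

lemma F_outside: "\<alpha> \<in> F (a, b) \<Longrightarrow> \<not> (a \<le> n \<and> b \<le> n) \<Longrightarrow> \<alpha> = 0"
proof -
  assume \<alpha>: "\<alpha> \<in> F (a, b)" and ab: "\<not> (a \<le> n \<and> b \<le> n)"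
  from \<alpha> biforms_subspace show "\<alpha> = 0"
  proof (induction rule: formsF_induct)
    case (tens \<omega> x)
    then show ?case using biforms_outside[OF ab tens(1)] by (simp add: tensF_0)
  qed simp
qed

lemma G_outside: "\<beta> \<in> G (a, b) \<Longrightarrow> \<not> (a \<le> n \<and> b \<le> n) \<Longrightarrow> \<beta> = 0"
proof -
  assume \<beta>: "\<beta> \<in> G (a, b)" and ab: "\<not> (a \<le> n \<and> b \<le> n)"
  from \<beta> biforms_subspace show "\<beta> = 0"
  proof (induction rule: formsD_induct)
    case (tens \<phi> \<nu>)
    then show ?case using biforms_outside[OF ab tens(2)] by (simp add: tensD_0)
  qed simp
qed

lemma pair_add_left: "\<alpha> \<in> VF \<Longrightarrow> \<alpha>' \<in> VF \<Longrightarrow> \<beta> \<in> VD \<Longrightarrow> pair (\<alpha> + \<alpha>') \<beta> = pair \<alpha> \<beta> + pair \<alpha>' \<beta>"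
  and pair_add_right: "\<alpha> \<in> VF \<Longrightarrow> \<beta> \<in> VD \<Longrightarrow> \<beta>' \<in> VD \<Longrightarrow> pair \<alpha> (\<beta> + \<beta>') = pair \<alpha> \<beta> + pair \<alpha> \<beta>'"
  and pair_scale_left: "\<alpha> \<in> VF \<Longrightarrow> \<beta> \<in> VD \<Longrightarrow> pair (c *\<^sub>C \<alpha>) \<beta> = c * pair \<alpha> \<beta>"
  and pair_scale_right: "\<alpha> \<in> VF \<Longrightarrow> \<beta> \<in> VD \<Longrightarrow> pair \<alpha> (c *\<^sub>C \<beta>) = c * pair \<alpha> \<beta>"
  by (simp_all add: pair_def ev_add_left ev_add_right ev_scale_left ev_scale_right integral_add integral_scale)

lemma pair_0: "\<beta> \<in> VD \<Longrightarrow> pair 0 \<beta> = 0" "\<alpha> \<in> VF \<Longrightarrow> pair \<alpha> 0 = 0"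
  using pair_scale_left[of 0 \<beta> 0] pair_scale_right[of \<alpha> 0 0] by (simp_all add: formsF_closed formsD_closed)

lemma pair_bidegree: "\<alpha> \<in> F (a, b) \<Longrightarrow> \<beta> \<in> G (c, d) \<Longrightarrow> (a + c, b + d) \<noteq> (n, n) \<Longrightarrow> pair \<alpha> \<beta> = 0"
  unfolding pair_def by (rule integral_biform[OF ev_biforms])

text \<open>
  Stokes' theorem for the Leibniz rule of the evaluation product.
\<close>

lemma pair_D:
  assumes "\<alpha> \<in> F (a, b)" "\<beta> \<in> VD"
  shows "pair (D \<alpha>) \<beta> = - ((-1) ^ (a + b) * pair \<alpha> (D' \<beta>))"
proof -
  have "0 = \<I> (delbar K (ev K E \<alpha> \<beta>))" by (simp add: integral_delbar)
  also have "\<dots> = pair (D \<alpha>) \<beta> + (-1) ^ (a + b) * pair \<alpha> (D' \<beta>)"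
    by (simp add: delbar_ev[OF assms] integral_add integral_scale pair_def)
  finally show ?thesis by (simp add: eq_neg_iff_add_eq_0)
qed

text \<open>
  Pairing with \<open>\<omega> \<otimes> x\<close> is integrating \<open>\<omega>\<close> against the evaluation of \<open>\<beta>\<close> at \<open>1 \<otimes> x\<close>, and these
  evaluations determine \<open>\<beta>\<close>.
\<close>

lemma pair_nondegenerate_right:
  assumes \<beta>: "\<beta> \<in> VD" and "\<And>\<alpha>. \<alpha> \<in> VF \<Longrightarrow> pair \<alpha> \<beta> = 0"
  shows "\<beta> = 0"
proof (rule formsD_eqI[OF \<beta>])
  show "(0 :: ('f \<Rightarrow> 'm, 'w) tensor) \<in> VD" by (rule formsD_closed)
  fix x
  have "ev K E (tF 1 x) \<beta> = 0"
  proof (rule integral_nondegenerate_right)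
    fix \<omega>
    have "\<I> (\<omega> * ev K E (tF 1 x) \<beta>) = pair (wedgeF K E \<omega> (tF 1 x)) \<beta>"
      using \<beta> by (simp add: pair_def ev_wedgeF tensF_in)
    then show "\<I> (\<omega> * ev K E (tF 1 x) \<beta>) = 0" using assms(2) by (simp add: wedgeF_in tensF_in)
  qed
  moreover have "ev K E (tF 1 x) 0 = 0"
    using ev_scale_right[of "tF 1 x" 0 0] by (simp add: tensF_in formsD_closed)
  ultimately show "ev K E (tF 1 x) \<beta> = ev K E (tF 1 x) 0" by simp
qed

lemma pair_nondegenerate_left:
  assumes \<alpha>: "\<alpha> \<in> VF" and "\<And>\<beta>. \<beta> \<in> VD \<Longrightarrow> pair \<alpha> \<beta> = 0"
  shows "\<alpha> = 0"
proof -
  obtain N :: nat and e \<epsilon> where \<epsilon>: "\<And>k. \<epsilon> k \<in> dual E"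
    and F: "\<And>\<alpha>. \<alpha> \<in> VF \<Longrightarrow> (\<Sum>k<N. tF (ev K E \<alpha> (tD (\<epsilon> k) 1)) (e k)) = \<alpha>"
    by (rule dual_basis) (rule that)
  have "ev K E \<alpha> (tD (\<epsilon> k) 1) = 0" for k
  proof (rule integral_nondegenerate_left)
    fix \<nu>
    have "\<I> (ev K E \<alpha> (tD (\<epsilon> k) 1) * \<nu>) = pair \<alpha> (wedgeD K E (tD (\<epsilon> k) 1) \<nu>)"
      using \<alpha> \<epsilon> by (simp add: pair_def ev_wedgeD tensD_in)
    then show "\<I> (ev K E \<alpha> (tD (\<epsilon> k) 1) * \<nu>) = 0" using assms(2) \<epsilon> by (simp add: wedgeD_in tensD_in)
  qed
  then show ?thesis using F[OF \<alpha>] by (simp add: tensF_0)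
qed

text \<open>
  On pure tensors, \<open>\<omega> \<otimes> x\<close> and \<open>\<nu> \<otimes> y\<close> pair to \<open>\<integral> \<omega> h(y)(x) \<star>(\<nu>*)\<close>, and \<open>h(x)(y)\<close> is the adjoint of
  \<open>h(y)(x)\<close>.
\<close>

lemma pair_hermitian:
  assumes \<alpha>: "\<alpha> \<in> VF" and \<gamma>: "\<gamma> \<in> VF"
  shows "pair \<alpha> (S \<gamma>) = cnj (pair \<gamma> (S \<alpha>))"
  using \<alpha>
proof (induction rule: VF_induct)
  case (tens \<omega> x)
  from \<gamma> show ?case
  proof (induction rule: VF_induct)
    case (tens \<nu> y)
    then show ?case
      using integral_Hodge_incl_hermitian[of \<omega> "h y x" \<nu>]
      by (simp add: pair_def S_tens ev_tens h_in h_sym[of x y])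
  next
    case (add \<gamma> \<gamma>')
    then show ?case by (simp add: S_add S_in pair_add_left pair_add_right tensF_in)
  qed
next
  case (add \<alpha> \<alpha>')
  then show ?case using \<gamma> by (simp add: S_add S_in pair_add_left pair_add_right)
qed

lemma metric_nondegenerate:
  assumes \<gamma>: "\<gamma> \<in> VF" and "\<And>\<alpha>. \<alpha> \<in> VF \<Longrightarrow> pair \<alpha> (S \<gamma>) = 0"
  shows "\<gamma> = 0"
proof (rule pair_nondegenerate_left[OF \<gamma>])
  fix \<beta> assume "\<beta> \<in> VD"
  then obtain \<alpha> where "\<alpha> \<in> VF" "S \<alpha> = \<beta>" using S_surj_all by blast
  then show "pair \<gamma> \<beta> = 0" using pair_hermitian[OF \<gamma>, of \<alpha>] assms(2) by auto
qed

lemma VF_biform_induct [consumes 1, case_names biform add]: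
  assumes \<alpha>: "\<alpha> \<in> VF" and P: "\<And>a b \<alpha>. \<alpha> \<in> F (a, b) \<Longrightarrow> P \<alpha>"
    and add: "\<And>\<alpha> \<alpha>'. \<alpha> \<in> VF \<Longrightarrow> \<alpha>' \<in> VF \<Longrightarrow> P \<alpha> \<Longrightarrow> P \<alpha>' \<Longrightarrow> P (\<alpha> + \<alpha>')"
  shows "P \<alpha>"
  using \<alpha>
proof (induction rule: VF_induct)
  case (tens \<omega> x)
  show ?case
  proof (induction \<omega> rule: biform_induct)
    case (biform p \<omega>)
    then show ?case using P[of "tF \<omega> x" "fst p" "snd p"] by (simp add: tensF_in)
  next
    case (add \<omega> \<nu>)
    then show ?case using assms(3)[of "tF \<omega> x" "tF \<nu> x"] by (simp add: tensF_add_left tensF_in)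
  qed
qed (rule add)

text \<open>
  The forms of bidegree \<open>(a, b - 1)\<close>, with no such forms for \<open>b = 0\<close>, where natural number subtraction
  would give bidegree \<open>(a, 0)\<close>.
\<close>

definition F_below :: "nat \<Rightarrow> nat \<Rightarrow> ('w, 'f) tensor set"
  where "F_below a b = (case b of 0 \<Rightarrow> {0} | Suc b' \<Rightarrow> F (a, b'))"

lemma F_below_VF: "\<alpha> \<in> F_below a b \<Longrightarrow> \<alpha> \<in> VF"
  by (auto simp: F_below_def formsF_closed formsF_UNIV split: nat.splits)

lemma D_F_below: "\<alpha> \<in> F_below a b \<Longrightarrow> D \<alpha> \<in> F (a, b)"
  using dbar_ext_scale[of 0 0] dbar_ext_biforms[of \<alpha> a "b - 1"]
  by (auto simp: F_below_def formsF_closed split: nat.splits)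

lemma D'_0: "D' 0 = 0"
  using dbar_dual_ext_scale[of 0 0] by (simp add: formsD_closed)

text \<open>
  The adjoint is \<open>S\<^sup>-\<^sup>1 D' S\<close> up to sign.  By bidegree only \<open>\<alpha>\<close> of bidegree \<open>(a, b - 1)\<close> contributes to
  either side of the adjunction, so the sign \<open>-(-1)\<^sup>a\<^sup>+\<^sup>b\<^sup>-\<^sup>1\<close> of \<open>pair_D\<close> depends on \<open>\<beta>\<close> alone.
\<close>

lemma adjoint_biform_exists:
  assumes \<beta>: "\<beta> \<in> F (a, b)"
  shows "\<exists>\<gamma>\<in>F_below a b. S \<gamma> = (-1) ^ (a + b) *\<^sub>C D' (S \<beta>) \<and> (\<forall>\<alpha>\<in>VF. pair (D \<alpha>) (S \<beta>) = pair \<alpha> (S \<gamma>))"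
proof -
  have Sb: "S \<beta> \<in> VD" using \<beta> by (simp add: S_in formsF_UNIV)
  have DSb: "D' (S \<beta>) \<in> G (n - a, n - b + 1)"
    using dbar_dual_ext_biforms[OF S_biforms[OF \<beta>]] .
  have "\<exists>\<gamma>\<in>F_below a b. S \<gamma> = (-1) ^ (a + b) *\<^sub>C D' (S \<beta>)"
  proof (cases "a \<le> n \<and> b \<le> n")
    case False
    then have "\<beta> = 0" using F_outside \<beta> by blast
    moreover have "0 \<in> F_below a b" by (simp add: F_below_def formsF_closed split: nat.splits)
    ultimately show ?thesis by (intro bexI[of _ 0]) (simp_all add: S_0 D'_0)
  next
    case True
    show ?thesis
    proof (cases b)
      case 0
      then have "D' (S \<beta>) = 0" using DSb G_outside by simp
      then show ?thesis using 0 by (simp add: F_below_def S_0)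
    next
      case (Suc b')
      then have "n - b + 1 = n - b'" using True by arith
      then have "(-1) ^ (a + b) *\<^sub>C D' (S \<beta>) \<in> G (n - a, n - b')"
        using DSb by (simp only: formsD_closed)
      from S_surj[OF _ _ this] show ?thesis using True Suc by (simp add: F_below_def)
    qed
  qed
  then obtain \<gamma> where \<gamma>: "\<gamma> \<in> F_below a b" "S \<gamma> = (-1) ^ (a + b) *\<^sub>C D' (S \<beta>)" by blast
  have "pair (D \<alpha>) (S \<beta>) = pair \<alpha> (S \<gamma>)" if "\<alpha> \<in> VF" for \<alpha>
    using that
  proof (induction rule: VF_biform_induct)
    case (biform c d \<alpha>)
    have 1: "pair (D \<alpha>) (S \<beta>) = - ((-1) ^ (c + d) * pair \<alpha> (D' (S \<beta>)))"
      by (rule pair_D[OF biform Sb])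
    have 2: "pair \<alpha> (S \<gamma>) = (-1) ^ (a + b) * pair \<alpha> (D' (S \<beta>))"
      using Sb formsF_UNIV[OF biform] by (simp add: \<gamma> pair_scale_right dbar_dual_ext_in)
    show ?case
    proof (cases "a \<le> n \<and> b \<le> n")
      case False
      then have "\<beta> = 0" using F_outside \<beta> by blast
      then show ?thesis using 1 2 formsF_UNIV[OF biform] by (simp add: S_0 D'_0 pair_0)
    next
      case ab: True
      show ?thesis
      proof (cases "c = a \<and> b = Suc d")
        case True
        then show ?thesis unfolding 1 2 by simp
      next
        case False
        then have "pair \<alpha> (D' (S \<beta>)) = 0"
          using ab by (intro pair_bidegree[OF biform DSb]) auto
        then show ?thesis unfolding 1 2 by simp
      qed
    qed
  next
    case (add \<alpha> \<alpha>')
    then show ?case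
      using Sb F_below_VF[OF \<gamma>(1)] by (simp add: dbar_ext_add dbar_ext_in pair_add_left S_in)
  qed
  with \<gamma> show ?thesis by blast
qed

abbreviation A :: "('w, 'f) tensor \<Rightarrow> ('w, 'f) tensor" where "A \<equiv> dbar_adjoint K E h f"

lemma adjoint_exists: "\<beta> \<in> VF \<Longrightarrow> \<exists>\<gamma>\<in>VF. \<forall>\<alpha>\<in>VF. pair (D \<alpha>) (S \<beta>) = pair \<alpha> (S \<gamma>)"
proof (induction rule: VF_biform_induct)
  case (biform a b \<beta>)
  then show ?case using adjoint_biform_exists F_below_VF by blast
next
  case (add \<beta> \<beta>')
  then obtain \<gamma> \<gamma>' where g: "\<gamma> \<in> VF" "\<forall>\<alpha>\<in>VF. pair (D \<alpha>) (S \<beta>) = pair \<alpha> (S \<gamma>)"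
    "\<gamma>' \<in> VF" "\<forall>\<alpha>\<in>VF. pair (D \<alpha>) (S \<beta>') = pair \<alpha> (S \<gamma>')" by blast
  then have "\<forall>\<alpha>\<in>VF. pair (D \<alpha>) (S (\<beta> + \<beta>')) = pair \<alpha> (S (\<gamma> + \<gamma>'))"
    using add by (simp add: S_add S_in pair_add_right dbar_ext_in)
  then show ?case using g by (intro bexI[of _ "\<gamma> + \<gamma>'"]) (simp_all add: formsF_closed)
qed

lemma adjoint_unique:
  assumes "\<gamma> \<in> VF" "\<gamma>' \<in> VF" "\<And>\<alpha>. \<alpha> \<in> VF \<Longrightarrow> pair \<alpha> (S \<gamma>) = pair \<alpha> (S \<gamma>')"
  shows "\<gamma> = \<gamma>'"
proof -
  have m: "(-1) *\<^sub>C \<gamma>' \<in> VF" using assms by (simp only: formsF_closed)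
  have "\<gamma> + (-1) *\<^sub>C \<gamma>' = 0"
  proof (rule metric_nondegenerate)
    show "\<gamma> + (-1) *\<^sub>C \<gamma>' \<in> VF" using assms m by (simp only: formsF_closed)
    fix \<alpha> assume \<alpha>: "\<alpha> \<in> VF"
    have "S (\<gamma> + (-1) *\<^sub>C \<gamma>') = S \<gamma> + cnj (-1) *\<^sub>C S \<gamma>'"
      by (simp only: S_add[OF assms(1) m] S_scale[OF assms(2)])
    then show "pair \<alpha> (S (\<gamma> + (-1) *\<^sub>C \<gamma>')) = 0"
      using assms(1,2) assms(3)[OF \<alpha>] \<alpha> formsD_closed(3)[OF S_in[OF assms(2)], of "cnj (-1)"]
      by (simp only: pair_add_right pair_scale_right S_in) simp
  qed
  then show ?thesis by (simp add: scaleC_one)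
qed

lemma innerF_pair: "innerF K E h f \<alpha> \<gamma> = pair \<alpha> (S \<gamma>)"
  by (simp add: innerF_def metricF_def pair_def form_integral_def)

lemma adjoint_ex1:
  assumes \<beta>: "\<beta> \<in> VF"
  shows "\<exists>!\<gamma>. \<gamma> \<in> VF \<and> (\<forall>\<alpha>\<in>VF. innerF K E h f (D \<alpha>) \<beta> = innerF K E h f \<alpha> \<gamma>)"
proof -
  obtain \<gamma> where "\<gamma> \<in> VF" "\<forall>\<alpha>\<in>VF. pair (D \<alpha>) (S \<beta>) = pair \<alpha> (S \<gamma>)"
    using adjoint_exists[OF \<beta>] by blast
  then show ?thesis unfolding innerF_pair by (intro ex1I[of _ \<gamma>]) (auto intro: adjoint_unique)
qed

lemma A_spec: "\<beta> \<in> VF \<Longrightarrow> A \<beta> \<in> VF \<and> (\<forall>\<alpha>\<in>VF. pair (D \<alpha>) (S \<beta>) = pair \<alpha> (S (A \<beta>)))"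
  unfolding dbar_adjoint_def innerF_pair[symmetric] by (rule theI'[OF adjoint_ex1])

lemma A_in: "\<beta> \<in> VF \<Longrightarrow> A \<beta> \<in> VF"
  and A_pair: "\<alpha> \<in> VF \<Longrightarrow> \<beta> \<in> VF \<Longrightarrow> pair (D \<alpha>) (S \<beta>) = pair \<alpha> (S (A \<beta>))"
  using A_spec by blast+

lemma A_eq: "\<beta> \<in> VF \<Longrightarrow> \<gamma> \<in> VF \<Longrightarrow> (\<And>\<alpha>. \<alpha> \<in> VF \<Longrightarrow> pair (D \<alpha>) (S \<beta>) = pair \<alpha> (S \<gamma>)) \<Longrightarrow> A \<beta> = \<gamma>"
  by (rule adjoint_unique) (simp_all add: A_in A_pair[symmetric])

lemma A_add: "\<beta> \<in> VF \<Longrightarrow> \<beta>' \<in> VF \<Longrightarrow> A (\<beta> + \<beta>') = A \<beta> + A \<beta>'"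
  by (rule A_eq) (simp_all add: A_in formsF_closed S_add S_in pair_add_right dbar_ext_in A_pair)

lemma A_scale: "\<beta> \<in> VF \<Longrightarrow> A (c *\<^sub>C \<beta>) = c *\<^sub>C A \<beta>"
  by (rule A_eq) (simp_all add: A_in formsF_closed S_scale S_in pair_scale_right dbar_ext_in A_pair)

lemma A_biform:
  assumes "\<beta> \<in> F (a, b)"
  shows "A \<beta> \<in> F_below a b" and "S (A \<beta>) = (-1) ^ (a + b) *\<^sub>C D' (S \<beta>)"
proof -
  obtain \<gamma> where \<gamma>: "\<gamma> \<in> F_below a b" "S \<gamma> = (-1) ^ (a + b) *\<^sub>C D' (S \<beta>)"
    "\<forall>\<alpha>\<in>VF. pair (D \<alpha>) (S \<beta>) = pair \<alpha> (S \<gamma>)"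
    using adjoint_biform_exists[OF assms] by blast
  have "A \<beta> = \<gamma>" using \<gamma> F_below_VF assms by (intro A_eq) (auto simp: formsF_UNIV)
  with \<gamma> show "A \<beta> \<in> F_below a b" "S (A \<beta>) = (-1) ^ (a + b) *\<^sub>C D' (S \<beta>)" by simp_all
qed

lemma D_0: "D 0 = 0"
  using dbar_ext_scale[of 0 0] by (simp add: formsF_closed)

lemma A_0: "A 0 = 0"
  using A_scale[of 0 0] by (simp add: formsF_closed)

text \<open>
  By non-degeneracy, from \<open>D\<^sup>2 = 0\<close>.
\<close>

lemma A_squared: "\<beta> \<in> VF \<Longrightarrow> A (A \<beta>) = 0"
  by (rule A_eq)
    (simp_all add: A_in formsF_closed A_pair[symmetric] dbar_ext_in dbar_ext_squared S_0 S_in pair_0)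

section \<open>Cocycles and coboundaries\<close>

lemma cocyclesF_subspace: "cvec.subspace (cocyclesF K E a b)"
  by (auto simp: cvec.subspace_def cocyclesF_def formsF_closed D_0 dbar_ext_add dbar_ext_scale formsF_UNIV)

lemma cocyclesD_subspace: "cvec.subspace (cocyclesD K E a b)"
  by (auto simp: cvec.subspace_def cocyclesD_def formsD_closed D'_0 dbar_dual_ext_add dbar_dual_ext_scale formsD_UNIV)

lemma coboundariesF_eq: "coboundariesF K E a b = D ` F_below a b"
  by (cases b) (simp_all add: coboundariesF_def F_below_def D_0)

lemma coboundariesF_subspace: "cvec.subspace (coboundariesF K E a b)"
proof -
  have "cvec.subspace (D ` F (a, b'))" for b'
    unfolding cvec.subspace_def
  proof (intro conjI ballI allI)
    show "0 \<in> D ` F (a, b')" using D_0 formsF_closed(1) by force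
    show "x + y \<in> D ` F (a, b')" if "x \<in> D ` F (a, b')" "y \<in> D ` F (a, b')" for x y
      using that by (auto simp: formsF_UNIV dbar_ext_add[symmetric] intro!: imageI formsF_closed)
    show "c *\<^sub>C x \<in> D ` F (a, b')" if "x \<in> D ` F (a, b')" for c x
      using that by (auto simp: formsF_UNIV dbar_ext_scale[symmetric] intro!: imageI formsF_closed)
  qed
  then show ?thesis by (simp add: coboundariesF_def split: nat.splits)
qed

lemma coboundariesD_subspace: "cvec.subspace (coboundariesD K E a b)"
proof -
  have "cvec.subspace (D' ` G (a, b'))" for b'
    unfolding cvec.subspace_def
  proof (intro conjI ballI allI)
    show "0 \<in> D' ` G (a, b')" using D'_0 formsD_closed(1) by force
    show "x + y \<in> D' ` G (a, b')" if "x \<in> D' ` G (a, b')" "y \<in> D' ` G (a, b')" for x y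
      using that by (auto simp: formsD_UNIV dbar_dual_ext_add[symmetric] intro!: imageI formsD_closed)
    show "c *\<^sub>C x \<in> D' ` G (a, b')" if "x \<in> D' ` G (a, b')" for c x
      using that by (auto simp: formsD_UNIV dbar_dual_ext_scale[symmetric] intro!: imageI formsD_closed)
  qed
  then show ?thesis by (simp add: coboundariesD_def split: nat.splits)
qed

lemma coboundariesF_sub: "coboundariesF K E a b \<subseteq> cocyclesF K E a b"
  using D_F_below F_below_VF dbar_ext_squared by (auto simp: coboundariesF_eq cocyclesF_def)

text \<open>
  The dual structure inherits flatness because the pairing is non-degenerate and \<open>D'\<close> is, up to sign,
  the transpose of \<open>D\<close>.
\<close>

lemma D'_squared:
  assumes "\<beta> \<in> VD"
  shows "D' (D' \<beta>) = 0"
proof (rule pair_nondegenerate_right)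
  show "D' (D' \<beta>) \<in> VD" using assms by (simp add: dbar_dual_ext_in)
  fix \<alpha> assume "\<alpha> \<in> VF"
  then show "pair \<alpha> (D' (D' \<beta>)) = 0"
  proof (induction rule: VF_biform_induct)
    case (biform a b \<alpha>)
    have "pair (D (D \<alpha>)) \<beta> = 0" using assms formsF_UNIV[OF biform] by (simp add: dbar_ext_squared pair_0)
    then have "pair (D \<alpha>) (D' \<beta>) = 0" using pair_D[OF dbar_ext_biforms[OF biform] assms] by simp
    then show ?case using pair_D[OF biform dbar_dual_ext_in[OF assms]] by simp
  qed (simp add: pair_add_left dbar_dual_ext_in assms)
qed

lemma coboundariesD_sub: "coboundariesD K E a b \<subseteq> cocyclesD K E a b"
proof (cases b)
  case 0
  then show ?thesis by (simp add: coboundariesD_def cocyclesD_def formsD_closed D'_0)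
next
  case (Suc b')
  then show ?thesis
    using dbar_dual_ext_biforms[of _ a b'] D'_squared formsD_UNIV
    by (auto simp: coboundariesD_def cocyclesD_def)
qed

lemma pair_coboundaryF:
  assumes "\<alpha> \<in> coboundariesF K E a b" "\<beta> \<in> cocyclesD K E c d"
  shows "pair \<alpha> \<beta> = 0"
proof -
  have \<beta>: "\<beta> \<in> VD" "D' \<beta> = 0" using assms(2) by (auto simp: cocyclesD_def formsD_UNIV)
  show ?thesis
  proof (cases b)
    case 0
    then show ?thesis using assms(1) \<beta> by (simp add: coboundariesF_def pair_0)
  next
    case (Suc b')
    then obtain \<gamma> where \<gamma>: "\<gamma> \<in> F (a, b')" "\<alpha> = D \<gamma>" using assms(1) by (auto simp: coboundariesF_def)
    then show ?thesis using pair_D[OF \<gamma>(1) \<beta>(1)] formsF_UNIV[OF \<gamma>(1)] by (simp add: \<beta> pair_0)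
  qed
qed

lemma pair_coboundaryD:
  assumes "\<alpha> \<in> cocyclesF K E a b" "\<beta> \<in> coboundariesD K E c d"
  shows "pair \<alpha> \<beta> = 0"
proof -
  have \<alpha>: "\<alpha> \<in> F (a, b)" "D \<alpha> = 0" using assms(1) by (auto simp: cocyclesF_def)
  show ?thesis
  proof (cases d)
    case 0
    then show ?thesis using assms(2) formsF_UNIV[OF \<alpha>(1)] by (simp add: coboundariesD_def pair_0)
  next
    case (Suc d')
    then obtain \<gamma> where \<gamma>: "\<gamma> \<in> G (c, d')" "\<beta> = D' \<gamma>" using assms(2) by (auto simp: coboundariesD_def)
    then show ?thesis using pair_D[OF \<alpha>(1) formsD_UNIV[OF \<gamma>(1)]] formsD_UNIV[OF \<gamma>(1)] by (simp add: \<alpha> pair_0)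
  qed
qed

text \<open>
  This turns dual-valued cocycles into forms killed by the adjoint.
\<close>

lemma S_cocycle:
  assumes "\<gamma> \<in> F (a, b)"
  shows "S \<gamma> \<in> cocyclesD K E (n - a) (n - b) \<longleftrightarrow> A \<gamma> = 0"
proof -
  have "A \<gamma> = 0" if "D' (S \<gamma>) = 0"
  proof (rule metric_nondegenerate)
    show "A \<gamma> \<in> VF" using assms by (simp add: A_in formsF_UNIV)
    show "pair \<alpha> (S (A \<gamma>)) = 0" if "\<alpha> \<in> VF" for \<alpha>
      using A_biform(2)[OF assms] \<open>D' (S \<gamma>) = 0\<close> that by (simp add: pair_0)
  qed
  moreover have "D' (S \<gamma>) = 0" if "A \<gamma> = 0"
    using A_biform(2)[OF assms] that by (simp add: S_0)
  ultimately show ?thesis using S_biforms[OF assms] by (auto simp: cocyclesD_def)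
qed

section \<open>The Hodge decomposition\<close>

lemma bipart_mult_incl: "bipart p (\<omega> * incl K m) = bipart p \<omega> * incl K m"
proof (induction \<omega> rule: biform_induct)
  case (biform q \<omega>)
  then show ?case by (simp add: bipart_biforms[OF biform] bipart_biforms[OF biforms_incl_right[OF biform]])
qed (simp add: distrib_right clinear_add[OF bipart_linear])

text \<open>
  The projections onto the bidegrees, transported to the tensor product along their \<open>M\<close>-linearity.
\<close>

definition bipartF :: "nat \<times> nat \<Rightarrow> ('w, 'f) tensor \<Rightarrow> ('w, 'f) tensor"
  where "bipartF p = liftF K E (\<lambda>\<omega> x. tF (bipart p \<omega>) x)"

lemma bipartF_bal: "balF id (\<lambda>\<omega> x. tF (bipart p \<omega>) x)"
  by (simp add: balanced_map_def clinear_add[OF bipart_linear] clinear_scale[OF bipart_linear]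
      bipart_mult_incl tensF_add_left tensF_add_right tensF_scale_left tensF_scale_right tensF_balanced)

lemma bipartF_tens: "bipartF p (tF \<omega> x) = tF (bipart p \<omega>) x"
  by (simp add: bipartF_def liftF_tens[OF bipartF_bal])

lemma bipartF_add: "\<alpha> \<in> VF \<Longrightarrow> \<alpha>' \<in> VF \<Longrightarrow> bipartF p (\<alpha> + \<alpha>') = bipartF p \<alpha> + bipartF p \<alpha>'"
  by (simp add: bipartF_def liftF_add[OF bipartF_bal])

lemma bipartF_in: "\<alpha> \<in> VF \<Longrightarrow> bipartF p \<alpha> \<in> F p"
  by (induction rule: VF_induct) (simp_all add: bipartF_tens bipartF_add tensF_in bipart_in formsF_closed)

lemma bipartF_biform: "\<alpha> \<in> F q \<Longrightarrow> bipartF p \<alpha> = (if p = q then \<alpha> else 0)"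
proof -
  assume "\<alpha> \<in> F q"
  then show ?thesis
    using biforms_subspace
  proof (induction rule: formsF_induct)
    case (tens \<omega> x)
    then show ?case by (simp add: bipartF_tens bipart_biforms[OF tens] tensF_0)
  next
    case (add \<alpha> \<alpha>')
    then show ?case by (simp add: bipartF_add formsF_UNIV)
  qed
qed

lemma F_disjoint: "\<alpha> \<in> F p \<Longrightarrow> \<alpha> \<in> F q \<Longrightarrow> p \<noteq> q \<Longrightarrow> \<alpha> = 0"
  using bipartF_biform[of \<alpha> p p] bipartF_biform[of \<alpha> q p] by simp

definition harmonic :: "nat \<Rightarrow> nat \<Rightarrow> ('w, 'f) tensor set"
  where "harmonic a b = {\<alpha> \<in> F (a, b). D \<alpha> = 0 \<and> A \<alpha> = 0}"

definition laplacian :: "('w, 'f) tensor \<Rightarrow> ('w, 'f) tensor"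
  where "laplacian \<alpha> = D (A \<alpha>) + A (D \<alpha>)"

lemma laplacian_square:
  assumes "\<alpha> \<in> VF"
  shows "D (D \<alpha> + A \<alpha>) + A (D \<alpha> + A \<alpha>) = laplacian \<alpha>"
  using assms by (simp add: dbar_ext_add A_add dbar_ext_in A_in dbar_ext_squared A_squared laplacian_def)

lemma laplacian_biform:
  assumes "\<alpha> \<in> F (a, b)"
  shows "laplacian \<alpha> \<in> F (a, b)"
proof -
  have "A (D \<alpha>) \<in> F (a, b)"
    using A_biform(1)[OF dbar_ext_biforms[OF assms]] by (simp add: F_below_def)
  then show ?thesis using D_F_below[OF A_biform(1)[OF assms]] by (simp add: laplacian_def formsF_closed)
qed

lemma laplacian_add: "\<alpha> \<in> VF \<Longrightarrow> \<alpha>' \<in> VF \<Longrightarrow> laplacian (\<alpha> + \<alpha>') = laplacian \<alpha> + laplacian \<alpha>'"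
  by (simp add: laplacian_def dbar_ext_add A_add dbar_ext_in A_in add_ac)

lemma laplacian_in: "\<alpha> \<in> VF \<Longrightarrow> laplacian \<alpha> \<in> VF"
  by (simp add: laplacian_def dbar_ext_in A_in formsF_closed)

lemma laplacian_bipartF: "\<alpha> \<in> VF \<Longrightarrow> bipartF p (laplacian \<alpha>) = laplacian (bipartF p \<alpha>)"
proof (induction rule: VF_biform_induct)
  case (biform a b \<alpha>)
  then show ?case
    by (simp add: bipartF_biform[OF biform] bipartF_biform[OF laplacian_biform[OF biform]])
      (simp add: laplacian_def D_0 A_0)
next
  case (add \<alpha> \<alpha>')
  then show ?case by (simp add: laplacian_add laplacian_in bipartF_add formsF_UNIV[OF bipartF_in])
qed

context
  assumes diagonalisable: "diagonalisable_kaehler K E h f"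
begin

text \<open>
  The Laplacian is the square of \<open>D + A\<close> and commutes with the projection to bidegree \<open>(a, b)\<close>, so the
  decomposition of \<open>V\<close> can be projected.  The projection of the kernel part is killed by the square of
  \<open>D + A\<close>, hence by \<open>D + A\<close>, hence by \<open>D\<close> and \<open>A\<close> separately, whose values on it have different
  bidegrees.
\<close>

lemma hodge_decomposition:
  assumes v: "v \<in> F (a, b)"
  shows "\<exists>k\<in>harmonic a b. \<exists>u\<in>F (a, b). v = k + laplacian u"
proof -
  let ?T = "\<lambda>\<alpha>. D \<alpha> + A \<alpha>"
  have diag: "diagonalisable_on VF ?T" using diagonalisable by (simp add: diagonalisable_kaehler_def)
  have T_add: "?T (x + y) = ?T x + ?T y" if "x \<in> VF" "y \<in> VF" for x y
    using that by (simp add: dbar_ext_add A_add add_ac)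
  have T_scale: "?T (c *\<^sub>C x) = c *\<^sub>C ?T x" if "x \<in> VF" for c x
    using that by (simp add: dbar_ext_scale A_scale scaleC_add_right)
  have T_in: "?T x \<in> VF" if "x \<in> VF" for x
    using that by (simp add: dbar_ext_in A_in formsF_closed)
  have T_split: "\<exists>k\<in>VF. \<exists>u\<in>VF. ?T k = 0 \<and> v = k + ?T (?T u)"
    by (rule diagonalisable_on_decomposition(1)[OF diag]; (rule T_add T_scale T_in formsF_UNIV[OF v]; assumption))
  have T_ker: "?T x = 0" if "x \<in> VF" "?T (?T x) = 0" for x
    by (rule diagonalisable_on_decomposition(2)[OF diag]; (rule T_add T_scale T_in that; assumption))
  let ?p = "(a, b)"
  obtain k u where k: "k \<in> VF" "D k + A k = 0" and u: "u \<in> VF" and "v = k + ?T (?T u)"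
    using T_split by blast
  then have "v = k + laplacian u" using laplacian_square[OF u] by simp
  then have "bipartF ?p v = bipartF ?p k + laplacian (bipartF ?p u)"
    using k u by (simp add: bipartF_add laplacian_in laplacian_bipartF)
  then have v_eq: "v = bipartF ?p k + laplacian (bipartF ?p u)"
    using bipartF_biform[OF v, of ?p] by simp
  let ?k = "bipartF ?p k"
  have kF: "?k \<in> F (a, b)" using k by (simp add: bipartF_in)
  have "laplacian k = 0" using laplacian_square[OF k(1)] k(2) by (simp add: D_0 A_0)
  then have "laplacian ?k = 0"
    using laplacian_bipartF[OF k(1), of ?p] bipartF_biform[OF formsF_closed(1), of ?p ?p] by simp
  then have "?T ?k = 0"
    using T_ker[OF formsF_UNIV[OF kF]] laplacian_square[OF formsF_UNIV[OF kF]] by simp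
  then have D_A: "D ?k = (-1) *\<^sub>C A ?k" by (simp add: scaleC_one eq_neg_iff_add_eq_0)
  have D1: "D ?k \<in> F (a, b + 1)" by (rule dbar_ext_biforms[OF kF])
  have "D ?k = 0"
  proof (cases b)
    case 0
    then show ?thesis using A_biform(1)[OF kF] D_A by (simp add: F_below_def)
  next
    case (Suc b')
    then have "A ?k \<in> F (a, b')" using A_biform(1)[OF kF] by (simp add: F_below_def)
    then have "D ?k \<in> F (a, b')" unfolding D_A by (rule formsF_closed)
    then show ?thesis using F_disjoint[OF D1] Suc by simp
  qed
  moreover from this have "A ?k = 0" using \<open>?T ?k = 0\<close> by simp
  ultimately have "?k \<in> harmonic a b" using kF by (simp add: harmonic_def)
  then show ?thesis using v_eq bipartF_in[OF u, of ?p] by blast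
qed

text \<open>
  A harmonic form is orthogonal to the images of \<open>D\<close> and \<open>A\<close> and to all other bidegrees, so a harmonic
  form orthogonal to all harmonic forms is orthogonal to everything.
\<close>

lemma harmonic_nondegenerate:
  assumes k: "k \<in> harmonic a b" and "\<And>k'. k' \<in> harmonic a b \<Longrightarrow> pair k (S k') = 0"
  shows "k = 0"
proof (rule metric_nondegenerate)
  have kF: "k \<in> F (a, b)" and Dk: "D k = 0" and Ak: "A k = 0" using k by (auto simp: harmonic_def)
  show kV: "k \<in> VF" using kF by (rule formsF_UNIV)
  fix v assume "v \<in> VF"
  then show "pair v (S k) = 0"
  proof (induction rule: VF_biform_induct)
    case (biform c d v)
    show ?case
    proof (cases "(c, d) = (a, b)")
      case True
      then obtain k' u where k': "k' \<in> harmonic a b" and u: "u \<in> F (a, b)" and v: "v = k' + laplacian u"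
        using hodge_decomposition[of v a b] biform by auto
      have VF: "k' \<in> VF" "u \<in> VF" using k' u by (auto simp: harmonic_def formsF_UNIV)
      have "pair (D (A u)) (S k) = 0"
        using VF kV by (simp add: A_pair A_in Ak S_0 pair_0)
      moreover have "pair k (S (A (D u))) = 0"
        using VF kV A_pair[of k "D u"] by (simp add: dbar_ext_in Dk pair_0 S_in)
      then have "pair (A (D u)) (S k) = 0"
        using VF kV pair_hermitian[of "A (D u)" k] by (simp add: A_in dbar_ext_in)
      moreover have "pair k' (S k) = 0" using assms(2)[OF k'] pair_hermitian[OF VF(1) kV] by simp
      ultimately show ?thesis
        using VF kV by (simp add: v laplacian_def pair_add_left S_in A_in dbar_ext_in formsF_closed)
    next
      case False
      show ?thesis
      proof (cases "a \<le> n \<and> b \<le> n")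
        case True
        then show ?thesis using False by (intro pair_bidegree[OF biform S_biforms[OF kF]]) auto
      next
        case outside: False
        then have "k = 0" using F_outside[OF kF] by blast
        then show ?thesis using formsF_UNIV[OF biform] by (simp add: S_0 pair_0)
      qed
    qed
  next
    case (add v v')
    then show ?case using kV by (simp add: pair_add_left S_in)
  qed
qed

text \<open>
  If \<open>\<alpha> = k + D A u + A D u\<close> is a cocycle, then \<open>A D u\<close> is killed by \<open>D\<close> as well as by \<open>A\<close>, so it belongs
  to the harmonic part.
\<close>

lemma cocycleF_split:
  assumes "\<alpha> \<in> cocyclesF K E a b"
  shows "\<exists>k\<in>harmonic a b. \<exists>x\<in>F_below a b. \<alpha> = k + D x"
proof -
  have \<alpha>: "\<alpha> \<in> F (a, b)" "D \<alpha> = 0" using assms by (auto simp: cocyclesF_def)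
  obtain k u where k: "k \<in> F (a, b)" "D k = 0" "A k = 0" and u: "u \<in> F (a, b)" and eq: "\<alpha> = k + laplacian u"
    using hodge_decomposition[OF \<alpha>(1)] by (auto simp: harmonic_def)
  have VF: "k \<in> VF" "u \<in> VF" using k u by (auto simp: formsF_UNIV)
  let ?w = "A (D u)"
  have w: "?w \<in> F (a, b)" using A_biform(1)[OF dbar_ext_biforms[OF u]] by (simp add: F_below_def)
  have "D \<alpha> = D ?w"
    using VF by (simp add: eq laplacian_def dbar_ext_add dbar_ext_in A_in formsF_closed dbar_ext_squared k)
  then have "k + ?w \<in> harmonic a b"
    using VF w k \<alpha> by (simp add: harmonic_def formsF_closed dbar_ext_add A_add A_in dbar_ext_in A_squared)
  moreover have "\<alpha> = (k + ?w) + D (A u)" by (simp add: eq laplacian_def add_ac)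
  ultimately show ?thesis using A_biform(1)[OF u] by blast
qed

text \<open>
  As for cocycles, with the roles of \<open>D\<close> and \<open>A\<close> exchanged: here \<open>D A u\<close> is harmonic.
\<close>

lemma adjoint_cocycle_split:
  assumes "\<gamma> \<in> F (a, b)" "A \<gamma> = 0"
  shows "\<exists>k\<in>harmonic a b. \<exists>y\<in>F (a, b + 1). \<gamma> = k + A y"
proof -
  obtain k u where k: "k \<in> F (a, b)" "D k = 0" "A k = 0" and u: "u \<in> F (a, b)" and eq: "\<gamma> = k + laplacian u"
    using hodge_decomposition[OF assms(1)] by (auto simp: harmonic_def)
  have VF: "k \<in> VF" "u \<in> VF" using k u by (auto simp: formsF_UNIV)
  let ?w = "D (A u)"
  have w: "?w \<in> F (a, b)" by (rule D_F_below[OF A_biform(1)[OF u]])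
  have "A \<gamma> = A ?w"
    using VF by (simp add: eq laplacian_def A_add dbar_ext_in A_in formsF_closed A_squared k)
  then have "k + ?w \<in> harmonic a b"
    using VF w k assms by (simp add: harmonic_def formsF_closed dbar_ext_add A_add A_in dbar_ext_in dbar_ext_squared)
  moreover have "\<gamma> = (k + ?w) + A (D u)" by (simp add: eq laplacian_def add_ac)
  ultimately show ?thesis using dbar_ext_biforms[OF u] by blast
qed

text \<open>
  Testing against \<open>S k'\<close> with \<open>k'\<close> harmonic only sees the harmonic part of \<open>\<alpha>\<close>.
\<close>

lemma pairing_left_kernel:
  assumes \<alpha>: "\<alpha> \<in> cocyclesF K E a b"
    and zero: "\<And>\<beta>. \<beta> \<in> cocyclesD K E (n - a) (n - b) \<Longrightarrow> pair \<alpha> \<beta> = 0"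
  shows "\<alpha> \<in> coboundariesF K E a b"
proof -
  obtain k x where k: "k \<in> harmonic a b" and x: "x \<in> F_below a b" and eq: "\<alpha> = k + D x"
    using cocycleF_split[OF \<alpha>] by blast
  have kV: "k \<in> VF" using k by (auto simp: harmonic_def formsF_UNIV)
  have "k = 0"
  proof (rule harmonic_nondegenerate[OF k])
    fix k' assume k': "k' \<in> harmonic a b"
    then have cyc: "S k' \<in> cocyclesD K E (n - a) (n - b)" by (simp add: S_cocycle harmonic_def)
    then have "pair (D x) (S k') = 0"
      using pair_coboundaryF[of "D x" a b] x by (simp add: coboundariesF_eq)
    moreover have "S k' \<in> VD" using cyc by (auto simp: cocyclesD_def formsD_UNIV)
    ultimately show "pair k (S k') = 0"
      using zero[OF cyc] kV F_below_VF[OF x] by (simp add: eq pair_add_left dbar_ext_in)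
  qed
  then show ?thesis using x by (simp add: eq coboundariesF_eq)
qed

text \<open>
  Write \<open>\<beta> = S(k + A y)\<close> with \<open>k\<close> harmonic.  Testing against harmonic forms shows \<open>k = 0\<close>, and \<open>S A y\<close> is
  a coboundary because \<open>S A = \<plusminus> D' S\<close>.
\<close>

lemma pairing_right_kernel:
  assumes ab: "a \<le> n" "b \<le> n" and \<beta>: "\<beta> \<in> cocyclesD K E (n - a) (n - b)"
    and zero: "\<And>\<alpha>. \<alpha> \<in> cocyclesF K E a b \<Longrightarrow> pair \<alpha> \<beta> = 0"
  shows "\<beta> \<in> coboundariesD K E (n - a) (n - b)"
proof -
  obtain \<gamma> where \<gamma>: "\<gamma> \<in> F (a, b)" "S \<gamma> = \<beta>" using S_surj[OF ab] \<beta> by (auto simp: cocyclesD_def)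
  then have "A \<gamma> = 0" using S_cocycle[OF \<gamma>(1)] \<beta> by simp
  from adjoint_cocycle_split[OF \<gamma>(1) this] obtain k y
    where k: "k \<in> harmonic a b" and y: "y \<in> F (a, b + 1)" and eq: "\<gamma> = k + A y" by blast
  have VF: "k \<in> VF" "y \<in> VF" using k y by (auto simp: harmonic_def formsF_UNIV)
  have "k = 0"
  proof (rule harmonic_nondegenerate[OF k])
    fix k' assume k': "k' \<in> harmonic a b"
    then have k'V: "k' \<in> VF" and cyc: "k' \<in> cocyclesF K E a b" by (auto simp: harmonic_def formsF_UNIV cocyclesF_def)
    have "pair k' (S (A y)) = 0"
      using A_pair[OF k'V VF(2)] k' VF by (simp add: harmonic_def pair_0 S_in)
    then have "pair k' (S k) = 0"
      using zero[OF cyc] VF k'V by (simp add: \<gamma>(2)[symmetric] eq S_add A_in pair_add_right S_in)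
    then show "pair k (S k') = 0" using pair_hermitian[OF VF(1) k'V] by simp
  qed
  then have \<beta>_eq: "\<beta> = (-1) ^ (a + (b + 1)) *\<^sub>C D' (S y)"
    using \<gamma> eq A_biform(2)[OF y] by simp
  show ?thesis
  proof (cases "n - b")
    \<comment> \<open>here \<open>b = n\<close>, and \<open>y\<close> has bidegree \<open>(a, n + 1)\<close>\<close>
    case 0
    then have "y = 0" using F_outside[OF y] ab by simp
    then show ?thesis using 0 \<beta>_eq by (simp add: coboundariesD_def S_0 D'_0)
  next
    case (Suc d)
    then have "S y \<in> G (n - a, d)" using S_biforms[OF y] by (simp add: Suc_diff_Suc) (metis diff_Suc_1 diff_Suc_eq_diff_pred diff_commute)
    then have "D' (S y) \<in> coboundariesD K E (n - a) (n - b)" by (simp add: coboundariesD_def Suc)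
    then show ?thesis unfolding \<beta>_eq by (rule cvec.subspace_scale[OF coboundariesD_subspace])
  qed
qed

end

end

theorem theorem6p8:
  fixes H :: "'a::complex_star_algebra hopf"
    and K :: "('a, 'm::complex_star_algebra, 'w::complex_algebra_1) kaehler"
    and E :: "('a, 'm, 'w, 'f::complex_vector) bundle_data"
    and h :: "'f \<Rightarrow> 'f \<Rightarrow> 'm"
    and f :: "'m \<Rightarrow> complex"
    and a b :: nat
  assumes "hopf_star_algebra H"
    and "kaehler_structure H K"
    and "positive_definite_kaehler K"
    and "state f"
    and "closed_integral K f"
    and "holomorphic_vector_bundle H K E"
    and "hermitian_structure H K E h"
    and "positive_definite_hermitian h"
    and "diagonalisable_kaehler K E h f"
    and "a \<le> half_dim K" and "b \<le> half_dim K"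
  shows "\<exists>P. (\<forall>\<alpha>\<in>cocyclesF K E a b. \<forall>\<beta>\<in>cocyclesD K E (half_dim K - a) (half_dim K - b).
             P (coset (coboundariesF K E a b) \<alpha>) (coset (coboundariesD K E (half_dim K - a) (half_dim K - b)) \<beta>)
               = form_integral K f (ev K E \<alpha> \<beta>)) \<and>
           bilinear_pairing (coboundariesF K E a b) (cohomologyF K E a b)
             (coboundariesD K E (half_dim K - a) (half_dim K - b)) (cohomologyD K E (half_dim K - a) (half_dim K - b)) P \<and>
           nondegenerate_pairing (coboundariesF K E a b) (cohomologyF K E a b)
             (coboundariesD K E (half_dim K - a) (half_dim K - b)) (cohomologyD K E (half_dim K - a) (half_dim K - b)) P"
proof -
  interpret kaehler_hermitian H K f E h
    using assms by unfold_locales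
  have VF: "\<alpha> \<in> VF" if "\<alpha> \<in> cocyclesF K E a b" for \<alpha>
    using that formsF_UNIV by (auto simp: cocyclesF_def)
  have VD: "\<beta> \<in> VD" if "\<beta> \<in> cocyclesD K E (n - a) (n - b)" for \<beta>
    using that formsD_UNIV by (auto simp: cocyclesD_def)
  show ?thesis
    unfolding cohomologyF_def cohomologyD_def pair_def[symmetric]
  proof (rule pairing_on_cosets)
    show "\<alpha> \<in> coboundariesF K E a b"
      if "\<alpha> \<in> cocyclesF K E a b" "\<And>\<beta>. \<beta> \<in> cocyclesD K E (n - a) (n - b) \<Longrightarrow> pair \<alpha> \<beta> = 0" for \<alpha>
      by (rule pairing_left_kernel[OF assms(9) that])
    show "\<beta> \<in> coboundariesD K E (n - a) (n - b)"
      if "\<beta> \<in> cocyclesD K E (n - a) (n - b)" "\<And>\<alpha>. \<alpha> \<in> cocyclesF K E a b \<Longrightarrow> pair \<alpha> \<beta> = 0" for \<beta>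
      by (rule pairing_right_kernel[OF assms(9-11) that])
  qed (simp_all add: VF VD cocyclesF_subspace cocyclesD_subspace coboundariesF_subspace
      coboundariesD_subspace coboundariesF_sub coboundariesD_sub pair_add_left pair_add_right
      pair_scale_left pair_scale_right pair_coboundaryF pair_coboundaryD)
qed

end
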